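(* There are absolute constants $C,b,c>0$ such that the following holds. Let $d\in\mathbb N$ and let $w(k)>0$, $k\in\mathbb Z^d$, be weights with $\sum_{k\in\mathbb Z^d}w(k)^{-2}<\infty$. Then for all integers $n\ge2$ the sampling numbers of the embedding $\mathrm I_w\colon H^w(\mathbb T^d)\to L_\infty(\mathbb T^d)$ satisfy $$g_n(\mathrm I_w)\le C\min\Big\{a_{\lfloor n/(b\log n)\rfloor}(\mathrm I_w),\ \sqrt{\log n}\;a_{\lfloor cn\rfloor}(\mathrm I_w)\Big\}.$$ Moreover, $$a_n(\mathrm I_w)^2\le\sum_{k\ge n+1}\tau_k^2,$$ where $(\tau_k)_{k\ge1}$ is the non-increasing rearrangement of $(1/w(k))_{k\in\mathbb Z^d}$.
   Context: $\log$ is the natural logarithm. $\mathbb T=[0,2\pi]$ with endpoints identified; $\mathbb T^d$ carries the measure $(2\pi)^{-d}dx$. For integrable $f$, $c_k(f)=(2\pi)^{-d}\int_{\mathbb T^d}f(x)e^{-ik\cdot x}dx$. $H^w(\mathbb T^d)$ is the Hilbert space of integrable functions on $\mathbb T^d$ with $\|f\|_{H^w(\mathbb T^d)}=\big(\sum_{k\in\mathbb Z^d}w(k)^2|c_k(f)|^2\big)^{1/2}<\infty$; under the summability condition its elements are identified with continuous functions, and it is a reproducing kernel Hilbert space with kernel $\sum_{k}w(k)^{-2}e^{ik\cdot(x-y)}$. For the embedding $\mathrm I_w\colon H\to F$ with $H=H^w(\mathbb T^d)$, $F=L_\infty(\mathbb T^d)$: approximation numbers $a_n(\mathrm I_w):=\inf\{\sup_{\|f\|_H\le1}\|f-Af\|_F:\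 A\colon H\to F\text{ linear continuous},\ \operatorname{rank}A<n\}$ (with $a_0=\inf\emptyset=+\infty$); sampling numbers $g_n(\mathrm I_w):=\inf_{x^1,\dots,x^n\in\mathbb T^d}\inf_R\sup_{\|f\|_H\le1}\|f-R(f(x^1),\dots,f(x^n))\|_F$, where $R$ runs over linear maps $\mathbb C^n\to F$.
   Formalization: With a_n defined by rank A < n, the "Moreover" bound as stated is false for every n (a_1² equals the full sum over k ≥ 1); what is proved is a_{n+1}(I_w)² ≤ sum over k ≥ n+1 of τ_k², for all n ≥ 0. *)

theory Defs
  imports "HOL-Analysis.Analysis" "HOL-Probability.Essential_Supremum"
begin

text \<open>
  The dimension d is quantified inside the theorem (the constants must not depend on it), so
  points of the torus and frequencies are extensional functions on the index set {..<d}.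
  The circle is the closed interval [0, 2*pi] with identified end points; the identification
  only matters for continuity, since it concerns a null set.
\<close>

definition torus_points :: "nat \<Rightarrow> (nat \<Rightarrow> real) set" where
  "torus_points d = (\<Pi>\<^sub>E i\<in>{..<d}. {0..2 * pi})"

definition torus :: "nat \<Rightarrow> (nat \<Rightarrow> real) measure" where
  "torus d = (\<Pi>\<^sub>M i\<in>{..<d}. scale_measure (ennreal (1 / (2 * pi))) (restrict_space lborel {0..2 * pi}))"

definition torus_identified :: "nat \<Rightarrow> (nat \<Rightarrow> real) \<Rightarrow> (nat \<Rightarrow> real) \<Rightarrow> bool" where
  "torus_identified d x y \<longleftrightarrow> (\<forall>i<d. x i = y i \<or> {x i, y i} = {0, 2 * pi})"

text \<open>Continuous functions on the quotient are the continuous functions on the cube that respect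
  the identification.\<close>

definition torus_continuous :: "nat \<Rightarrow> ((nat \<Rightarrow> real) \<Rightarrow> complex) \<Rightarrow> bool" where
  "torus_continuous d f \<longleftrightarrow> continuous_on (torus_points d) f \<and>
     (\<forall>x\<in>torus_points d. \<forall>y\<in>torus_points d. torus_identified d x y \<longrightarrow> f x = f y)"

definition frequencies :: "nat \<Rightarrow> (nat \<Rightarrow> int) set" where
  "frequencies d = (\<Pi>\<^sub>E i\<in>{..<d}. UNIV)"

definition fourier_coeff :: "nat \<Rightarrow> ((nat \<Rightarrow> real) \<Rightarrow> complex) \<Rightarrow> (nat \<Rightarrow> int) \<Rightarrow> complex" where
  "fourier_coeff d f k =
     (LINT x|torus d. f x * exp (- (\<i> * complex_of_real (\<Sum>i<d. real_of_int (k i) * x i))))"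

text \<open>
  Elements of H and of the target space L-infinity are represented by functions, with equality
  almost everywhere on the torus as equality of elements.
\<close>

definition Hw :: "nat \<Rightarrow> ((nat \<Rightarrow> int) \<Rightarrow> real) \<Rightarrow> ((nat \<Rightarrow> real) \<Rightarrow> complex) set" where
  "Hw d w = {f. integrable (torus d) f \<and>
     (\<lambda>k. (w k)\<^sup>2 * (cmod (fourier_coeff d f k))\<^sup>2) summable_on frequencies d}"

definition Hw_norm :: "nat \<Rightarrow> ((nat \<Rightarrow> int) \<Rightarrow> real) \<Rightarrow> ((nat \<Rightarrow> real) \<Rightarrow> complex) \<Rightarrow> real" where
  "Hw_norm d w f = sqrt (\<Sum>\<^sub>\<infinity>k\<in>frequencies d. (w k)\<^sup>2 * (cmod (fourier_coeff d f k))\<^sup>2)"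

definition Hw_ball :: "nat \<Rightarrow> ((nat \<Rightarrow> int) \<Rightarrow> real) \<Rightarrow> ((nat \<Rightarrow> real) \<Rightarrow> complex) set" where
  "Hw_ball d w = {f \<in> Hw d w. Hw_norm d w f \<le> 1}"

text \<open>Point evaluation on H refers to this representative, which exists for every element of H
  when the inverse squared weights are summable, and is then unique on the torus.\<close>

definition cont_rep :: "nat \<Rightarrow> ((nat \<Rightarrow> real) \<Rightarrow> complex) \<Rightarrow> (nat \<Rightarrow> real) \<Rightarrow> complex" where
  "cont_rep d f = (SOME g. torus_continuous d g \<and> (AE x in torus d. f x = g x))"

definition Linf_norm :: "nat \<Rightarrow> ((nat \<Rightarrow> real) \<Rightarrow> complex) \<Rightarrow> ennreal" where
  "Linf_norm d f = esssup (torus d) (\<lambda>x. ennreal (cmod (f x)))"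

definition Linf :: "nat \<Rightarrow> ((nat \<Rightarrow> real) \<Rightarrow> complex) set" where
  "Linf d = {f \<in> borel_measurable (torus d). Linf_norm d f < \<infinity>}"

text \<open>Linear continuous maps from H to L-infinity. Linearity and boundedness force such a map to
  send almost everywhere equal functions to almost everywhere equal functions.\<close>

definition Hw_operators ::
    "nat \<Rightarrow> ((nat \<Rightarrow> int) \<Rightarrow> real) \<Rightarrow> (((nat \<Rightarrow> real) \<Rightarrow> complex) \<Rightarrow> ((nat \<Rightarrow> real) \<Rightarrow> complex)) set" where
  "Hw_operators d w = {A.
     (\<forall>f\<in>Hw d w. A f \<in> Linf d) \<and>
     (\<forall>f\<in>Hw d w. \<forall>g\<in>Hw d w. \<forall>a b. AE x in torus d.
        A (\<lambda>y. a * f y + b * g y) x = a * A f x + b * A g x) \<and>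
     (\<exists>B. \<forall>f\<in>Hw d w. Linf_norm d (A f) \<le> ennreal (B * Hw_norm d w f))}"

text \<open>The range, as a subspace of L-infinity, is spanned by fewer than n elements.\<close>

definition rank_less ::
    "nat \<Rightarrow> ((nat \<Rightarrow> int) \<Rightarrow> real) \<Rightarrow> (((nat \<Rightarrow> real) \<Rightarrow> complex) \<Rightarrow> ((nat \<Rightarrow> real) \<Rightarrow> complex)) \<Rightarrow> nat \<Rightarrow> bool" where
  "rank_less d w A n \<longleftrightarrow> (\<exists>m<n. \<exists>\<phi> :: nat \<Rightarrow> (nat \<Rightarrow> real) \<Rightarrow> complex.
     (\<forall>i<m. \<phi> i \<in> Linf d) \<and>
     (\<forall>f\<in>Hw d w. \<exists>c :: nat \<Rightarrow> complex. AE x in torus d. A f x = (\<Sum>i<m. c i * \<phi> i x)))"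

text \<open>The infimum over the empty set in \<^typ>\<open>ennreal\<close> is infinite, so the number with index 0 is
  infinite.\<close>

definition approx_number :: "nat \<Rightarrow> ((nat \<Rightarrow> int) \<Rightarrow> real) \<Rightarrow> nat \<Rightarrow> ennreal" where
  "approx_number d w n =
     (INF A\<in>{A \<in> Hw_operators d w. rank_less d w A n}.
        SUP f\<in>Hw_ball d w. Linf_norm d (\<lambda>x. f x - A f x))"

definition reconstructions :: "nat \<Rightarrow> nat \<Rightarrow> ((nat \<Rightarrow> complex) \<Rightarrow> ((nat \<Rightarrow> real) \<Rightarrow> complex)) set" where
  "reconstructions d n = {R.
     (\<forall>u\<in>{..<n} \<rightarrow>\<^sub>E UNIV. R u \<in> Linf d) \<and>
     (\<forall>u\<in>{..<n} \<rightarrow>\<^sub>E UNIV. \<forall>v\<in>{..<n} \<rightarrow>\<^sub>E UNIV. \<forall>a b. AE x in torus d.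
        R (\<lambda>j\<in>{..<n}. a * u j + b * v j) x = a * R u x + b * R v x)}"

definition sampling_number :: "nat \<Rightarrow> ((nat \<Rightarrow> int) \<Rightarrow> real) \<Rightarrow> nat \<Rightarrow> ennreal" where
  "sampling_number d w n =
     (INF X\<in>{..<n} \<rightarrow>\<^sub>E torus_points d. INF R\<in>reconstructions d n.
        SUP f\<in>Hw_ball d w. Linf_norm d (\<lambda>x. f x - R (\<lambda>j\<in>{..<n}. cont_rep d f (X j)) x))"

text \<open>The sequence is indexed from 1; its value at 0 is irrelevant.\<close>

definition nonincreasing_rearrangement :: "('a \<Rightarrow> real) \<Rightarrow> 'a set \<Rightarrow> (nat \<Rightarrow> real) \<Rightarrow> bool" where
  "nonincreasing_rearrangement u S \<tau> \<longleftrightarrow>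
     (\<exists>\<sigma>. bij_betw \<sigma> {1..} S \<and> (\<forall>k\<ge>1. \<tau> k = u (\<sigma> k))) \<and>
     (\<forall>j k. 1 \<le> j \<and> j \<le> k \<longrightarrow> \<tau> k \<le> \<tau> j)"

text \<open>
  A pitfall about indices: \<^const>\<open>approx_number\<close> uses the strict rank condition rank A < n, and
  with it the number of index n equals the root of the tail sum of the squared rearrangement from
  k = n on (for n = 1 the only competitor is A = 0, and the squared operator norm of the embedding
  is the full sum from k = 1). The tail sum from k = n + 1 on therefore bounds the number of index
  n + 1, that is, the best approximation by operators of rank at most n.
\<close>

end

theory Submission
  imports Defs "HOL-Probability.Infinite_Product_Measure"
begin

text \<open>
  Let \<open>V\<close> be a set of \<open>m\<close> frequencies with the smallest weights and \<open>T\<close> the sum of \<open>w(k)\<^sup>-\<^sup>2\<close> over the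
  remaining ones. The approximation number of index \<open>m + 1\<close> equals the root of \<open>T\<close>: the Fourier
  projection onto \<open>V\<close> attains it, and for any operator of rank at most \<open>m\<close> the squared errors on
  the functions \<open>w(k)\<^sup>-\<^sup>1 e\<^sub>k\<close>, summed pointwise and integrated, are at least \<open>T\<close>.

  Both bounds for the sampling numbers follow from the stronger fact that \<open>16 m\<close> points always
  achieve an error of at most \<open>4\<close> times the root of \<open>T\<close>, without any logarithm. The points are found
  by a barrier argument in the spirit of Batson, Spielman and Srivastava. With
  \<open>z\<^sub>x = (e\<^sub>k(x))\<close> on \<open>V\<close> and \<open>z\<^sub>x = (w(k)\<^sup>-\<^sup>1 T\<^sup>-\<^sup>1\<^sup>/\<^sup>2 e\<^sub>k(x))\<close> off \<open>V\<close>, and \<open>P\<close> the projection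
  onto the coordinates in \<open>V\<close>, one keeps
  \<open>N = \<Sum>\<^sub>i z\<^sub>i z\<^sub>i\<^sup>* / 4 + (1 - P) - l P\<close> positive while \<open>l\<close> grows from \<open>-m\<close> to \<open>m\<close> in steps of \<open>1/8\<close>: the potential
  \<open>tr D N\<^sup>-\<^sup>1\<close>, where \<open>D\<close> is the mean of \<open>z\<^sub>x z\<^sub>x\<^sup>*\<close>, stays at most \<open>2\<close>, because on average a new point
  lowers it by as much as the shift raises it. The final positivity says that least squares
  at the chosen points, regularised off \<open>V\<close>, is stable with constant \<open>m\<close> on \<open>V\<close>, which the
  inequality \<open>\<parallel>p\<parallel>\<^sub>\<infinity> \<le> m\<^sup>1\<^sup>/\<^sup>2 \<parallel>p\<parallel>\<^sub>2\<close> for \<open>p\<close> in the span of \<open>V\<close> turns into the uniform bound.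
\<close>

section \<open>Self-adjoint operators on a finite index set\<close>

definition ip :: "'k set \<Rightarrow> ('k \<Rightarrow> complex) \<Rightarrow> ('k \<Rightarrow> complex) \<Rightarrow> complex" where
  "ip I a b = (\<Sum>i\<in>I. cnj (a i) * b i)"

definition unit_vec :: "'k \<Rightarrow> 'k \<Rightarrow> complex" where
  "unit_vec k = (\<lambda>i. if i = k then 1 else 0)"

text \<open>Operators on the coordinate space over a finite index set are plain functions; their
  values outside the index set are irrelevant, and self-adjointness forces linearity on it.\<close>

definition selfadj :: "'k set \<Rightarrow> (('k \<Rightarrow> complex) \<Rightarrow> ('k \<Rightarrow> complex)) \<Rightarrow> bool" where
  "selfadj I Y \<longleftrightarrow> (\<forall>a b. ip I a (Y b) = ip I (Y a) b)"

definition quad_form :: "'k set \<Rightarrow> (('k \<Rightarrow> complex) \<Rightarrow> ('k \<Rightarrow> complex)) \<Rightarrow> ('k \<Rightarrow> complex) \<Rightarrow> real" where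
  "quad_form I Y a = Re (ip I a (Y a))"

definition psd :: "'k set \<Rightarrow> (('k \<Rightarrow> complex) \<Rightarrow> ('k \<Rightarrow> complex)) \<Rightarrow> bool" where
  "psd I Y \<longleftrightarrow> selfadj I Y \<and> (\<forall>a. 0 \<le> quad_form I Y a)"

text \<open>Only one order is recorded: for self-adjoint operators the adjoint of
  \<open>N Y = 1\<close> is \<open>Y N = 1\<close>, so inside \<open>ip\<close> the other order is
  reached by moving both operators across.\<close>

definition right_inverse :: "'k set \<Rightarrow> (('k \<Rightarrow> complex) \<Rightarrow> ('k \<Rightarrow> complex)) \<Rightarrow>
    (('k \<Rightarrow> complex) \<Rightarrow> ('k \<Rightarrow> complex)) \<Rightarrow> bool" where
  "right_inverse I N Y \<longleftrightarrow> (\<forall>a. \<forall>i\<in>I. N (Y a) i = a i)"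

definition rank_one_update :: "'k set \<Rightarrow> (('k \<Rightarrow> complex) \<Rightarrow> ('k \<Rightarrow> complex)) \<Rightarrow> real \<Rightarrow>
    ('k \<Rightarrow> complex) \<Rightarrow> (('k \<Rightarrow> complex) \<Rightarrow> ('k \<Rightarrow> complex))" where
  "rank_one_update I Y \<kappa> z = (\<lambda>a i. Y a i + of_real \<kappa> * ip I z a * z i)"

definition shift_op :: "(('k \<Rightarrow> complex) \<Rightarrow> ('k \<Rightarrow> complex)) \<Rightarrow> real \<Rightarrow> 'k set \<Rightarrow>
    (('k \<Rightarrow> complex) \<Rightarrow> ('k \<Rightarrow> complex))" where
  "shift_op N \<delta> S = (\<lambda>a i. N a i + (if i \<in> S then of_real \<delta> * a i else 0))"

text \<open>The real part of the trace of \<open>diag_op D\<close> times \<open>Y\<close>. With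
  \<open>Y\<close> the inverse of the current operator it is the potential of the barrier
  argument.\<close>

definition wtrace :: "'k set \<Rightarrow> ('k \<Rightarrow> real) \<Rightarrow> (('k \<Rightarrow> complex) \<Rightarrow> ('k \<Rightarrow> complex)) \<Rightarrow> real" where
  "wtrace I D Y = (\<Sum>k\<in>I. D k * Re (Y (unit_vec k) k))"

definition diag_op :: "('k \<Rightarrow> real) \<Rightarrow> ('k \<Rightarrow> complex) \<Rightarrow> ('k \<Rightarrow> complex)" where
  "diag_op D a = (\<lambda>i. of_real (D i) * a i)"

lemma ip_add_right: "ip I a (\<lambda>i. b i + c i) = ip I a b + ip I a c"
  and ip_add_left: "ip I (\<lambda>i. b i + c i) a = ip I b a + ip I c a"
  and ip_scale_right: "ip I a (\<lambda>i. \<alpha> * b i) = \<alpha> * ip I a b"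
  and ip_scale_left: "ip I (\<lambda>i. \<alpha> * b i) a = cnj \<alpha> * ip I b a"
  by (simp_all add: ip_def algebra_simps sum.distrib sum_distrib_left)

lemma cnj_ip: "cnj (ip I a b) = ip I b a"
  by (simp add: ip_def mult.commute)

lemma ip_cong: "(\<And>i. i \<in> I \<Longrightarrow> a i = a' i) \<Longrightarrow> (\<And>i. i \<in> I \<Longrightarrow> b i = b' i) \<Longrightarrow> ip I a b = ip I a' b'"
  by (simp add: ip_def)

lemma ip_self: "ip I a a = of_real (\<Sum>i\<in>I. (cmod (a i))\<^sup>2)"
  unfolding ip_def of_real_sum
  by (intro sum.cong refl) (metis complex_norm_square mult.commute)

lemma ip_unit: "finite I \<Longrightarrow> k \<in> I \<Longrightarrow> ip I (unit_vec k) a = a k"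
  by (simp add: ip_def unit_vec_def if_distrib[of cnj] if_distrib[of "\<lambda>x. x * _"] cong: if_cong)

lemma ip_diag: "ip I a (diag_op D b) = ip I (diag_op D a) b"
  unfolding ip_def diag_op_def by (intro sum.cong refl) simp

lemma ip_diag_self: "ip I a (diag_op D a) = of_real (\<Sum>i\<in>I. D i * (cmod (a i))\<^sup>2)"
  unfolding ip_def diag_op_def of_real_sum
  by (intro sum.cong refl) (metis (no_types, lifting) complex_norm_square mult.commute mult.left_commute of_real_mult)

lemma ip_norm_bound:
  "(cmod (ip I a b))\<^sup>2 \<le> (\<Sum>i\<in>I. (cmod (a i))\<^sup>2) * (\<Sum>i\<in>I. (cmod (b i))\<^sup>2)"
proof -
  have "cmod (ip I a b) \<le> (\<Sum>i\<in>I. cmod (a i) * cmod (b i))"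
    unfolding ip_def by (rule order_trans[OF norm_sum]) (simp add: norm_mult)
  then have "(cmod (ip I a b))\<^sup>2 \<le> (\<Sum>i\<in>I. cmod (a i) * cmod (b i))\<^sup>2"
    by (rule power_mono) simp
  also have "\<dots> \<le> (\<Sum>i\<in>I. (cmod (a i))\<^sup>2) * (\<Sum>i\<in>I. (cmod (b i))\<^sup>2)"
    by (rule Cauchy_Schwarz_ineq_sum)
  finally show ?thesis .
qed

lemma selfadjD: "selfadj I Y \<Longrightarrow> ip I a (Y b) = ip I (Y a) b"
  by (simp add: selfadj_def)

lemma selfadj_entry: "finite I \<Longrightarrow> selfadj I Y \<Longrightarrow> i \<in> I \<Longrightarrow> Y a i = ip I (Y (unit_vec i)) a"
  by (metis ip_unit selfadjD)

lemma psd_selfadj: "psd I Y \<Longrightarrow> selfadj I Y"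
  by (simp add: psd_def)

lemma quad_form_complex: "selfadj I Y \<Longrightarrow> ip I a (Y a) = of_real (quad_form I Y a)"
  by (metis quad_form_def cnj_ip complex_is_Real_iff of_real_Re Reals_cnj_iff selfadjD)

lemma quad_form_unit: "finite I \<Longrightarrow> k \<in> I \<Longrightarrow> quad_form I Y (unit_vec k) = Re (Y (unit_vec k) k)"
  by (simp add: quad_form_def ip_unit)

lemma selfadj_lincomb:
  assumes "finite I" "selfadj I Y" "i \<in> I"
  shows "Y (\<lambda>j. a j + \<alpha> * b j) i = Y a i + \<alpha> * Y b i"
  using assms by (simp add: selfadj_entry[OF assms(1,2)] ip_add_right ip_scale_right)

lemma quad_form_lincomb:
  assumes "finite I" "selfadj I Y"
  shows "quad_form I Y (\<lambda>i. a i + t * b i)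
     = quad_form I Y a + 2 * Re (t * ip I a (Y b)) + (cmod t)\<^sup>2 * quad_form I Y b"
proof -
  have "ip I (\<lambda>i. a i + t * b i) (Y (\<lambda>i. a i + t * b i))
      = ip I (\<lambda>i. a i + t * b i) (\<lambda>i. Y a i + t * Y b i)"
    by (rule ip_cong) (simp_all add: selfadj_lincomb[OF assms])
  also have "\<dots> = ip I a (Y a) + t * ip I a (Y b) + cnj t * ip I b (Y a) + cnj t * t * ip I b (Y b)"
    by (simp add: ip_add_left ip_add_right ip_scale_left ip_scale_right algebra_simps)
  also have "ip I b (Y a) = cnj (ip I a (Y b))"
    by (simp add: cnj_ip selfadjD[OF assms(2)])
  also have "cnj t * t = of_real ((cmod t)\<^sup>2)"
    by (metis complex_norm_square mult.commute)
  finally show ?thesis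
    by (simp add: quad_form_def)
qed

text \<open>The usual quadratic in a real parameter \<open>s\<close>, along \<open>b\<close> with
  the phase of \<open>p\<close> rotated away. The form may degenerate, so a zero value at
  \<open>b\<close> is treated apart: there a large \<open>s\<close> forces
  \<open>p = 0\<close>.\<close>

lemma psd_Cauchy_Schwarz:
  assumes "finite I" "psd I Y"
  shows "(cmod (ip I a (Y b)))\<^sup>2 \<le> quad_form I Y a * quad_form I Y b"
proof -
  define p where "p = ip I a (Y b)"
  have sa: "selfadj I Y" and nn: "\<And>a. 0 \<le> quad_form I Y a"
    using assms(2) by (auto simp: psd_def)
  have *: "0 \<le> quad_form I Y a - 2 * s * (cmod p)\<^sup>2 + s\<^sup>2 * (cmod p)\<^sup>2 * quad_form I Y b" for s :: real
  proof -
    have "0 \<le> quad_form I Y (\<lambda>i. a i + (- of_real s * cnj p) * b i)"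
      by (rule nn)
    also have "\<dots> = quad_form I Y a + 2 * Re ((- of_real s * cnj p) * p)
          + (cmod (- of_real s * cnj p))\<^sup>2 * quad_form I Y b"
      unfolding p_def by (rule quad_form_lincomb[OF assms(1) sa])
    also have "(- of_real s * cnj p) * p = of_real (- s * (cmod p)\<^sup>2)"
      using complex_norm_square[of p] by (simp add: mult.commute)
    also have "(cmod (- of_real s * cnj p))\<^sup>2 = s\<^sup>2 * (cmod p)\<^sup>2"
      by (simp add: norm_mult power_mult_distrib)
    finally show ?thesis by simp
  qed
  show ?thesis
  proof (cases "quad_form I Y b = 0")
    case True
    have "p = 0"
    proof (rule ccontr)
      assume "p \<noteq> 0"
      then have "0 < (cmod p)\<^sup>2" by simp
      with *[of "(quad_form I Y a + 1) / (2 * (cmod p)\<^sup>2)"] True show False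
        by simp
    qed
    then show ?thesis using True by (simp add: p_def)
  next
    case False
    then have pos: "0 < quad_form I Y b" using nn[of b] by simp
    have "0 \<le> quad_form I Y a - (cmod p)\<^sup>2 / quad_form I Y b"
      using *[of "1 / quad_form I Y b"] pos by (simp add: power2_eq_square)
    then show ?thesis using pos by (simp add: field_simps p_def)
  qed
qed

section \<open>Rank-one updates and diagonal shifts of an inverse\<close>

lemma ip_rank_one_right:
  "ip I b (rank_one_update I Y \<kappa> z a) = ip I b (Y a) + of_real \<kappa> * ip I z a * ip I b z"
  by (simp add: rank_one_update_def ip_add_right ip_scale_right)

lemma ip_rank_one_left:
  "ip I (rank_one_update I Y \<kappa> z a) b = ip I (Y a) b + of_real \<kappa> * ip I a z * ip I z b"
  by (simp add: rank_one_update_def ip_add_left ip_scale_left cnj_ip)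

lemma selfadj_rank_one: "selfadj I Y \<Longrightarrow> selfadj I (rank_one_update I Y \<kappa> z)"
  by (simp add: selfadj_def ip_rank_one_left ip_rank_one_right)

lemma quad_form_rank_one:
  "quad_form I (rank_one_update I Y \<kappa> z) a = quad_form I Y a + \<kappa> * (cmod (ip I z a))\<^sup>2"
proof -
  have "ip I z a * ip I a z = of_real ((cmod (ip I z a))\<^sup>2)"
    by (metis cnj_ip complex_norm_square)
  then show ?thesis
    by (simp add: quad_form_def ip_rank_one_right mult.assoc)
qed

lemma selfadj_shift:
  assumes "selfadj I N"
  shows "selfadj I (shift_op N \<delta> S)"
proof -
  have "ip I a (\<lambda>i. if i \<in> S then of_real \<delta> * b i else 0) = ip I (\<lambda>i. if i \<in> S then of_real \<delta> * a i else 0) b" for a b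
    unfolding ip_def by (intro sum.cong) auto
  with assms show ?thesis
    by (simp add: selfadj_def shift_op_def ip_add_left ip_add_right)
qed

text \<open>The Sherman-Morrison formula. For \<open>\<sigma> \<ge> 0\<close> Cauchy-Schwarz for
  \<open>Y\<close> bounds the subtracted term by the fraction
  \<open>\<kappa> * quad_form I Y z\<close> of the form, and this fraction is at most 1; for
  negative \<open>\<sigma>\<close> the correction is an addition.\<close>

lemma right_inverse_rank_one:
  assumes fin: "finite I" and N: "selfadj I N" and Y: "psd I Y" and inv: "right_inverse I N Y"
    and pos: "0 < 1 + \<sigma> * quad_form I Y z"
  defines "\<kappa> \<equiv> \<sigma> / (1 + \<sigma> * quad_form I Y z)"
  shows "right_inverse I (rank_one_update I N \<sigma> z) (rank_one_update I Y (- \<kappa>) (Y z))"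
    and "psd I (rank_one_update I Y (- \<kappa>) (Y z))"
proof -
  let ?\<gamma> = "quad_form I Y z"
  have sa: "selfadj I Y" and nn: "\<And>a. 0 \<le> quad_form I Y a"
    using Y by (auto simp: psd_def)
  \<comment> \<open>This cancellation removes the multiple of \<open>z\<close> left over in the
    product of the two updates; it is what determines \<open>\<kappa>\<close>.\<close>
  have \<kappa>: "- \<kappa> + \<sigma> - \<sigma> * \<kappa> * ?\<gamma> = 0"
    using pos by (simp add: \<kappa>_def field_simps)
  then have \<kappa>c: "- of_real \<kappa> + of_real \<sigma> - of_real \<sigma> * of_real \<kappa> * of_real ?\<gamma> = (0::complex)"
    by (simp only: of_real_mult[symmetric] of_real_diff[symmetric] of_real_minus[symmetric] of_real_add[symmetric] of_real_0)
  show "right_inverse I (rank_one_update I N \<sigma> z) (rank_one_update I Y (- \<kappa>) (Y z))"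
    unfolding right_inverse_def
  proof (intro allI ballI)
    fix a i assume i: "i \<in> I"
    let ?\<beta> = "ip I z (Y a)"
    have Y': "rank_one_update I Y (- \<kappa>) (Y z) a = (\<lambda>j. Y a j + (- of_real \<kappa> * ?\<beta>) * Y z j)"
      by (simp add: rank_one_update_def selfadjD[OF sa])
    have 1: "N (rank_one_update I Y (- \<kappa>) (Y z) a) i = a i + (- of_real \<kappa> * ?\<beta>) * z i"
      unfolding Y' selfadj_lincomb[OF fin N i] using inv i by (simp add: right_inverse_def)
    have 2: "ip I z (rank_one_update I Y (- \<kappa>) (Y z) a) = ?\<beta> - of_real \<kappa> * ?\<beta> * of_real ?\<gamma>"
      unfolding Y' ip_add_right ip_scale_right quad_form_complex[OF sa] by simp
    have "rank_one_update I N \<sigma> z (rank_one_update I Y (- \<kappa>) (Y z) a) i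
        = a i + (- of_real \<kappa> * ?\<beta>) * z i + of_real \<sigma> * (?\<beta> - of_real \<kappa> * ?\<beta> * of_real ?\<gamma>) * z i"
      unfolding rank_one_update_def[of I N] 1 2 ..
    also have "\<dots> = a i + (- of_real \<kappa> + of_real \<sigma> - of_real \<sigma> * of_real \<kappa> * of_real ?\<gamma>) * (?\<beta> * z i)"
      by (simp add: algebra_simps)
    finally show "rank_one_update I N \<sigma> z (rank_one_update I Y (- \<kappa>) (Y z) a) i = a i"
      unfolding \<kappa>c by simp
  qed
  show "psd I (rank_one_update I Y (- \<kappa>) (Y z))"
    unfolding psd_def
  proof (intro conjI allI selfadj_rank_one sa)
    fix a
    have cs: "(cmod (ip I (Y z) a))\<^sup>2 \<le> quad_form I Y z * quad_form I Y a"
      using psd_Cauchy_Schwarz[OF fin Y, of z a] by (simp add: selfadjD[OF sa])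
    show "0 \<le> quad_form I (rank_one_update I Y (- \<kappa>) (Y z)) a"
    proof (cases "\<sigma> \<ge> 0")
      case True
      then have "\<kappa> \<ge> 0" using pos by (simp add: \<kappa>_def)
      then have "\<kappa> * (cmod (ip I (Y z) a))\<^sup>2 \<le> \<kappa> * (quad_form I Y z * quad_form I Y a)"
        using cs by (rule mult_left_mono[rotated])
      also have "\<dots> = (\<kappa> * ?\<gamma>) * quad_form I Y a" by simp
      also have "\<dots> \<le> 1 * quad_form I Y a"
        using pos nn[of z] by (intro mult_right_mono nn) (simp add: \<kappa>_def)
      finally show ?thesis by (simp add: quad_form_rank_one)
    next
      case False
      then have "\<kappa> \<le> 0" using pos by (simp add: \<kappa>_def divide_le_0_iff)
      then have "\<kappa> * (cmod (ip I (Y z) a))\<^sup>2 \<le> 0" by (simp add: mult_nonpos_nonneg)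
      then show ?thesis using nn[of a] by (simp add: quad_form_rank_one)
    qed
  qed
qed

text \<open>Builds a shift on a set out of rank-one updates along unit vectors, so that
  Sherman-Morrison covers shifts one index at a time.\<close>

lemma shift_insert:
  assumes "finite I" "k \<in> I" "k \<notin> S"
  shows "shift_op N \<sigma> (insert k S) = rank_one_update I (shift_op N \<sigma> S) \<sigma> (unit_vec k)"
proof -
  have "ip I (unit_vec k) a = a k" for a :: "'a \<Rightarrow> complex"
    by (rule ip_unit[OF assms(1,2)])
  with assms(3) show ?thesis
    by (auto simp: shift_op_def rank_one_update_def unit_vec_def fun_eq_iff)
qed

text \<open>The indices of \<open>S\<close> are shifted one after the other. A single shift enlarges
  the form by at most the factor \<open>1 / (1 - \<delta> * g)\<close>, with \<open>g\<close> the
  diagonal entry of the current inverse. Bounding \<open>g\<close> by the induction hypothesis makes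
  these factors telescope to a denominator that is linear in the partial trace of the original
  \<open>Y\<close>.\<close>

lemma shift_down:
  assumes fin: "finite I" and N: "selfadj I N" and Y: "psd I Y" and inv: "right_inverse I N Y"
    and S: "S \<subseteq> I" and \<delta>: "0 \<le> \<delta>" and small: "\<delta> * (\<Sum>k\<in>S. Re (Y (unit_vec k) k)) < 1"
  shows "\<exists>Y'. psd I Y' \<and> right_inverse I (shift_op N (- \<delta>) S) Y' \<and>
    (\<forall>a. quad_form I Y' a \<le> quad_form I Y a / (1 - \<delta> * (\<Sum>k\<in>S. Re (Y (unit_vec k) k))))"
proof -
  have "finite S" using fin S finite_subset by blast
  then show ?thesis using S small
  proof (induction S rule: finite_induct)
    case empty
    have "shift_op N (- \<delta>) {} = N" by (simp add: shift_op_def)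
    with Y inv show ?case by auto
  next
    case (insert k S)
    have kI: "k \<in> I" and SI: "S \<subseteq> I" using insert.prems by auto
    have nn: "0 \<le> quad_form I Y a" for a using Y by (simp add: psd_def)
    define y where "y = Re (Y (unit_vec k) k)"
    define \<theta> where "\<theta> = \<delta> * (\<Sum>k\<in>S. Re (Y (unit_vec k) k))"
    have y0: "0 \<le> y" using nn[of "unit_vec k"] by (simp add: quad_form_unit fin kI y_def)
    have \<theta>': "\<delta> * (\<Sum>k\<in>insert k S. Re (Y (unit_vec k) k)) = \<theta> + \<delta> * y"
      using insert.hyps by (simp add: \<theta>_def y_def algebra_simps)
    have lt: "\<theta> + \<delta> * y < 1" using insert.prems(2) \<theta>' by simp
    have dy: "0 \<le> \<delta> * y" using \<delta> y0 by simp
    have \<theta>1: "\<theta> < 1" using lt dy by linarith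
    obtain Z where Z: "psd I Z" "right_inverse I (shift_op N (- \<delta>) S) Z"
      and le: "\<And>a. quad_form I Z a \<le> quad_form I Y a / (1 - \<theta>)"
      using insert.IH[OF SI] \<theta>1 unfolding \<theta>_def by blast
    define g where "g = quad_form I Z (unit_vec k)"
    have g0: "0 \<le> g" using Z(1) by (simp add: psd_def g_def)
    have g: "g \<le> y / (1 - \<theta>)"
      using le[of "unit_vec k"] by (simp add: g_def quad_form_unit fin kI y_def)
    have dg: "\<delta> * g \<le> \<delta> * y / (1 - \<theta>)"
      using mult_left_mono[OF g \<delta>] by simp
    have "\<delta> * y / (1 - \<theta>) < 1" using lt \<theta>1 by simp
    then have pos: "0 < 1 + (- \<delta>) * g" using dg by simp
    define \<kappa> where "\<kappa> = - \<delta> / (1 + (- \<delta>) * g)"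
    define Y' where "Y' = rank_one_update I Z (- \<kappa>) (Z (unit_vec k))"
    have sN: "selfadj I (shift_op N (- \<delta>) S)" by (rule selfadj_shift[OF N])
    have R: "right_inverse I (shift_op N (- \<delta>) (insert k S)) Y'" and P: "psd I Y'"
      using right_inverse_rank_one[OF fin sN Z(1,2) pos[unfolded g_def]]
      unfolding Y'_def \<kappa>_def g_def shift_insert[OF fin kI insert.hyps(2)] by auto
    have "quad_form I Y' a \<le> quad_form I Y a / (1 - (\<theta> + \<delta> * y))" for a
    proof -
      have sZ: "selfadj I Z" using Z(1) by (rule psd_selfadj)
      have qZ: "0 \<le> quad_form I Z a" using Z(1) by (simp add: psd_def)
      have "quad_form I Y' a = quad_form I Z a + \<delta> / (1 - \<delta> * g) * (cmod (ip I (Z (unit_vec k)) a))\<^sup>2"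
        by (simp add: Y'_def quad_form_rank_one \<kappa>_def)
      \<comment> \<open>Cauchy-Schwarz for \<open>Z\<close> against the unit vector turns the
        rank-one correction into a multiple of the form itself.\<close>
      also have "\<dots> \<le> quad_form I Z a + \<delta> / (1 - \<delta> * g) * (g * quad_form I Z a)"
        using psd_Cauchy_Schwarz[OF fin Z(1), of "unit_vec k" a] pos \<delta>
        by (intro add_left_mono mult_left_mono) (auto simp: selfadjD[OF sZ] g_def)
      also have "\<dots> = quad_form I Z a * (1 / (1 - \<delta> * g))"
        using pos by (simp add: field_simps)
      also have "\<dots> \<le> quad_form I Z a * (1 / (1 - \<delta> * y / (1 - \<theta>)))"
        using dg pos \<open>\<delta> * y / (1 - \<theta>) < 1\<close> qZ by (intro mult_left_mono frac_le) auto
      also have "\<dots> \<le> quad_form I Y a / (1 - \<theta>) * (1 / (1 - \<delta> * y / (1 - \<theta>)))"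
        using \<open>\<delta> * y / (1 - \<theta>) < 1\<close> by (intro mult_right_mono le) auto
      also have "\<dots> = quad_form I Y a / (1 - (\<theta> + \<delta> * y))"
      proof -
        have "(1 - \<theta>) * (1 - \<delta> * y / (1 - \<theta>)) = 1 - (\<theta> + \<delta> * y)"
          using \<theta>1 by (simp add: field_simps)
        then show ?thesis by (simp only: times_divide_times_eq mult_1_right)
      qed
      finally show ?thesis .
    qed
    then show ?case using P R unfolding \<theta>' by blast
  qed
qed

text \<open>Raising the diagonal keeps every Sherman-Morrison denominator at least 1. This leads
  from the inverse of the last barrier operator to the inverse of the normal equations of least
  squares.\<close>

lemma shift_up:
  assumes fin: "finite I" and N: "selfadj I N" and Y: "psd I Y" and inv: "right_inverse I N Y"
    and S: "S \<subseteq> I" and \<delta>: "0 \<le> \<delta>"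
  shows "\<exists>Y'. psd I Y' \<and> right_inverse I (shift_op N \<delta> S) Y'"
proof -
  have "finite S" using fin S finite_subset by blast
  then show ?thesis using S
  proof (induction S rule: finite_induct)
    case empty
    have "shift_op N \<delta> {} = N" by (simp add: shift_op_def)
    with Y inv show ?case by auto
  next
    case (insert k S)
    then obtain Z where Z: "psd I Z" "right_inverse I (shift_op N \<delta> S) Z" by auto
    have "0 \<le> \<delta> * quad_form I Z (unit_vec k)" using Z(1) \<delta> by (simp add: psd_def)
    then have "0 < 1 + \<delta> * quad_form I Z (unit_vec k)" by linarith
    from right_inverse_rank_one[OF fin selfadj_shift[OF N] Z this] insert
    show ?case by (auto simp: shift_insert[OF fin])
  qed
qed

section \<open>The weighted trace under updates and shifts\<close>

text \<open>The correction is the rank-one operator built from \<open>Y z\<close>, whose weighted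
  trace is the form of \<open>Y D Y\<close> at \<open>z\<close>. Up to the Sherman-Morrison factor
  this is how much a new point lowers the potential.\<close>

lemma trace_rank_one:
  assumes fin: "finite I" and Y: "selfadj I Y"
  shows "wtrace I D (rank_one_update I Y \<kappa> (Y z))
    = wtrace I D Y + \<kappa> * quad_form I (\<lambda>a. Y (diag_op D (Y a))) z"
proof -
  have "Re (rank_one_update I Y \<kappa> (Y z) (unit_vec k) k) = Re (Y (unit_vec k) k) + \<kappa> * (cmod (Y z k))\<^sup>2"
    if "k \<in> I" for k
  proof -
    have "ip I (Y z) (unit_vec k) * Y z k = of_real ((cmod (Y z k))\<^sup>2)"
      using that by (metis cnj_ip complex_norm_square fin ip_unit mult.commute)
    then show ?thesis by (simp add: rank_one_update_def mult.assoc)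
  qed
  then have "wtrace I D (rank_one_update I Y \<kappa> (Y z))
      = (\<Sum>k\<in>I. D k * Re (Y (unit_vec k) k) + \<kappa> * (D k * (cmod (Y z k))\<^sup>2))"
    unfolding wtrace_def by (intro sum.cong refl) (simp add: algebra_simps)
  also have "\<dots> = wtrace I D Y + \<kappa> * (\<Sum>k\<in>I. D k * (cmod (Y z k))\<^sup>2)"
    by (simp add: wtrace_def sum.distrib sum_distrib_left)
  also have "(\<Sum>k\<in>I. D k * (cmod (Y z k))\<^sup>2) = quad_form I (\<lambda>a. Y (diag_op D (Y a))) z"
    by (simp add: quad_form_def selfadjD[OF Y] ip_diag_self)
  finally show ?thesis .
qed

text \<open>This is the trace of \<open>D Y D Y\<close>. The expansion shows that it is nonnegative
  for nonnegative \<open>D\<close>; both the cost of a shift and the gain of a point are measured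
  against it.\<close>

lemma trace_sandwich:
  assumes fin: "finite I" and Y: "selfadj I Y"
  shows "wtrace I D (\<lambda>a. Y (diag_op D (Y a))) = (\<Sum>k\<in>I. D k * (\<Sum>i\<in>I. D i * (cmod (Y (unit_vec k) i))\<^sup>2))"
  unfolding wtrace_def
proof (intro sum.cong refl)
  fix k assume k: "k \<in> I"
  have "Y (diag_op D (Y (unit_vec k))) k = ip I (Y (unit_vec k)) (diag_op D (Y (unit_vec k)))"
    by (rule selfadj_entry[OF fin Y k])
  then show "D k * Re (Y (diag_op D (Y (unit_vec k))) k) = D k * (\<Sum>i\<in>I. D i * (cmod (Y (unit_vec k) i))\<^sup>2)"
    by (simp add: ip_diag_self)
qed

lemma selfadj_sandwich:
  assumes "selfadj I Y"
  shows "selfadj I (\<lambda>a. Y (diag_op D (Y a)))"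
  using assms by (simp add: selfadj_def ip_diag)

text \<open>The identity \<open>Y' - Y = \<delta> Y' P Y = \<delta> Y P Y'\<close> for \<open>Y = N\<^sup>-\<^sup>1\<close>, \<open>Y' = (N - \<delta> P)\<^sup>-\<^sup>1\<close>.\<close>

lemma resolvent_identity:
  assumes N: "selfadj I N" and Y: "selfadj I Y" "right_inverse I N Y"
    and Y': "selfadj I Y'" "right_inverse I (shift_op N (- \<delta>) S) Y'"
  shows "ip I b (Y' a) = ip I b (Y a) + \<delta> * ip I (Y' b) (\<lambda>i. if i \<in> S then Y a i else 0)"
proof -
  have "ip I b (Y' a) = ip I (Y' b) a" by (rule selfadjD[OF Y'(1)])
  also have "\<dots> = ip I (Y' b) (N (Y a))"
    using Y(2) by (intro ip_cong) (auto simp: right_inverse_def)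
  also have "N (Y a) = (\<lambda>i. shift_op N (- \<delta>) S (Y a) i + of_real \<delta> * (if i \<in> S then Y a i else 0))"
    by (auto simp: shift_op_def)
  also have "ip I (Y' b) \<dots> = ip I (Y' b) (shift_op N (- \<delta>) S (Y a))
      + of_real \<delta> * ip I (Y' b) (\<lambda>i. if i \<in> S then Y a i else 0)"
    by (simp only: ip_add_right ip_scale_right)
  also have "ip I (Y' b) (shift_op N (- \<delta>) S (Y a)) = ip I (shift_op N (- \<delta>) S (Y' b)) (Y a)"
    by (rule selfadjD[OF selfadj_shift[OF N]])
  also have "\<dots> = ip I b (Y a)"
    using Y'(2) by (intro ip_cong) (auto simp: right_inverse_def)
  finally show ?thesis .
qed

text \<open>The resolvent identity is used twice. First it writes the change of a diagonal entry as
  \<open>\<delta>\<close> times a mixed product of \<open>Y' e\<close> and \<open>Y e\<close> on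
  \<open>S\<close>; then it replaces \<open>Y\<close> by \<open>Y'\<close> there, which can only
  increase the product. What remains is the squared length of \<open>Y' e\<close> on
  \<open>S\<close>, and \<open>D\<close> is at least 1 on \<open>S\<close>.\<close>

lemma shift_cost:
  assumes fin: "finite I" and N: "selfadj I N" and Y: "psd I Y" "right_inverse I N Y"
    and Y': "psd I Y'" "right_inverse I (shift_op N (- \<delta>) S) Y'"
    and S: "S \<subseteq> I" and \<delta>: "0 \<le> \<delta>" and D: "\<And>i. i \<in> I \<Longrightarrow> 0 \<le> D i" "\<And>i. i \<in> S \<Longrightarrow> 1 \<le> D i"
  shows "wtrace I D Y' - wtrace I D Y \<le> \<delta> * wtrace I D (\<lambda>a. Y' (diag_op D (Y' a)))"
proof -
  let ?P = "\<lambda>a i. if i \<in> S then a i else (0::complex)"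
  have P: "ip I (?P a) b = ip I a (?P b)" for a b
    unfolding ip_def by (intro sum.cong) auto
  have PP: "ip I (?P a) (?P b) = ip I a (?P b)" for a b
    unfolding ip_def by (intro sum.cong) auto
  note sY = psd_selfadj[OF Y(1)] note sY' = psd_selfadj[OF Y'(1)]
  note res = resolvent_identity[OF N sY Y(2) sY' Y'(2)]
  have "Re (Y' (unit_vec k) k) - Re (Y (unit_vec k) k) \<le> \<delta> * (\<Sum>i\<in>I. D i * (cmod (Y' (unit_vec k) i))\<^sup>2)"
    if k: "k \<in> I" for k
  proof -
    define e where "e = (unit_vec k :: 'a \<Rightarrow> complex)"
    define b where "b = ?P (Y' e)"
    have 1: "Re (Y' e k) - Re (Y e k) = \<delta> * Re (ip I (Y' e) (?P (Y e)))"
      using res[of e e] by (simp add: e_def ip_unit[OF fin k])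
    \<comment> \<open>The second use of the identity, tested on \<open>b\<close>: the correction is
      the form of \<open>Y\<close> at \<open>b\<close>, hence nonnegative.\<close>
    have 3: "ip I b (Y' e) = ip I b (Y e) + \<delta> * ip I b (Y b)"
    proof -
      have "ip I b (Y' e) = cnj (ip I e (Y' b))" by (simp add: cnj_ip selfadjD[OF sY'])
      also have "ip I e (Y' b) = ip I e (Y b) + \<delta> * ip I (Y' e) (?P (Y b))" by (rule res)
      also have "ip I (Y' e) (?P (Y b)) = ip I b (Y b)" unfolding b_def by (rule P[symmetric])
      finally show ?thesis
        by (simp add: cnj_ip) (simp add: selfadjD[OF sY])
    qed
    have "Re (ip I (Y' e) (?P (Y e))) = Re (ip I b (Y e))" by (simp add: b_def P)
    also have "\<dots> \<le> Re (ip I b (Y' e))"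
      using 3 Y(1) \<delta> by (simp add: psd_def quad_form_def)
    also have "ip I b (Y' e) = ip I b b"
      unfolding b_def P[of "Y' e" "Y' e"] PP[of "Y' e" "Y' e"] ..
    also have "Re (ip I b b) = (\<Sum>i\<in>I. (cmod (b i))\<^sup>2)" by (simp add: ip_self)
    also have "\<dots> \<le> (\<Sum>i\<in>I. D i * (cmod (Y' e i))\<^sup>2)"
    proof (rule sum_mono)
      fix i assume i: "i \<in> I"
      show "(cmod (b i))\<^sup>2 \<le> D i * (cmod (Y' e i))\<^sup>2"
      proof (cases "i \<in> S")
        case True
        then have "1 * (cmod (Y' e i))\<^sup>2 \<le> D i * (cmod (Y' e i))\<^sup>2"
          using D(2) by (intro mult_right_mono) auto
        then show ?thesis using True by (simp add: b_def)
      qed (use D(1) i in \<open>simp add: b_def\<close>)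
    qed
    finally show ?thesis using mult_left_mono[OF _ \<delta>] 1 by (simp add: e_def)
  qed
  then have "(\<Sum>k\<in>I. D k * (Re (Y' (unit_vec k) k) - Re (Y (unit_vec k) k)))
      \<le> (\<Sum>k\<in>I. D k * (\<delta> * (\<Sum>i\<in>I. D i * (cmod (Y' (unit_vec k) i))\<^sup>2)))"
    using D(1) by (intro sum_mono mult_left_mono) auto
  moreover have "(\<Sum>k\<in>I. D k * (Re (Y' (unit_vec k) k) - Re (Y (unit_vec k) k))) = wtrace I D Y' - wtrace I D Y"
    by (simp add: wtrace_def sum_subtractf right_diff_distrib)
  moreover have "(\<Sum>k\<in>I. D k * (\<delta> * (\<Sum>i\<in>I. D i * (cmod (Y' (unit_vec k) i))\<^sup>2)))
      = \<delta> * wtrace I D (\<lambda>a. Y' (diag_op D (Y' a)))"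
    unfolding trace_sandwich[OF fin sY'] by (simp add: sum_distrib_left mult.left_commute)
  ultimately show ?thesis by simp
qed

section \<open>The barrier argument\<close>

text \<open>The shift raises the potential by at most \<open>\<Delta>\<close>, and the new point
  must win this back. By Sherman-Morrison with factor \<open>1/4\<close> the gain at
  \<open>z\<close> is the form of \<open>Z D Z\<close> divided by
  \<open>4 + quad_form I Z z\<close>, so it suffices to find a point where the form of
  \<open>Z D Z - \<Delta> Z\<close> is at least \<open>4 \<Delta>\<close>; averaging provides
  it.\<close>

lemma barrier_step:
  assumes fin: "finite I" and N: "selfadj I N" and Y: "psd I Y" "right_inverse I N Y"
    and S: "S \<subseteq> I" and D: "\<And>i. i \<in> I \<Longrightarrow> 0 \<le> D i" "\<And>i. i \<in> S \<Longrightarrow> 1 \<le> D i"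
    and tr: "wtrace I D Y \<le> 2"
    and avg: "\<And>H. selfadj I H \<Longrightarrow> \<exists>x\<in>X. wtrace I D H \<le> quad_form I H (z x)"
  shows "\<exists>x\<in>X. \<exists>Y'. psd I Y' \<and>
    right_inverse I (rank_one_update I (shift_op N (- (1/8)) S) (1/4) (z x)) Y' \<and> wtrace I D Y' \<le> 2"
proof -
  note sY = psd_selfadj[OF Y(1)]
  have pos: "0 \<le> Re (Y (unit_vec k) k)" if "k \<in> I" for k
    using Y(1) quad_form_unit[OF fin that, of Y] by (metis psd_def)
  have "(\<Sum>k\<in>S. Re (Y (unit_vec k) k)) \<le> (\<Sum>k\<in>S. D k * Re (Y (unit_vec k) k))"
  proof (rule sum_mono)
    fix k assume "k \<in> S"
    then show "Re (Y (unit_vec k) k) \<le> D k * Re (Y (unit_vec k) k)"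
      using mult_right_mono[OF D(2) pos] S by fastforce
  qed
  also have "\<dots> \<le> (\<Sum>k\<in>I. D k * Re (Y (unit_vec k) k))"
    using fin S D(1) pos by (intro sum_mono2) auto
  also have "\<dots> \<le> 2" using tr by (simp add: wtrace_def)
  \<comment> \<open>The step \<open>1/8\<close> times the potential bound 2. The inverse therefore
    grows by at most the factor \<open>4/3\<close>, and the shifted potential stays below 4.\<close>
  finally have \<theta>: "(1/8) * (\<Sum>k\<in>S. Re (Y (unit_vec k) k)) \<le> 1/4" by simp
  then have "(1/8) * (\<Sum>k\<in>S. Re (Y (unit_vec k) k)) < 1" by linarith
  from shift_down[OF fin N Y S _ this]
  obtain Z where Z: "psd I Z" "right_inverse I (shift_op N (- (1/8)) S) Z"
    and le: "\<And>a. quad_form I Z a \<le> quad_form I Y a / (1 - (1/8) * (\<Sum>k\<in>S. Re (Y (unit_vec k) k)))"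
    by auto
  note sZ = psd_selfadj[OF Z(1)]
  have le': "Re (Z (unit_vec k) k) \<le> 4/3 * Re (Y (unit_vec k) k)" if k: "k \<in> I" for k
  proof -
    have "Re (Z (unit_vec k) k) \<le> Re (Y (unit_vec k) k) / (1 - (1/8) * (\<Sum>k\<in>S. Re (Y (unit_vec k) k)))"
      using le[of "unit_vec k"] by (simp add: quad_form_unit fin k)
    also have "\<dots> \<le> Re (Y (unit_vec k) k) / (3/4)"
      using \<theta> pos[OF k] by (intro divide_left_mono) auto
    finally show ?thesis by simp
  qed
  have "wtrace I D Z \<le> (\<Sum>k\<in>I. D k * (4/3 * Re (Y (unit_vec k) k)))"
    unfolding wtrace_def using D(1) le' by (intro sum_mono mult_left_mono) auto
  also have "\<dots> = 4/3 * wtrace I D Y"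
    by (simp add: wtrace_def sum_distrib_left algebra_simps)
  finally have trZ: "wtrace I D Z \<le> 4" using tr by simp
  let ?W = "\<lambda>a. Z (diag_op D (Z a))"
  \<comment> \<open>Truncated at 0 so that the bound 4 on the trace of \<open>Z\<close> can be
    multiplied by it.\<close>
  define \<Delta> where "\<Delta> = max 0 (wtrace I D Z - wtrace I D Y)"
  have W0: "0 \<le> wtrace I D ?W"
    using D(1) by (simp add: trace_sandwich[OF fin sZ] sum_nonneg)
  have \<Delta>0: "0 \<le> \<Delta>" by (simp add: \<Delta>_def)
  have "wtrace I D Z - wtrace I D Y \<le> (1/8) * wtrace I D ?W"
    by (rule shift_cost[OF fin N Y Z S _ D]) auto
  then have \<Delta>1: "\<Delta> \<le> (1/8) * wtrace I D ?W"
    using W0 by (auto simp: \<Delta>_def max_def)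
  \<comment> \<open>The weighted trace of this operator is at least
    \<open>8 \<Delta> - 4 \<Delta> = 4 \<Delta>\<close>: the first term by the cost estimate, the
    second by the bound on the trace of \<open>Z\<close>.\<close>
  let ?H = "\<lambda>a i. ?W a i + of_real (- \<Delta>) * Z a i"
  have sW: "selfadj I ?W" by (rule selfadj_sandwich[OF sZ])
  have "selfadj I ?H"
    using sW sZ by (simp add: selfadj_def ip_add_left ip_add_right ip_scale_left ip_scale_right del: of_real_minus)
  then obtain x where x: "x \<in> X" and le: "wtrace I D ?H \<le> quad_form I ?H (z x)"
    using avg by blast
  have "wtrace I D ?H = wtrace I D ?W - \<Delta> * wtrace I D Z"
    by (simp add: wtrace_def sum_subtractf[symmetric] sum_distrib_left algebra_simps)
  moreover have "quad_form I ?H (z x) = quad_form I ?W (z x) - \<Delta> * quad_form I Z (z x)"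
    by (simp add: quad_form_def ip_add_right ip_scale_right del: of_real_minus)
  moreover have "\<Delta> * wtrace I D Z \<le> \<Delta> * 4" by (rule mult_left_mono[OF trZ \<Delta>0])
  ultimately have gain: "\<Delta> * (4 + quad_form I Z (z x)) \<le> quad_form I ?W (z x)"
    using le \<Delta>1 by (simp add: algebra_simps)
  have q0: "0 \<le> quad_form I Z (z x)" using Z(1) by (simp add: psd_def)
  define Y' where "Y' = rank_one_update I Z (- ((1/4) / (1 + (1/4) * quad_form I Z (z x)))) (Z (z x))"
  have "0 < 1 + (1/4) * quad_form I Z (z x)" using q0 by simp
  from right_inverse_rank_one[OF fin selfadj_shift[OF N] Z this]
  have 1: "psd I Y'" "right_inverse I (rank_one_update I (shift_op N (- (1/8)) S) (1/4) (z x)) Y'"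
    by (auto simp: Y'_def)
  have "wtrace I D Y' = wtrace I D Z - ((1/4) / (1 + (1/4) * quad_form I Z (z x))) * quad_form I ?W (z x)"
    by (simp add: Y'_def trace_rank_one[OF fin sZ])
  also have "(1/4) / (1 + (1/4) * quad_form I Z (z x)) = 1 / (4 + quad_form I Z (z x))"
    using q0 by (simp add: field_simps)
  also have "wtrace I D Z - 1 / (4 + quad_form I Z (z x)) * quad_form I ?W (z x) \<le> wtrace I D Z - \<Delta>"
    using gain q0 by (simp add: field_simps)
  also have "\<dots> \<le> 2" using tr by (simp add: \<Delta>_def)
  finally show ?thesis using 1 x by blast
qed

text \<open>The operator \<open>N\<close> of the overview with \<open>c = - l\<close>, after
  \<open>q\<close> points have been chosen.\<close>

definition barrier_op :: "'k set \<Rightarrow> 'k set \<Rightarrow> real \<Rightarrow> ('x \<Rightarrow> 'k \<Rightarrow> complex) \<Rightarrow> nat \<Rightarrow> (nat \<Rightarrow> 'x) \<Rightarrow>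
    ('k \<Rightarrow> complex) \<Rightarrow> ('k \<Rightarrow> complex)" where
  "barrier_op I V c z q xs = (\<lambda>a i. (if i \<in> V then of_real c * a i else a i)
     + (\<Sum>t<q. of_real (1/4) * ip I (z (xs t)) a * z (xs t) i))"

lemma barrier_op_shift: "shift_op (barrier_op I V c z q xs) \<delta> V = barrier_op I V (c + \<delta>) z q xs"
  by (auto simp: shift_op_def barrier_op_def fun_eq_iff algebra_simps)

lemma barrier_op_Suc:
  "rank_one_update I (barrier_op I V c z q xs) (1/4) (z (xs q)) = barrier_op I V c z (Suc q) xs"
  by (auto simp: rank_one_update_def barrier_op_def fun_eq_iff algebra_simps)

lemma barrier_op_cong: "(\<And>t. t < q \<Longrightarrow> xs t = ys t) \<Longrightarrow> barrier_op I V c z q xs = barrier_op I V c z q ys"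
  by (simp add: barrier_op_def)

lemma selfadj_barrier_op: "selfadj I (barrier_op I V c z q xs)"
proof (induction q)
  case 0
  have "ip I a (\<lambda>i. if i \<in> V then of_real c * b i else b i) = ip I (\<lambda>i. if i \<in> V then of_real c * a i else a i) b" for a b
    unfolding ip_def by (intro sum.cong) auto
  then show ?case by (simp add: selfadj_def barrier_op_def)
next
  case (Suc q)
  then show ?case by (simp add: barrier_op_Suc[symmetric] selfadj_rank_one)
qed

text \<open>At the start the operator is diagonal, \<open>card V\<close> on \<open>V\<close> and 1
  elsewhere. The potential of its inverse is 1 from \<open>V\<close> plus the total weight off
  \<open>V\<close>, hence at most 2, and each barrier step preserves this bound.\<close>

lemma barrier_iterate:
  assumes fin: "finite I" and V: "V \<subseteq> I" "V \<noteq> {}"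
    and D: "\<And>i. i \<in> I \<Longrightarrow> 0 \<le> D i" "\<And>i. i \<in> V \<Longrightarrow> D i = 1" "(\<Sum>i\<in>I - V. D i) \<le> 1"
    and avg: "\<And>H. selfadj I H \<Longrightarrow> \<exists>x\<in>X. wtrace I D H \<le> quad_form I H (z x)"
  shows "\<exists>xs. (\<forall>t<q. xs t \<in> X) \<and> (\<exists>Y. psd I Y \<and>
     right_inverse I (barrier_op I V (card V - q / 8) z q xs) Y \<and> wtrace I D Y \<le> 2)"
proof (induction q)
  case 0
  have finV: "finite V" using V(1) fin by (rule finite_subset)
  have m: "0 < card V" using V(2) finV by (simp add: card_gt_0_iff)
  define Y :: "('a \<Rightarrow> complex) \<Rightarrow> 'a \<Rightarrow> complex"
    where "Y = (\<lambda>a i. (if i \<in> V then of_real (1 / card V) * a i else a i))"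
  have "Y = diag_op (\<lambda>i. if i \<in> V then 1 / card V else 1)"
    by (auto simp: Y_def diag_op_def fun_eq_iff)
  then have "psd I Y"
    by (simp add: psd_def selfadj_def quad_form_def ip_diag_self) (simp add: ip_diag sum_nonneg)
  moreover have "right_inverse I (barrier_op I V (real (card V) - real 0 / 8) z 0 xs) Y" for xs
    using m by (auto simp: right_inverse_def barrier_op_def Y_def)
  moreover have "wtrace I D Y \<le> 2"
  proof -
    have "wtrace I D Y = (\<Sum>k\<in>I - V. D k * Re (Y (unit_vec k) k)) + (\<Sum>k\<in>V. D k * Re (Y (unit_vec k) k))"
      unfolding wtrace_def by (rule sum.subset_diff[OF V(1) fin])
    also have "(\<Sum>k\<in>I - V. D k * Re (Y (unit_vec k) k)) = (\<Sum>k\<in>I - V. D k)"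
      by (intro sum.cong) (auto simp: Y_def unit_vec_def)
    also have "(\<Sum>k\<in>V. D k * Re (Y (unit_vec k) k)) = (\<Sum>k\<in>V. 1 / card V)"
      by (intro sum.cong) (auto simp: Y_def unit_vec_def D(2))
    also have "\<dots> = 1" using m by simp
    finally show ?thesis using D(3) by simp
  qed
  ultimately show ?case by auto
next
  case (Suc q)
  then obtain xs Y where xs: "\<forall>t<q. xs t \<in> X" and Y: "psd I Y"
    "right_inverse I (barrier_op I V (card V - q / 8) z q xs) Y" "wtrace I D Y \<le> 2" by blast
  obtain x Y' where x: "x \<in> X" and Y': "psd I Y'" "wtrace I D Y' \<le> 2"
    "right_inverse I (rank_one_update I (barrier_op I V (card V - q / 8 + - (1/8)) z q xs) (1/4) (z x)) Y'"
    using barrier_step[OF fin selfadj_barrier_op Y(1,2) V(1) D(1) _ Y(3) avg] D(2)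
    unfolding barrier_op_shift by (metis order_refl)
  define ys where "ys = xs(q := x)"
  have c: "card V - q / 8 + - (1/8) = card V - Suc q / 8" by (simp add: field_simps)
  have "barrier_op I V (card V - q / 8 + - (1/8)) z q xs = barrier_op I V (card V - Suc q / 8) z q ys"
    unfolding c by (rule barrier_op_cong) (simp add: ys_def)
  then have "rank_one_update I (barrier_op I V (card V - q / 8 + - (1/8)) z q xs) (1/4) (z x)
      = barrier_op I V (card V - Suc q / 8) z (Suc q) ys"
    using barrier_op_Suc[of I V "card V - Suc q / 8" z q ys] by (simp add: ys_def)
  moreover have "\<forall>t<Suc q. ys t \<in> X" using xs x by (simp add: ys_def)
  ultimately show ?case using Y' by metis
qed

text \<open>The operator \<open>L\<close> solves the least squares problem with the samples as data, regularised on
  the indices outside \<open>V\<close>; \<open>r\<close> collects the part of the data that the index set does not see.\<close>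

lemma regularised_least_squares:
  assumes fin: "finite I" and V: "V \<subseteq> I"
    and D: "\<And>i. i \<in> I \<Longrightarrow> 0 \<le> D i" "\<And>i. i \<in> V \<Longrightarrow> D i = 1" "(\<Sum>i\<in>I - V. D i) \<le> 1"
    and avg: "\<And>H. selfadj I H \<Longrightarrow> \<exists>x\<in>X. wtrace I D H \<le> quad_form I H (z x)"
  shows "\<exists>xs L. (\<forall>t<16 * card V. xs t \<in> X) \<and> (\<forall>c r.
     let e = (\<lambda>i. (\<Sum>t<16 * card V. L t i * (ip I (z (xs t)) c + r t)) - c i);
         J = (\<Sum>i\<in>I - V. (cmod (c i))\<^sup>2) + (\<Sum>t<16 * card V. (cmod (r t))\<^sup>2) / 4
     in card V * (\<Sum>i\<in>V. (cmod (e i))\<^sup>2) \<le> J \<and> (\<Sum>i\<in>I - V. (cmod (e i))\<^sup>2) \<le> J)"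
proof (cases "V = {}")
  case True
  \<comment> \<open>There are no samples here, so \<open>e = - c\<close>, and \<open>J\<close>
    contains the whole sum of squares of \<open>c\<close>.\<close>
  then show ?thesis
    by (intro exI[of _ undefined] exI[of _ "\<lambda>_ _. 0"]) (simp add: sum_nonneg)
next
  case False
  define q where "q = 16 * card V"
  have finV: "finite V" using V fin by (rule finite_subset)
  \<comment> \<open>The number 16 comes from here: \<open>16 * card V\<close> steps of
    \<open>1/8\<close> carry the coefficient on \<open>V\<close> from \<open>card V\<close> down to
    \<open>- card V\<close>.\<close>
  have eq: "real (card V) - real q / 8 = - real (card V)" by (simp add: q_def)
  have "\<exists>xs. (\<forall>t<q. xs t \<in> X) \<and> (\<exists>Y. psd I Y \<and>
     right_inverse I (barrier_op I V (card V - q / 8) z q xs) Y \<and> wtrace I D Y \<le> 2)"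
    by (rule barrier_iterate[OF fin V False]) (use D avg in auto)
  then obtain xs Y where xs: "\<forall>t<q. xs t \<in> X" and Y: "psd I Y"
    "right_inverse I (barrier_op I V (- real (card V)) z q xs) Y" unfolding eq by blast
  \<comment> \<open>Coefficient 0 on \<open>V\<close> leaves the normal equations of least squares
    with a penalty only off \<open>V\<close>.\<close>
  define M where "M = barrier_op I V 0 z q xs"
  have sM: "selfadj I M" unfolding M_def by (rule selfadj_barrier_op)
  obtain Z where Z: "psd I Z" "right_inverse I M Z"
    using shift_up[OF fin selfadj_barrier_op Y V, of "card V"] by (auto simp: barrier_op_shift M_def)
  note sZ = psd_selfadj[OF Z(1)]
  have qM: "quad_form I (barrier_op I V \<gamma> z q xs) a = \<gamma> * (\<Sum>i\<in>V. (cmod (a i))\<^sup>2)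
       + (\<Sum>i\<in>I - V. (cmod (a i))\<^sup>2) + (\<Sum>t<q. (cmod (ip I (z (xs t)) a))\<^sup>2) / 4" for \<gamma> a
  proof -
    have 1: "(cmod (ip I w a))\<^sup>2 = Re (ip I w a * ip I a w)" for w
      by (metis cnj_ip complex_norm_square Re_complex_of_real)
    have "ip I a (barrier_op I V \<gamma> z q xs a) = ip I a (diag_op (\<lambda>i. if i \<in> V then \<gamma> else 1) a)
        + (\<Sum>t<q. of_real (1/4) * (ip I (z (xs t)) a * ip I a (z (xs t))))"
    proof -
      have "ip I a (\<lambda>i. \<Sum>t<q. of_real (1/4) * ip I (z (xs t)) a * z (xs t) i)
          = (\<Sum>t<q. of_real (1/4) * (ip I (z (xs t)) a * ip I a (z (xs t))))"
        unfolding ip_def[of I a] sum_distrib_left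
        by (subst sum.swap) (simp add: algebra_simps)
      moreover have "barrier_op I V \<gamma> z q xs a = (\<lambda>i. diag_op (\<lambda>i. if i \<in> V then \<gamma> else 1) a i
         + (\<Sum>t<q. of_real (1/4) * ip I (z (xs t)) a * z (xs t) i))"
        by (auto simp: barrier_op_def diag_op_def)
      ultimately show ?thesis by (simp only: ip_add_right)
    qed
    then have "quad_form I (barrier_op I V \<gamma> z q xs) a = (\<Sum>i\<in>I. (if i \<in> V then \<gamma> else 1) * (cmod (a i))\<^sup>2)
        + (\<Sum>t<q. (cmod (ip I (z (xs t)) a))\<^sup>2) / 4"
      by (simp add: quad_form_def ip_diag_self 1 sum_divide_distrib del: times_complex.simps of_real_sum)
    also have "(\<Sum>i\<in>I. (if i \<in> V then \<gamma> else 1) * (cmod (a i))\<^sup>2)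
        = (\<Sum>i\<in>I - V. (cmod (a i))\<^sup>2) + (\<Sum>i\<in>V. \<gamma> * (cmod (a i))\<^sup>2)"
      by (subst sum.subset_diff[OF V fin]) (intro arg_cong2[where f="(+)"] sum.cong, auto)
    finally show ?thesis by (simp add: sum_distrib_left)
  qed
  \<comment> \<open>Stability on \<open>V\<close>. The last barrier operator is nonnegative because
    its inverse is, and it differs from \<open>M\<close> by exactly \<open>card V\<close> on
    \<open>V\<close>.\<close>
  have dom: "card V * (\<Sum>i\<in>V. (cmod (a i))\<^sup>2) \<le> quad_form I M a" for a
  proof -
    let ?N = "barrier_op I V (- real (card V)) z q xs"
    have "0 \<le> quad_form I Y (?N a)" using Y(1) by (simp add: psd_def)
    also have "quad_form I Y (?N a) = quad_form I ?N a"
    proof -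
      have "ip I (?N a) (Y (?N a)) = ip I a (?N (Y (?N a)))" by (simp add: selfadjD[OF selfadj_barrier_op])
      also have "\<dots> = ip I a (?N a)"
        using Y(2) by (intro ip_cong) (auto simp: right_inverse_def)
      finally show ?thesis by (simp add: quad_form_def)
    qed
    finally show ?thesis unfolding M_def qM by simp
  qed
  \<comment> \<open>Applied to data \<open>y\<close>, these columns give the minimiser of the
    squared length off \<open>V\<close> plus a quarter of the squared residuals at the
    samples.\<close>
  define L where "L = (\<lambda>t i. of_real (1/4) * Z (z (xs t)) i)"
  have main: "card V * (\<Sum>i\<in>V. (cmod (e i))\<^sup>2) \<le> J \<and> (\<Sum>i\<in>I - V. (cmod (e i))\<^sup>2) \<le> J"
    if e: "e = (\<lambda>i. (\<Sum>t<q. L t i * (ip I (z (xs t)) c + r t)) - c i)"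
      and J: "J = (\<Sum>i\<in>I - V. (cmod (c i))\<^sup>2) + (\<Sum>t<q. (cmod (r t))\<^sup>2) / 4" for c r e J
  proof -
    have LZ: "ip I b (\<lambda>i. \<Sum>t<q. L t i * y t) = (\<Sum>t<q. of_real (1/4) * ip I (Z b) (z (xs t)) * y t)" for b y
    proof -
      have "ip I b (\<lambda>i. \<Sum>t<q. L t i * y t) = (\<Sum>t<q. ip I b (Z (z (xs t))) * (of_real (1/4) * y t))"
        unfolding ip_def sum_distrib_left sum_distrib_right L_def by (subst sum.swap) (simp add: algebra_simps)
      then show ?thesis by (simp add: selfadjD[OF sZ])
    qed
    have ZM: "ip I (Z (M e)) b = ip I e b" for b
    proof -
      have "ip I (Z (M e)) b = ip I e (M (Z b))" by (simp add: selfadjD[OF sM] selfadjD[OF sZ])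
      also have "\<dots> = ip I e b" using Z(2) by (intro ip_cong) (auto simp: right_inverse_def)
      finally show ?thesis .
    qed
    have "ip I (M e) e = ip I (M e) (\<lambda>i. (\<Sum>t<q. L t i * (ip I (z (xs t)) c + r t)) + (- 1) * c i)"
      by (simp add: e)
    also have "\<dots> = (\<Sum>t<q. of_real (1/4) * ip I e (z (xs t)) * (ip I (z (xs t)) c + r t)) - ip I (M e) c"
      unfolding ip_add_right ip_scale_right LZ ZM by simp
    also have "ip I (M e) c = ip I e (M c)" by (simp add: selfadjD[OF sM])
    also have "M c = (\<lambda>i. (if i \<in> V then 0 else c i) + (\<Sum>t<q. of_real (1/4) * ip I (z (xs t)) c * z (xs t) i))"
      by (auto simp: M_def barrier_op_def)
    also have "ip I e \<dots> = ip I e (\<lambda>i. if i \<in> V then 0 else c i)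
        + (\<Sum>t<q. of_real (1/4) * ip I e (z (xs t)) * ip I (z (xs t)) c)"
    proof -
      have "ip I e (\<lambda>i. \<Sum>t<q. of_real (1/4) * ip I (z (xs t)) c * z (xs t) i)
          = (\<Sum>t<q. of_real (1/4) * ip I e (z (xs t)) * ip I (z (xs t)) c)"
        unfolding ip_def[of I e] sum_distrib_left sum_distrib_right
        by (subst sum.swap) (simp add: algebra_simps)
      then show ?thesis by (simp only: ip_add_right)
    qed
    also have "ip I e (\<lambda>i. if i \<in> V then 0 else c i) = (\<Sum>i\<in>I - V. cnj (e i) * c i)"
      unfolding ip_def by (rule sum.mono_neutral_cong_right) (use fin in auto)
    \<comment> \<open>The samples of \<open>c\<close> cancel: only the unseen data \<open>r\<close>
      and the penalised part of \<open>c\<close> drive the error.\<close>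
    finally have eq: "ip I (M e) e = (\<Sum>t<q. of_real (1/4) * ip I e (z (xs t)) * r t) - (\<Sum>i\<in>I - V. cnj (e i) * c i)"
      by (simp add: algebra_simps sum.distrib add_divide_distrib)
    let ?Q = "quad_form I M e"
    have Q: "?Q = (\<Sum>i\<in>I - V. (cmod (e i))\<^sup>2) + (\<Sum>t<q. (cmod (ip I (z (xs t)) e))\<^sup>2) / 4"
      unfolding M_def qM by simp
    have am: "x * y \<le> (x\<^sup>2 + y\<^sup>2) / 2" for x y :: real
      using sum_squares_bound[of x y] by simp
    have "?Q = Re (ip I (M e) e)" by (simp add: quad_form_def selfadjD[OF sM])
    also have "\<dots> \<le> cmod (ip I (M e) e)" by (rule complex_Re_le_cmod)
    also have "\<dots> \<le> (\<Sum>t<q. (cmod (ip I (z (xs t)) e))\<^sup>2 / 8 + (cmod (r t))\<^sup>2 / 8)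
        + (\<Sum>i\<in>I - V. (cmod (e i))\<^sup>2 / 2 + (cmod (c i))\<^sup>2 / 2)"
      unfolding eq
    proof (rule order_trans[OF norm_triangle_ineq4], intro add_mono sum_norm_le)
      fix t
      have "cmod (ip I e (z (xs t))) = cmod (ip I (z (xs t)) e)" by (metis cnj_ip complex_mod_cnj)
      then show "cmod (of_real (1/4) * ip I e (z (xs t)) * r t)
          \<le> (cmod (ip I (z (xs t)) e))\<^sup>2 / 8 + (cmod (r t))\<^sup>2 / 8"
        using am[of "cmod (ip I (z (xs t)) e)" "cmod (r t)"] by (simp add: norm_mult)
    next
      fix i
      show "cmod (cnj (e i) * c i) \<le> (cmod (e i))\<^sup>2 / 2 + (cmod (c i))\<^sup>2 / 2"
        using am[of "cmod (e i)" "cmod (c i)"] by (simp add: norm_mult)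
    qed
    \<comment> \<open>The elementary inequality for products was weighted so that exactly half of
      \<open>?Q\<close> appears, which the left side absorbs.\<close>
    also have "\<dots> = ?Q / 2 + J / 2"
      unfolding Q J by (simp add: sum.distrib sum_divide_distrib[symmetric] add_divide_distrib)
    finally have QJ: "?Q \<le> J" by simp
    have "(\<Sum>i\<in>I - V. (cmod (e i))\<^sup>2) \<le> ?Q" unfolding Q by (simp add: sum_nonneg)
    with QJ dom[of e] show ?thesis by linarith
  qed
  show ?thesis
    using xs main unfolding Let_def q_def[symmetric] by blast
qed

section \<open>Fourier coefficients on the torus\<close>

definition circle :: "real measure" where
  "circle = scale_measure (ennreal (1 / (2 * pi))) (restrict_space lborel {0..2 * pi})"

definition character :: "nat \<Rightarrow> (nat \<Rightarrow> int) \<Rightarrow> (nat \<Rightarrow> real) \<Rightarrow> complex" where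
  "character d k x = cis (\<Sum>i<d. real_of_int (k i) * x i)"

lemma torus_eq: "torus d = (\<Pi>\<^sub>M i\<in>{..<d}. circle)"
  by (simp add: torus_def circle_def)

lemma space_circle [simp]: "space circle = {0..2 * pi}"
  by (simp add: circle_def space_scale_measure space_restrict_space)

lemma sets_circle [measurable_cong]: "sets circle = sets (restrict_space borel {0..2 * pi})"
  unfolding circle_def by (simp add: sets_restrict_space)

lemma measurable_circle: "f \<in> borel_measurable borel \<Longrightarrow> f \<in> borel_measurable circle"
  by (simp add: measurable_cong_sets[OF sets_circle refl] measurable_restrict_space1)

lemma emeasure_circle:
  assumes "A \<in> sets borel" "A \<subseteq> {0..2 * pi}"
  shows "emeasure circle A = ennreal (1 / (2 * pi)) * emeasure lborel A"
  using assms by (simp add: circle_def emeasure_restrict_space)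

lemma prob_space_circle: "prob_space circle"
proof
  have "emeasure circle (space circle) = ennreal (1 / (2 * pi)) * ennreal (2 * pi)"
    using emeasure_circle[of "{0..2 * pi}"] by simp
  also have "\<dots> = 1" by (simp add: ennreal_mult[symmetric])
  finally show "emeasure circle (space circle) = 1" .
qed

interpretation circle: prob_space circle
  by (rule prob_space_circle)

interpretation circle_product: product_prob_space "\<lambda>_. circle" UNIV
  by unfold_locales

interpretation torus: prob_space "torus d" for d
  unfolding torus_eq by (rule prob_space_PiM) (rule prob_space_circle)

lemma space_torus [simp]: "space (torus d) = torus_points d"
  by (simp add: torus_eq space_PiM torus_points_def)

lemma integral_circle:
  fixes f :: "real \<Rightarrow> complex"
  assumes [measurable]: "f \<in> borel_measurable borel"
  shows "integral\<^sup>L circle f = (1 / (2 * pi)) *\<^sub>R (LINT x|lborel. indicator {0..2 * pi} x *\<^sub>R f x)"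
proof -
  let ?R = "restrict_space lborel {0..2 * pi}"
  \<comment> \<open>A scaled measure is a density with constant weight, which gives access to
    integration against densities.\<close>
  have "circle = density ?R (\<lambda>_. ennreal (1 / (2 * pi)))"
    by (rule measure_eqI) (simp_all add: circle_def emeasure_density nn_integral_cmult)
  then have "integral\<^sup>L circle f = integral\<^sup>L (density ?R (\<lambda>_. ennreal (1 / (2 * pi)))) f" by simp
  also have "\<dots> = (LINT x|?R. (1 / (2 * pi)) *\<^sub>R f x)"
    by (rule integral_density) (auto intro: measurable_restrict_space1)
  finally have "integral\<^sup>L circle f = (LINT x|?R. (1 / (2 * pi)) *\<^sub>R f x)" .
  then show ?thesis
    by (simp add: integral_restrict_space del: scaleR_conv_of_real)
qed

lemma integral_cis_circle: "(LINT t|circle. cis (real_of_int k * t)) = (if k = 0 then 1 else 0)"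
proof (cases "k = 0")
  case True
  then show ?thesis using circle.prob_space by simp
next
  case False
  let ?F = "\<lambda>t. cis (real_of_int k * t) / (\<i> * of_int k)"
  have "(LINT x|lborel. indicator {0..2 * pi} x *\<^sub>R cis (real_of_int k * x)) = ?F (2 * pi) - ?F 0"
  proof (rule integral_FTC_atLeastAtMost)
    fix x :: real
    have "((\<lambda>t. cis (real_of_int k * t)) has_vector_derivative (real_of_int k *\<^sub>R (\<i> * cis (real_of_int k * x))))
        (at x within {0..2 * pi})"
      by (rule vector_diff_chain_within[of "\<lambda>t. real_of_int k * t" "real_of_int k" _ _ cis, unfolded o_def])
        (auto intro!: derivative_eq_intros simp: has_vector_derivative_def fun_eq_iff scaleR_conv_of_real)
    then show "(?F has_vector_derivative cis (real_of_int k * x)) (at x within {0..2 * pi})"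
      using False has_vector_derivative_divide[of _ _ _ "\<i> * of_int k"]
      by (fastforce simp: scaleR_conv_of_real field_simps)
  qed (auto intro!: continuous_intros)
  also have "cis (real_of_int k * (2 * pi)) = 1"
    by (metis cis_multiple_2pi Ints_of_int mult.commute)
  finally have "(LINT x|lborel. indicator {0..2 * pi} x *\<^sub>R cis (real_of_int k * x)) = 0" by simp
  then show ?thesis
    using False by (subst integral_circle) (auto intro!: borel_measurable_continuous_onI continuous_intros)
qed

lemma character_prod: "character d k x = (\<Prod>i<d. cis (real_of_int (k i) * x i))"
  unfolding character_def by (induction d) (simp_all add: cis_mult[symmetric])

lemma norm_character [simp]: "cmod (character d k x) = 1"
  by (simp add: character_def)

lemma character_mult_cnj: "character d k x * cnj (character d l x) = character d (\<lambda>i. k i - l i) x"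
  by (simp add: character_def cis_cnj cis_mult left_diff_distrib sum_subtractf)

lemma measurable_coordinate [measurable]: "i < d \<Longrightarrow> (\<lambda>x. x i) \<in> borel_measurable (torus d)"
proof -
  assume "i < d"
  then have "(\<lambda>x. x i) \<in> measurable (torus d) circle"
    unfolding torus_eq by (intro measurable_component_singleton) auto
  moreover have "(\<lambda>x. x) \<in> borel_measurable circle" by (rule measurable_circle) simp
  ultimately show ?thesis by (rule measurable_compose)
qed

lemma character_measurable [measurable]: "character d k \<in> borel_measurable (torus d)"
proof -
  have "cis \<in> borel_measurable borel"
    by (intro borel_measurable_continuous_onI continuous_intros)
  moreover have "(\<lambda>x. \<Sum>i<d. real_of_int (k i) * x i) \<in> borel_measurable (torus d)"
    by measurable
  ultimately show ?thesis unfolding character_def[abs_def] by measurable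
qed

lemma integrable_bounded_torus:
  fixes f :: "(nat \<Rightarrow> real) \<Rightarrow> complex"
  assumes "f \<in> borel_measurable (torus d)" "\<And>x. x \<in> torus_points d \<Longrightarrow> cmod (f x) \<le> B"
  shows "integrable (torus d) f"
  by (rule torus.integrable_const_bound[of _ B]) (use assms in \<open>auto intro!: AE_I2\<close>)

lemma integrable_mult_bounded:
  fixes f g :: "'a \<Rightarrow> complex"
  assumes "integrable M f" "g \<in> borel_measurable M" "\<And>x. x \<in> space M \<Longrightarrow> cmod (g x) \<le> B"
  shows "integrable M (\<lambda>x. f x * g x)"
proof (rule Bochner_Integration.integrable_bound[where f="\<lambda>x. B *\<^sub>R f x"])
  show "integrable M (\<lambda>x. B *\<^sub>R f x)" using assms(1) by simp
  show "(\<lambda>x. f x * g x) \<in> borel_measurable M"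
    using assms(1,2) by (intro borel_measurable_times) auto
  show "AE x in M. norm (f x * g x) \<le> norm (B *\<^sub>R f x)"
  proof (rule AE_I2)
    fix x assume "x \<in> space M"
    then have "cmod (g x) \<le> \<bar>B\<bar>" using assms(3) by force
    then have "cmod (f x) * cmod (g x) \<le> \<bar>B\<bar> * cmod (f x)"
      by (metis mult.commute mult_left_mono norm_ge_zero)
    then show "norm (f x * g x) \<le> norm (B *\<^sub>R f x)" by (simp add: norm_mult)
  qed
qed

lemma integrable_character: "integrable (torus d) (character d k)"
  by (rule integrable_bounded_torus[of _ _ 1]) auto

lemma integral_character:
  "(LINT x|torus d. character d k x) = (if \<forall>i<d. k i = 0 then 1 else 0)"
proof -
  have "(LINT x|torus d. (\<Prod>i<d. cis (real_of_int (k i) * x i)))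
     = (\<Prod>i<d. LINT t|circle. cis (real_of_int (k i) * t))"
    unfolding torus_eq
  proof (rule circle_product.product_integral_prod)
    show "integrable circle (\<lambda>t. cis (real_of_int (k i) * t))" for i
      by (rule circle.integrable_const_bound[of _ 1])
        (auto intro!: measurable_circle borel_measurable_continuous_onI continuous_intros)
  qed simp
  also have "\<dots> = (if \<forall>i<d. k i = 0 then 1 else 0)"
    by (auto simp: integral_cis_circle intro!: prod.neutral)
  finally show ?thesis by (simp add: character_prod)
qed

lemma character_orthonormal:
  assumes "k \<in> frequencies d" "l \<in> frequencies d"
  shows "(LINT x|torus d. character d k x * cnj (character d l x)) = (if k = l then 1 else 0)"
proof -
  have "(\<forall>i<d. k i - l i = 0) \<longleftrightarrow> k = l"
    using assms by (auto simp: frequencies_def PiE_def extensional_def fun_eq_iff) metis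
  then show ?thesis
    by (simp add: character_mult_cnj integral_character)
qed

lemma cnj_character: "cnj (character d k x) = character d (\<lambda>i. - k i) x"
  by (simp add: character_def cis_cnj sum_negf)

lemma fourier_coeff_eq: "fourier_coeff d f k = (LINT x|torus d. f x * cnj (character d k x))"
  unfolding fourier_coeff_def character_def cis_conv_exp exp_cnj by simp

lemma integrable_times_cnj_character:
  "integrable (torus d) f \<Longrightarrow> integrable (torus d) (\<lambda>x. f x * cnj (character d k x))"
  unfolding cnj_character by (rule integrable_mult_bounded[of _ _ _ 1]) auto

section \<open>Uniqueness of Fourier coefficients\<close>

text \<open>Discards the two end points, the only points of the closed interval that
  \<open>cis\<close> identifies.\<close>

lemma AE_torus_coordinate:
  assumes "i < d"
  shows "AE x in torus d. x i \<in> {0<..<2 * pi}"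
proof -
  have "AE t in circle. t \<in> {0<..<2 * pi}"
  proof (rule AE_I)
    show "{t \<in> space circle. t \<notin> {0<..<2 * pi}} \<subseteq> {0, 2 * pi}" by auto
    show "{0, 2 * pi} \<in> circle.events"
      unfolding sets_circle sets_restrict_space by (rule image_eqI[of _ _ "{0, 2 * pi}"]) auto
    show "emeasure circle {0, 2 * pi} = 0"
      by (subst emeasure_circle) (auto intro!: emeasure_lborel_countable)
  qed
  then show ?thesis
    unfolding torus_eq by (intro AE_PiM_component prob_space_circle) (use assms in auto)
qed

text \<open>The class of such functions is closed under multiplication by polynomials in \<open>Re\<close> and \<open>Im\<close>
  of \<open>cis (x i)\<close>, so that the Stone-Weierstrass theorem can be applied one coordinate at a time.\<close>

definition coord_null :: "nat \<Rightarrow> nat \<Rightarrow> ((nat \<Rightarrow> real) \<Rightarrow> complex) \<Rightarrow> bool" where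
  "coord_null d i F \<longleftrightarrow> integrable (torus d) F \<and>
     (\<forall>k::int. (LINT x|torus d. F x * cis (real_of_int k * x i)) = 0)"

lemma integrable_mult_coord:
  assumes "integrable (torus d) F" "i < d" and h: "h \<in> borel_measurable borel" "\<And>t. cmod (h t) \<le> B"
  shows "integrable (torus d) (\<lambda>x. F x * h (x i))"
  by (rule integrable_mult_bounded[OF assms(1) measurable_compose[OF measurable_coordinate[OF assms(2)] h(1)] h(2)])

lemma integrable_mult_cis:
  assumes "integrable (torus d) F" "i < d"
  shows "integrable (torus d) (\<lambda>x. F x * cis (c * x i))"
  by (rule integrable_mult_coord[OF assms, of "\<lambda>t. cis (c * t)" 1])
    (auto intro!: borel_measurable_continuous_onI continuous_intros)

lemma coord_null_lincomb:
  assumes F: "coord_null d i F" and G: "coord_null d i G" and i: "i < d"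
  shows "coord_null d i (\<lambda>x. a * F x + b * G x)"
proof -
  have iF: "integrable (torus d) F" and iG: "integrable (torus d) G"
    using F G by (auto simp: coord_null_def)
  have "(LINT x|torus d. (a * F x + b * G x) * cis (real_of_int k * x i)) = 0" for k
  proof -
    have "(LINT x|torus d. (a * F x + b * G x) * cis (real_of_int k * x i))
      = (LINT x|torus d. a * (F x * cis (real_of_int k * x i)) + b * (G x * cis (real_of_int k * x i)))"
      by (simp add: algebra_simps)
    also have "\<dots> = a * (LINT x|torus d. F x * cis (real_of_int k * x i))
        + b * (LINT x|torus d. G x * cis (real_of_int k * x i))"
      using integrable_mult_cis[OF iF i] integrable_mult_cis[OF iG i] by simp
    finally show ?thesis using F G by (simp add: coord_null_def)
  qed
  then show ?thesis using iF iG by (simp add: coord_null_def)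
qed

lemma coord_null_cis:
  assumes F: "coord_null d i F" and i: "i < d"
  shows "coord_null d i (\<lambda>x. F x * cis (real_of_int k * x i))"
proof -
  have eq: "F x * cis (real_of_int k * x i) * cis (real_of_int l * x i) = F x * cis (real_of_int (k + l) * x i)" for l x
    by (simp add: mult.assoc cis_mult distrib_right)
  show ?thesis
    using F integrable_mult_cis[OF _ i] unfolding coord_null_def eq by blast
qed

text \<open>By Euler's formula a real-linear functional of \<open>cis t\<close> is a combination of
  \<open>cis t\<close> and \<open>cis (- t)\<close>, so it only moves frequencies by one.
  \<open>F\<close> varies in the induction because a product is handled by absorbing its first
  factor into \<open>F\<close>.\<close>

lemma coord_null_polynomial:
  assumes "real_polynomial_function p" and i: "i < d" and F: "coord_null d i F"
  shows "coord_null d i (\<lambda>x. F x * of_real (p (cis (x i))))"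
  using assms(1) F
proof (induction p arbitrary: F rule: real_polynomial_function.induct)
  case (linear f)
  interpret f: bounded_linear f by fact
  define \<alpha> where "\<alpha> = (complex_of_real (f 1) - \<i> * f \<i>) / 2"
  define \<beta> where "\<beta> = (complex_of_real (f 1) + \<i> * f \<i>) / 2"
  have "complex_of_real (f (cis t)) = \<alpha> * cis t + \<beta> * cis (- t)" for t
  proof -
    have "f (cis t) = f (cos t *\<^sub>R 1 + sin t *\<^sub>R \<i>)"
      by (rule arg_cong[where f=f]) (simp add: complex_eq_iff)
    also have "\<dots> = cos t * f 1 + sin t * f \<i>"
      by (simp only: f.add f.scaleR real_scaleR_def)
    finally show ?thesis
      by (simp add: \<alpha>_def \<beta>_def complex_eq_iff field_simps)
  qed
  then have eq: "(\<lambda>x. F x * of_real (f (cis (x i))))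
     = (\<lambda>x. \<alpha> * (F x * cis (real_of_int 1 * x i)) + \<beta> * (F x * cis (real_of_int (-1) * x i)))"
    by (simp add: algebra_simps)
  show ?case
    unfolding eq by (rule coord_null_lincomb[OF coord_null_cis[OF linear(2) i] coord_null_cis[OF linear(2) i] i])
next
  case (const c)
  have eq: "(\<lambda>x. F x * complex_of_real c) = (\<lambda>x. of_real c * F x + 0 * F x)" by (simp add: mult.commute)
  show ?case unfolding eq by (rule coord_null_lincomb[OF const const i])
next
  case (add f g)
  have eq: "(\<lambda>x. F x * complex_of_real (f (cis (x i)) + g (cis (x i))))
      = (\<lambda>x. 1 * (F x * of_real (f (cis (x i)))) + 1 * (F x * of_real (g (cis (x i)))))"
    by (simp add: algebra_simps)
  show ?case unfolding eq by (rule coord_null_lincomb[OF add.IH(1)[OF add.prems] add.IH(2)[OF add.prems] i])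
next
  case (mult f g)
  have eq: "(\<lambda>x. F x * complex_of_real (f (cis (x i)) * g (cis (x i))))
      = (\<lambda>x. F x * of_real (f (cis (x i))) * of_real (g (cis (x i))))"
    by (simp add: algebra_simps)
  show ?case unfolding eq by (rule mult.IH(2)[OF mult.IH(1)[OF mult.prems]])
qed

text \<open>Polynomials approximate \<open>u\<close> uniformly on the unit circle by
  Stone-Weierstrass, and the error in the integral is at most the uniform error times the integral
  of the modulus of \<open>F\<close>.\<close>

lemma coord_null_continuous:
  assumes i: "i < d" and F: "coord_null d i F" and u: "continuous_on UNIV u" "\<And>z. \<bar>u z\<bar> \<le> 1"
  shows "(LINT x|torus d. F x * of_real (u (cis (x i)))) = 0"
proof -
  have iF: "integrable (torus d) F" using F by (simp add: coord_null_def)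
  have int_u: "integrable (torus d) (\<lambda>x. F x * of_real (u (cis (x i))))"
  proof (rule integrable_mult_coord[OF iF i, of _ 1])
    show "(\<lambda>t. complex_of_real (u (cis t))) \<in> borel_measurable borel"
      by (intro borel_measurable_continuous_onI continuous_on_of_real continuous_on_compose2[OF u(1)] continuous_intros) auto
  qed (use u(2) in auto)
  define B where "B = (LINT x|torus d. cmod (F x))"
  have "cmod (LINT x|torus d. F x * of_real (u (cis (x i)))) \<le> e" if e: "0 < e" for e
  proof -
    have B0: "0 \<le> B" by (simp add: B_def)
    define e' where "e' = e / (B + 1)"
    have e': "0 < e'" using e B0 by (simp add: e'_def)
    obtain p where p: "real_polynomial_function p" "\<And>z. z \<in> sphere 0 1 \<Longrightarrow> \<bar>u z - p z\<bar> < e'"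
      using Stone_Weierstrass_real_polynomial_function[OF compact_sphere continuous_on_subset[OF u(1) subset_UNIV] e']
      by blast
    have null: "coord_null d i (\<lambda>x. F x * of_real (p (cis (x i))))"
      by (rule coord_null_polynomial[OF p(1) i F])
    then have int_p: "integrable (torus d) (\<lambda>x. F x * of_real (p (cis (x i))))"
      by (simp add: coord_null_def)
    have p0: "(LINT x|torus d. F x * of_real (p (cis (x i)))) = 0"
      using null[unfolded coord_null_def, THEN conjunct2, rule_format, of 0] by simp
    have "(LINT x|torus d. F x * of_real (u (cis (x i))))
        = (LINT x|torus d. F x * of_real (u (cis (x i))) - F x * of_real (p (cis (x i))))"
      using int_u int_p p0 by simp
    also have "cmod \<dots> \<le> (LINT x|torus d. cmod (F x * of_real (u (cis (x i))) - F x * of_real (p (cis (x i)))))"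
      by (rule integral_norm_bound)
    also have "\<dots> \<le> (LINT x|torus d. e' * cmod (F x))"
    proof (rule integral_mono)
      show "integrable (torus d) (\<lambda>x. cmod (F x * of_real (u (cis (x i))) - F x * of_real (p (cis (x i)))))"
        using int_u int_p by auto
      show "integrable (torus d) (\<lambda>x. e' * cmod (F x))" using iF by auto
      fix x
      have "cmod (F x * of_real (u (cis (x i))) - F x * of_real (p (cis (x i))))
          = cmod (F x) * \<bar>u (cis (x i)) - p (cis (x i))\<bar>"
        by (simp add: norm_mult[symmetric] right_diff_distrib[symmetric] del: of_real_diff)
          (simp add: norm_mult of_real_diff[symmetric] del: of_real_diff)
      also have "\<dots> \<le> cmod (F x) * e'"
        using p(2)[of "cis (x i)"] by (intro mult_left_mono) auto
      finally show "cmod (F x * of_real (u (cis (x i))) - F x * of_real (p (cis (x i)))) \<le> e' * cmod (F x)"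
        by (simp add: mult.commute)
    qed
    also have "\<dots> = e' * B" by (simp add: B_def)
    also have "\<dots> \<le> e" using e B0 by (simp add: e'_def field_simps)
    finally show ?thesis .
  qed
  then have "cmod (LINT x|torus d. F x * of_real (u (cis (x i)))) \<le> 0"
    by (rule field_le_epsilon[of _ 0, simplified])
  then show ?thesis by simp
qed

text \<open>The indicator of an open set is the pointwise limit of truncated multiples of the
  distance to its complement; dominated convergence does the rest.\<close>

lemma coord_null_open:
  assumes i: "i < d" and F: "coord_null d i F" and G: "open G"
  shows "(LINT x|torus d. F x * indicator G (cis (x i))) = 0"
\<comment> \<open>When the complement is empty, \<open>infdist\<close> is 0 by convention, and the
  approximating functions below would vanish instead of tending to 1.\<close>
proof (cases "G = UNIV")
  case True
  then show ?thesis using coord_null_continuous[OF i F, of "\<lambda>_. 1"] by simp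
next
  case False
  have iF: "integrable (torus d) F" using F by (simp add: coord_null_def)
  define u where "u n z = min 1 (real n * infdist z (- G))" for n z
  have cu: "continuous_on UNIV (u n)" for n
    unfolding u_def by (intro continuous_intros)
  have u1: "\<bar>u n z\<bar> \<le> 1" for n z
  proof -
    have "0 \<le> real n * infdist z (- G)" by (simp add: infdist_nonneg)
    then show ?thesis by (simp add: u_def)
  qed
  have lim: "(\<lambda>n. u n z) \<longlonglongrightarrow> indicator G z" for z
  proof (cases "z \<in> G")
    case True
    have "0 < infdist z (- G)"
      using False True G infdist_pos_not_in_closed[of "- G" z] by (auto simp: closed_Compl)
    then obtain N where N: "1 < real N * infdist z (- G)"
      using reals_Archimedean3 by blast
    have "u n z = 1" if "N \<le> n" for n
    proof -
      have "real N * infdist z (- G) \<le> real n * infdist z (- G)"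
        using that by (intro mult_right_mono infdist_nonneg) auto
      then show ?thesis using N by (simp add: u_def)
    qed
    then show ?thesis using True
      by (intro tendsto_eventually) (auto simp: eventually_sequentially)
  next
    case zG: False
    then have "infdist z (- G) = 0" by (intro infdist_zero) simp
    then show ?thesis using zG by (simp add: u_def)
  qed
  have "(\<lambda>n. LINT x|torus d. F x * of_real (u n (cis (x i)))) \<longlonglongrightarrow> (LINT x|torus d. F x * indicator G (cis (x i)))"
  proof (rule integral_dominated_convergence[where w="\<lambda>x. cmod (F x)"])
    have mc: "(\<lambda>x. cis (x i)) \<in> borel_measurable (torus d)"
      by (rule measurable_compose[OF measurable_coordinate[OF i]])
        (intro borel_measurable_continuous_onI continuous_intros)
    show "(\<lambda>x. F x * indicator G (cis (x i))) \<in> borel_measurable (torus d)"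
      using iF mc G by (intro borel_measurable_times measurable_compose[OF mc] borel_measurable_indicator) auto
    show "(\<lambda>x. F x * of_real (u n (cis (x i)))) \<in> borel_measurable (torus d)" for n
      using iF by (intro borel_measurable_times measurable_compose[OF mc] borel_measurable_continuous_onI
         continuous_on_of_real cu) auto
    show "integrable (torus d) (\<lambda>x. cmod (F x))" using iF by simp
    show "AE x in torus d. (\<lambda>n. F x * of_real (u n (cis (x i)))) \<longlonglongrightarrow> F x * indicator G (cis (x i))"
    proof (rule AE_I2)
      fix x
      have "(\<lambda>n. complex_of_real (u n (cis (x i)))) \<longlonglongrightarrow> of_real (indicator G (cis (x i)))"
        by (intro tendsto_of_real lim)
      then show "(\<lambda>n. F x * of_real (u n (cis (x i)))) \<longlonglongrightarrow> F x * indicator G (cis (x i))"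
        by (intro tendsto_mult tendsto_const) (simp add: of_real_indicator)
    qed
    show "AE x in torus d. norm (F x * of_real (u n (cis (x i)))) \<le> cmod (F x)" for n
      using u1 by (auto intro!: AE_I2 mult_left_le simp: norm_mult)
  qed
  then have "(\<lambda>n. 0::complex) \<longlonglongrightarrow> (LINT x|torus d. F x * indicator G (cis (x i)))"
    by (simp add: coord_null_continuous[OF i F cu u1])
  then show ?thesis by (simp add: LIMSEQ_const_iff)
qed

lemma cis_inj_interior:
  assumes "t \<in> {0<..<2 * pi}" "s \<in> {0..2 * pi}" "cis t = cis s"
  shows "t = s"
proof -
  have "cis (t - s) = 1" using assms(3) by (simp add: cis_divide[symmetric])
  then have "cos (t - s) = 1" by (simp add: complex_eq_iff)
  then obtain n :: int where n: "t - s = of_int n * (2 * pi)"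
    by (auto simp: cos_one_2pi_int)
  have "\<bar>t - s\<bar> < 2 * pi" using assms(1,2) by auto
  then have "\<bar>real_of_int n\<bar> < 1" using n by (simp add: abs_mult)
  then have "n = 0" by linarith
  then show ?thesis using n by simp
qed

text \<open>Dynkin's argument for the complex measure with density \<open>g\<close>, pushed forward
  by \<open>\<phi>\<close>. Vanishing total mass handles complements, dominated convergence the
  disjoint unions. It is used with \<open>\<phi>\<close> a coordinate and with \<open>\<phi>\<close>
  the identity.\<close>

lemma integral_indicator_sigma_sets:
  fixes g :: "'a \<Rightarrow> complex"
  assumes g: "integrable M g" and G: "Int_stable G" "G \<subseteq> Pow \<Omega>"
    and \<phi>: "\<phi> \<in> measurable M (sigma \<Omega> G)"
    and total: "integral\<^sup>L M g = 0"
    and basic: "\<And>A. A \<in> G \<Longrightarrow> (LINT x|M. g x * indicator A (\<phi> x)) = 0"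
    and A: "A \<in> sigma_sets \<Omega> G"
  shows "(LINT x|M. g x * indicator A (\<phi> x)) = 0"
proof -
  have int: "integrable M (\<lambda>x. g x * indicator A (\<phi> x))" if "A \<in> sigma_sets \<Omega> G" for A
    by (rule integrable_mult_bounded[OF g measurable_compose[OF \<phi> borel_measurable_indicator], of _ 1])
      (use that G(2) in \<open>auto simp: indicator_def\<close>)
  have \<Omega>: "\<phi> x \<in> \<Omega>" if "x \<in> space M" for x
    using measurable_space[OF \<phi> that] G(2) by (simp add: space_measure_of)
  show ?thesis
    using G A
  proof (induction rule: sigma_sets_induct_disjoint)
    case (basic A)
    then show ?case by (rule assms(6))
  next
    case empty
    show ?case by simp
  next
    case (compl A)
    have "(LINT x|M. g x * indicator (\<Omega> - A) (\<phi> x)) = (LINT x|M. g x - g x * indicator A (\<phi> x))"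
      using \<Omega> by (intro Bochner_Integration.integral_cong) (auto simp: indicator_def)
    then show ?case using int[OF compl(1)] compl(2) g total by simp
  next
    case (union A)
    have A: "A n \<in> sigma_sets \<Omega> G" for n using union(2) by auto
    have "(\<lambda>n. LINT x|M. (\<Sum>j<n. g x * indicator (A j) (\<phi> x))) \<longlonglongrightarrow> (LINT x|M. g x * indicator (\<Union>n. A n) (\<phi> x))"
    proof (rule integral_dominated_convergence[where w="\<lambda>x. cmod (g x)"])
      show "(\<lambda>x. g x * indicator (\<Union>n. A n) (\<phi> x)) \<in> borel_measurable M"
        using int[OF sigma_sets.Union[of A]] A by auto
      show "(\<lambda>x. \<Sum>j<n. g x * indicator (A j) (\<phi> x)) \<in> borel_measurable M" for n
        using int[OF A] by (intro borel_measurable_sum) auto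
      show "integrable M (\<lambda>x. cmod (g x))" using g by simp
      have eq: "(\<Sum>j<n. indicator (A j) t) = (indicator (\<Union>j<n. A j) t :: complex)" for n t
        using union(1) by (subst indicator_UN_disjoint) (auto simp: disjoint_family_on_def)
      show "AE x in M. (\<lambda>n. \<Sum>j<n. g x * indicator (A j) (\<phi> x)) \<longlonglongrightarrow> g x * indicator (\<Union>n. A n) (\<phi> x)"
        unfolding sum_distrib_left[symmetric] eq
        by (intro AE_I2 tendsto_mult tendsto_const LIMSEQ_indicator_UN)
      show "AE x in M. norm (\<Sum>j<n. g x * indicator (A j) (\<phi> x)) \<le> cmod (g x)" for n
        unfolding sum_distrib_left[symmetric] eq
        by (intro AE_I2) (simp add: norm_mult indicator_def)
    qed
    moreover have "(LINT x|M. (\<Sum>j<n. g x * indicator (A j) (\<phi> x))) = 0" for n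
      by (subst Bochner_Integration.integral_sum) (use int[OF A] union(3) in auto)
    ultimately show ?case by (simp add: LIMSEQ_const_iff)
  qed
qed

text \<open>Transfers the result from the circle to the interval: off the null set of end points, an
  open subset of the interval corresponds under \<open>cis\<close> to an open subset of the plane.
  Open sets then generate all Borel sets.\<close>

lemma coord_null_borel:
  assumes i: "i < d" and F: "coord_null d i F" and A: "A \<in> sets borel"
  shows "(LINT x|torus d. F x * indicator A (x i)) = 0"
proof -
  have iF: "integrable (torus d) F" using F by (simp add: coord_null_def)
  have opn: "(LINT x|torus d. F x * indicator U (x i)) = 0" if U: "open U" for U
  proof -
    define U' where "U' = U \<inter> {0<..<2 * pi}"
    \<comment> \<open>The complement of a compact image is open, which avoids any discussion of
      \<open>cis\<close> as an open map.\<close>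
    define G where "G = - (cis ` ({0..2 * pi} - U'))"
    have "compact ({0..2 * pi} - U')"
      unfolding U'_def using U by (intro compact_diff) auto
    then have "compact (cis ` ({0..2 * pi} - U'))"
      by (intro compact_continuous_image continuous_intros)
    then have G: "open G" by (simp add: G_def compact_imp_closed open_Compl)
    have iff: "cis t \<in> G \<longleftrightarrow> t \<in> U" if t: "t \<in> {0<..<2 * pi}" for t
      using cis_inj_interior[OF t] t by (force simp: G_def U'_def)
    have "(LINT x|torus d. F x * indicator U (x i)) = (LINT x|torus d. F x * indicator G (cis (x i)))"
    proof (rule integral_cong_AE)
      show "AE x in torus d. F x * indicator U (x i) = F x * indicator G (cis (x i))"
        by (rule eventually_mono[OF AE_torus_coordinate[OF i]]) (simp add: indicator_def iff)
      show "(\<lambda>x. F x * indicator U (x i)) \<in> borel_measurable (torus d)"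
        using iF U by (intro borel_measurable_times measurable_compose[OF measurable_coordinate[OF i]] borel_measurable_indicator) auto
      have "cis \<in> borel_measurable borel" by (intro borel_measurable_continuous_onI continuous_intros)
      from measurable_compose[OF measurable_coordinate[OF i] this]
      have mc: "(\<lambda>x. cis (x i)) \<in> borel_measurable (torus d)" .
      show "(\<lambda>x. F x * indicator G (cis (x i))) \<in> borel_measurable (torus d)"
        using iF G by (intro borel_measurable_times measurable_compose[OF mc] borel_measurable_indicator) auto
    qed
    then show ?thesis using coord_null_open[OF i F G] by simp
  qed
  have eq: "sigma UNIV {S. open S} = (borel :: real measure)" by (simp add: borel_def)
  show ?thesis
  proof (rule integral_indicator_sigma_sets[OF iF, where G="{S. open S}" and \<Omega>=UNIV])
    show "(\<lambda>x. x i) \<in> measurable (torus d) (sigma UNIV {S. open S})"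
      unfolding eq by (rule measurable_coordinate[OF i])
    show "A \<in> sigma_sets UNIV {S. open S}" using A by (simp add: borel_def)
    show "integral\<^sup>L (torus d) F = 0" using opn[of UNIV] by simp
  qed (use opn in \<open>auto simp: Int_stable_def\<close>)
qed

text \<open>Exponential factors are exchanged for indicators one coordinate at a time. The frequency
  \<open>k\<close> is general in the induction, because the exchange at coordinate \<open>i\<close>
  relies on all integer frequencies there.\<close>

lemma integral_mixed_zero:
  assumes f: "integrable (torus d) f" and null: "\<And>k. fourier_coeff d f k = 0"
    and S: "S \<subseteq> {..<d}" and A: "\<And>i. A i \<in> sets borel"
  shows "(LINT x|torus d. f x * (\<Prod>i\<in>S. indicator (A i) (x i)) * (\<Prod>i\<in>{..<d} - S. cis (real_of_int (k i) * x i))) = 0"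
proof -
  have "finite S" using S by (rule finite_subset) simp
  then show ?thesis using S
  proof (induction S arbitrary: k rule: finite_induct)
    case empty
    have "(\<Prod>i<d. cis (real_of_int (k i) * x i)) = cnj (character d (\<lambda>i. - k i) x)" for x
      using cnj_character[of d "\<lambda>i. - k i" x] by (simp add: character_prod)
    then show ?case using null[of "\<lambda>i. - k i"] by (simp add: fourier_coeff_eq)
  next
    case (insert i S)
    then have i: "i < d" and S: "S \<subseteq> {..<d}" by auto
    let ?C = "{..<d} - insert i S"
    define F where "F x = f x * (\<Prod>i\<in>S. indicator (A i) (x i)) * (\<Prod>i\<in>?C. cis (real_of_int (k i) * x i))" for x
    have C: "{..<d} - S = insert i ?C" using i insert.hyps by auto
    have "F x * cis (real_of_int l * x i)
        = f x * (\<Prod>i\<in>S. indicator (A i) (x i)) * (\<Prod>j\<in>{..<d} - S. cis (real_of_int ((k(i := l)) j) * x j))" for l x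
    proof -
      have "(\<Prod>j\<in>{..<d} - S. cis (real_of_int ((k(i := l)) j) * x j))
          = cis (real_of_int l * x i) * (\<Prod>j\<in>?C. cis (real_of_int ((k(i := l)) j) * x j))"
        unfolding C by (subst prod.insert) auto
      also have "(\<Prod>j\<in>?C. cis (real_of_int ((k(i := l)) j) * x j)) = (\<Prod>j\<in>?C. cis (real_of_int (k j) * x j))"
        by (intro prod.cong) auto
      finally show ?thesis by (simp add: F_def)
    qed
    then have z: "(LINT x|torus d. F x * cis (real_of_int l * x i)) = 0" for l
      using insert.IH[OF S] by simp
    have "integrable (torus d) (\<lambda>x. f x * ((\<Prod>i\<in>S. indicator (A i) (x i)) * (\<Prod>i\<in>?C. cis (real_of_int (k i) * x i))))"
    proof (rule integrable_mult_bounded[OF f, of _ 1])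
      have "(\<lambda>x. indicator (A j) (x j) :: complex) \<in> borel_measurable (torus d)" if "j \<in> S" for j
        using that S A by (intro measurable_compose[OF measurable_coordinate] borel_measurable_indicator) auto
      moreover have "(\<lambda>x. cis (real_of_int (k j) * x j)) \<in> borel_measurable (torus d)" if "j \<in> ?C" for j
        using that by (intro measurable_compose[OF measurable_coordinate, of j d "\<lambda>t. cis (real_of_int (k j) * t)"]
            borel_measurable_continuous_onI continuous_intros) auto
      ultimately show "(\<lambda>x. (\<Prod>i\<in>S. indicator (A i) (x i)) * (\<Prod>i\<in>?C. cis (real_of_int (k i) * x i))) \<in> borel_measurable (torus d)"
        by (intro borel_measurable_times borel_measurable_prod)
      show "cmod ((\<Prod>i\<in>S. indicator (A i) (x i)) * (\<Prod>i\<in>?C. cis (real_of_int (k i) * x i))) \<le> 1" for x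
        by (simp add: norm_mult prod_norm[symmetric]) (auto intro!: prod_le_1 simp: indicator_def)
    qed
    then have "coord_null d i F"
      using z by (simp add: coord_null_def F_def[abs_def] mult.assoc)
    from coord_null_borel[OF i this A[of i]] show ?case
      using insert.hyps by (simp add: F_def algebra_simps)
  qed
qed

text \<open>With all coordinates exchanged, the integral of \<open>f\<close> over every measurable
  box is 0. Boxes are stable under intersection and generate the product sets, so the integral over
  every measurable set is 0.\<close>

theorem fourier_coeff_unique_zero:
  assumes f: "integrable (torus d) f" and null: "\<And>k. fourier_coeff d f k = 0"
  shows "AE x in torus d. f x = 0"
proof (rule torus.density_zero[OF f])
  fix A assume A: "A \<in> sets (torus d)"
  define G where "G = {(\<Pi>\<^sub>E i\<in>{..<d}. X i) |X. \<forall>i\<in>{..<d}. X i \<in> sets circle}"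
  have Gsub: "G \<subseteq> Pow (torus_points d)"
  proof
    fix B assume "B \<in> G"
    then obtain X where "B = (\<Pi>\<^sub>E i\<in>{..<d}. X i)" "\<And>i. i \<in> {..<d} \<Longrightarrow> X i \<in> sets circle"
      unfolding G_def by blast
    then have "B \<subseteq> torus_points d"
      unfolding torus_points_def using sets.sets_into_space[of _ circle] by (simp only: space_circle PiE_mono)
    then show "B \<in> Pow (torus_points d)" by simp
  qed
  have GA: "G \<subseteq> sets (torus d)"
    unfolding G_def torus_eq by (auto intro!: sets_PiM_I_finite)
  have sub: "sets (torus d) \<subseteq> sigma_sets (torus_points d) G"
  proof -
    have "sets (torus d) = sigma_sets (torus_points d)
        {(\<Pi>\<^sub>E i\<in>{..<d}. X i) |X. (\<forall>i. X i \<in> sets circle) \<and> finite {i. X i \<noteq> space circle}}"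
      unfolding torus_eq sets_PiM_finite by (simp add: torus_points_def)
    also have "\<dots> \<subseteq> sigma_sets (torus_points d) G"
      by (rule sigma_sets_mono') (auto simp: G_def)
    finally show ?thesis .
  qed
  have "(LINT x|torus d. f x * indicator A x) = 0"
  proof (rule integral_indicator_sigma_sets[OF f, where G=G and \<Omega>="torus_points d" and \<phi>="\<lambda>x. x"])
    show "Int_stable G" unfolding G_def by (rule Int_stable_PiE)
    show "G \<subseteq> Pow (torus_points d)" by (rule Gsub)
    show "(\<lambda>x. x) \<in> torus d \<rightarrow>\<^sub>M sigma (torus_points d) G"
    proof (rule measurable_measure_of[OF Gsub])
      fix B assume "B \<in> G"
      then have "B \<in> sets (torus d)" using GA by blast
      from sets.Int[OF this sets.top]
      show "(\<lambda>x. x) -` B \<inter> space (torus d) \<in> sets (torus d)" by simp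
    qed simp
    show "A \<in> sigma_sets (torus_points d) G" using A sub by blast
    show "integral\<^sup>L (torus d) f = 0"
      using integral_mixed_zero[OF f null, of "{}" "\<lambda>_. UNIV" "\<lambda>_. 0"] by simp
    fix B assume "B \<in> G"
    then obtain X where X: "B = (\<Pi>\<^sub>E i\<in>{..<d}. X i)" "\<And>i. i < d \<Longrightarrow> X i \<in> sets circle"
      by (auto simp: G_def)
    have Xb: "X i \<in> sets borel" if "i < d" for i
      using X(2)[OF that] unfolding sets_circle by (auto simp: sets_restrict_space)
    have "(LINT x|torus d. f x * indicator B x)
       = (LINT x|torus d. f x * (\<Prod>i<d. indicator ((\<lambda>i. if i < d then X i else {}) i) (x i)) * (\<Prod>i\<in>{..<d} - {..<d}. cis (real_of_int 0 * x i)))"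
    proof (rule Bochner_Integration.integral_cong[OF refl])
      fix x assume "x \<in> space (torus d)"
      then have "x \<in> extensional {..<d}" by (simp add: torus_points_def PiE_def)
      then have "(\<Prod>i<d. indicator (if i < d then X i else {}) (x i)) = (indicator B x :: complex)"
      proof (cases "\<exists>i<d. x i \<notin> X i")
        case True
        then obtain i where i: "i < d" "x i \<notin> X i" by blast
        have "x \<notin> B" using i by (auto simp: X(1) dest: PiE_mem)
        moreover have "(\<Prod>i<d. indicator (if i < d then X i else {}) (x i)) = (0::complex)"
          using i by (intro prod_zero bexI[of _ i]) auto
        ultimately show ?thesis by simp
      next
        case False
        then have "x \<in> B" using \<open>x \<in> extensional {..<d}\<close> by (simp add: X(1) PiE_def Pi_def)
        with False show ?thesis by simp
      qed
      then show "f x * indicator B x = f x * (\<Prod>i<d. indicator ((\<lambda>i. if i < d then X i else {}) i) (x i)) * (\<Prod>i\<in>{..<d} - {..<d}. cis (real_of_int 0 * x i))"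
        by simp
    qed
    also have "\<dots> = 0"
      by (rule integral_mixed_zero[OF f null, where k="\<lambda>_. 0"]) (use Xb in auto)
    finally show "(LINT x|torus d. f x * indicator B x) = 0" .
  qed
  then show "set_lebesgue_integral (torus d) A f = 0"
    by (simp add: set_lebesgue_integral_def scaleR_conv_of_real of_real_indicator mult.commute)
qed

corollary fourier_coeff_unique:
  assumes f: "integrable (torus d) f" and g: "integrable (torus d) g"
    and eq: "\<And>k. k \<in> frequencies d \<Longrightarrow> fourier_coeff d f k = fourier_coeff d g k"
  shows "AE x in torus d. f x = g x"
proof -
  \<comment> \<open>The coefficient reads \<open>k\<close> only below \<open>d\<close>, so equality
    on the extensional frequencies extends to every \<open>k\<close>.\<close>
  have "fourier_coeff d h k = fourier_coeff d h (restrict k {..<d})" for h k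
    by (simp add: fourier_coeff_def)
  moreover have "restrict k {..<d} \<in> frequencies d" for k by (simp add: frequencies_def)
  ultimately have "fourier_coeff d f k = fourier_coeff d g k" for k using eq by metis
  then have "fourier_coeff d (\<lambda>x. f x - g x) k = 0" for k
    using integrable_times_cnj_character[OF f, of k] integrable_times_cnj_character[OF g, of k]
    by (simp add: fourier_coeff_eq left_diff_distrib)
  from fourier_coeff_unique_zero[OF _ this] f g show ?thesis by simp
qed

section \<open>Absolutely convergent Fourier series\<close>

lemma Linf_norm_le:
  assumes "f \<in> borel_measurable (torus d)" "AE x in torus d. cmod (f x) \<le> B"
  shows "Linf_norm d f \<le> ennreal B"
  unfolding Linf_norm_def using assms by (intro esssup_I) (auto intro: ennreal_leI)

lemma AE_Linf_norm:
  assumes "Linf_norm d f \<le> ennreal B" "0 \<le> B"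
  shows "AE x in torus d. cmod (f x) \<le> B"
  using esssup_AE[of "\<lambda>x. ennreal (cmod (f x))" "torus d"]
proof (rule eventually_mono)
  fix x assume "ennreal (cmod (f x)) \<le> esssup (torus d) (\<lambda>x. ennreal (cmod (f x)))"
  then have "ennreal (cmod (f x)) \<le> ennreal B" using assms(1) by (simp add: Linf_norm_def)
  then show "cmod (f x) \<le> B" using assms(2) by simp
qed

lemma Linf_integrable:
  assumes "f \<in> Linf d"
  shows "integrable (torus d) f"
proof -
  have m: "f \<in> borel_measurable (torus d)" and fin: "Linf_norm d f < \<infinity>"
    using assms by (auto simp: Linf_def)
  obtain B where B: "Linf_norm d f = ennreal B" "0 \<le> B"
    using fin by (cases "Linf_norm d f") auto
  have "AE x in torus d. norm (f x) \<le> B" using AE_Linf_norm[of d f B] B by simp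
  then show ?thesis using m by (rule torus.integrable_const_bound)
qed

lemma Linf_bounded:
  assumes "f \<in> borel_measurable (torus d)" "\<And>x. x \<in> torus_points d \<Longrightarrow> cmod (f x) \<le> B"
  shows "f \<in> Linf d"
proof -
  have "Linf_norm d f \<le> ennreal B"
    using assms by (intro Linf_norm_le AE_I2) simp_all
  also have "\<dots> < \<infinity>" by simp
  finally show ?thesis using assms(1) by (simp add: Linf_def)
qed

lemma trig_poly_measurable [measurable]: "(\<lambda>x. \<Sum>k\<in>K. c k * character d k x) \<in> borel_measurable (torus d)"
  by (intro borel_measurable_sum borel_measurable_times borel_measurable_const character_measurable)

lemma norm_trig_poly_le: "cmod (\<Sum>k\<in>K. c k * character d k x) \<le> (\<Sum>k\<in>K. cmod (c k))"
  by (rule sum_norm_le) (simp add: norm_mult)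

lemma trig_poly_Linf: "(\<lambda>x. \<Sum>k\<in>K. c k * character d k x) \<in> Linf d"
  by (rule Linf_bounded[OF trig_poly_measurable norm_trig_poly_le])

lemma trig_poly_integrable: "integrable (torus d) (\<lambda>x. \<Sum>k\<in>K. c k * character d k x)"
  by (rule Linf_integrable[OF trig_poly_Linf])

lemma fourier_coeff_trig_poly:
  assumes "finite K" "K \<subseteq> frequencies d" "l \<in> frequencies d"
  shows "fourier_coeff d (\<lambda>x. \<Sum>k\<in>K. c k * character d k x) l = (if l \<in> K then c l else 0)"
proof -
  have "fourier_coeff d (\<lambda>x. \<Sum>k\<in>K. c k * character d k x) l
      = (LINT x|torus d. (\<Sum>k\<in>K. c k * (character d k x * cnj (character d l x))))"
    by (simp add: fourier_coeff_eq sum_distrib_right mult.assoc)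
  also have "\<dots> = (\<Sum>k\<in>K. c k * (LINT x|torus d. character d k x * cnj (character d l x)))"
    using integrable_times_cnj_character[OF integrable_character] by (subst Bochner_Integration.integral_sum) auto
  also have "\<dots> = (\<Sum>k\<in>K. if k = l then c k else 0)"
    using assms by (intro sum.cong) (auto simp: character_orthonormal)
  finally show ?thesis using assms(1) by simp
qed

lemma fourier_coeff_diff:
  assumes "integrable (torus d) f" "integrable (torus d) g"
  shows "fourier_coeff d (\<lambda>x. f x - g x) k = fourier_coeff d f k - fourier_coeff d g k"
  using assms[THEN integrable_times_cnj_character, of k] by (simp add: fourier_coeff_eq left_diff_distrib)

lemma fourier_coeff_lincomb:
  assumes "integrable (torus d) f" "integrable (torus d) g"
  shows "fourier_coeff d (\<lambda>x. a * f x + b * g x) k = a * fourier_coeff d f k + b * fourier_coeff d g k"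
  using assms[THEN integrable_times_cnj_character, of k] by (simp add: fourier_coeff_eq distrib_right mult.assoc)

lemma fourier_coeff_bound:
  assumes "f \<in> borel_measurable (torus d)" "\<And>x. x \<in> torus_points d \<Longrightarrow> cmod (f x) \<le> B"
  shows "cmod (fourier_coeff d f k) \<le> B"
proof -
  have f: "integrable (torus d) f" by (rule integrable_bounded_torus[OF assms])
  have "cmod (fourier_coeff d f k) \<le> (LINT x|torus d. cmod (f x * cnj (character d k x)))"
    unfolding fourier_coeff_eq by (rule integral_norm_bound)
  also have "\<dots> \<le> (LINT x|torus d. B)"
    using integrable_norm[OF f] assms(2) by (intro integral_mono) (auto simp: norm_mult)
  finally show ?thesis using torus.prob_space by simp
qed

section \<open>Sums of absolutely convergent Fourier series\<close>

definition fourier_series :: "nat \<Rightarrow> ((nat \<Rightarrow> int) \<Rightarrow> complex) \<Rightarrow> (nat \<Rightarrow> real) \<Rightarrow> complex" where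
  "fourier_series d c x = (\<Sum>\<^sub>\<infinity>k\<in>frequencies d. c k * character d k x)"

lemma abs_summable_tail:
  fixes c :: "'a \<Rightarrow> complex"
  assumes "(\<lambda>k. cmod (c k)) summable_on F" "0 < e"
  shows "\<exists>K. finite K \<and> K \<subseteq> F \<and> (\<Sum>\<^sub>\<infinity>k\<in>F - K. cmod (c k)) \<le> e"
proof -
  obtain K where K: "finite K" "K \<subseteq> F" "dist (\<Sum>k\<in>K. cmod (c k)) (\<Sum>\<^sub>\<infinity>k\<in>F. cmod (c k)) \<le> e"
    using infsum_finite_approximation[OF assms] by blast
  have "(\<Sum>\<^sub>\<infinity>k\<in>F - K. cmod (c k)) = (\<Sum>\<^sub>\<infinity>k\<in>F. cmod (c k)) - (\<Sum>k\<in>K. cmod (c k))"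
    using infsum_Diff[OF assms(1) summable_on_finite[OF K(1)] K(2)] K(1) by simp
  then show ?thesis using K by (auto simp: dist_real_def)
qed

lemma fourier_series_tail:
  assumes c: "(\<lambda>k. cmod (c k)) summable_on frequencies d" and K: "finite K" "K \<subseteq> frequencies d"
  shows "cmod (fourier_series d c x - (\<Sum>k\<in>K. c k * character d k x)) \<le> (\<Sum>\<^sub>\<infinity>k\<in>frequencies d - K. cmod (c k))"
proof -
  have n: "(\<lambda>k. norm (c k * character d k x)) = (\<lambda>k. cmod (c k))" by (simp add: norm_mult)
  have s: "(\<lambda>k. c k * character d k x) summable_on frequencies d"
    by (rule abs_summable_summable) (simp add: n c)
  have "fourier_series d c x - (\<Sum>k\<in>K. c k * character d k x) = (\<Sum>\<^sub>\<infinity>k\<in>frequencies d - K. c k * character d k x)"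
    using infsum_Diff[OF s summable_on_finite[OF K(1)] K(2)] K(1) by (simp add: fourier_series_def)
  also have "cmod \<dots> \<le> (\<Sum>\<^sub>\<infinity>k\<in>frequencies d - K. norm (c k * character d k x))"
    unfolding n
    by (rule norm_infsum_bound[of "\<lambda>k. c k * character d k x", unfolded n])
      (rule summable_on_subset_banach[OF c], auto)
  finally show ?thesis by (simp add: n)
qed

lemma norm_fourier_series_le:
  assumes "(\<lambda>k. cmod (c k)) summable_on frequencies d"
  shows "cmod (fourier_series d c x) \<le> (\<Sum>\<^sub>\<infinity>k\<in>frequencies d. cmod (c k))"
  using fourier_series_tail[OF assms, of "{}"] by simp

text \<open>Replaces the net of finite partial sums by one uniformly convergent sequence, as the
  limit theorems for continuity and measurability require.\<close>

lemma fourier_series_approx: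
  assumes c: "(\<lambda>k. cmod (c k)) summable_on frequencies d"
  obtains K where "\<And>n. finite (K n)" "\<And>n. K n \<subseteq> frequencies d"
    "\<And>n x. cmod (fourier_series d c x - (\<Sum>k\<in>K n. c k * character d k x)) \<le> inverse (real (Suc n))"
proof -
  have "\<exists>K. finite K \<and> K \<subseteq> frequencies d \<and> (\<Sum>\<^sub>\<infinity>k\<in>frequencies d - K. cmod (c k)) \<le> inverse (real (Suc n))" for n
    by (rule abs_summable_tail[OF c]) simp
  then obtain K where K: "\<And>n. finite (K n) \<and> K n \<subseteq> frequencies d \<and>
      (\<Sum>\<^sub>\<infinity>k\<in>frequencies d - K n. cmod (c k)) \<le> inverse (real (Suc n))"
    by metis
  show ?thesis
  proof (rule that[of K])
    fix n x
    show "cmod (fourier_series d c x - (\<Sum>k\<in>K n. c k * character d k x)) \<le> inverse (real (Suc n))"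
      by (rule order_trans[OF fourier_series_tail[OF c]]) (use K in auto)
  qed (use K in auto)
qed

lemma continuous_on_character: "continuous_on S (character d k)"
proof -
  have "continuous_on S (\<lambda>x. x i)" for i :: nat
    by (rule continuous_on_subset[OF continuous_on_product_coordinates]) simp
  then show ?thesis
    unfolding character_def[abs_def] by (intro continuous_intros)
qed

lemma character_identified:
  assumes "torus_identified d x y"
  shows "character d k x = character d k y"
  unfolding character_prod
proof (rule prod.cong[OF refl])
  fix i assume "i \<in> {..<d}"
  then consider "x i = y i" | "x i = 0" "y i = 2 * pi" | "x i = 2 * pi" "y i = 0"
    using assms by (auto simp: torus_identified_def doubleton_eq_iff)
  moreover have "cis (real_of_int (k i) * (2 * pi)) = 1"
    by (metis cis_multiple_2pi Ints_of_int mult.commute)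
  ultimately show "cis (real_of_int (k i) * x i) = cis (real_of_int (k i) * y i)"
    by cases auto
qed

lemma fourier_series_continuous:
  assumes c: "(\<lambda>k. cmod (c k)) summable_on frequencies d"
  shows "torus_continuous d (fourier_series d c)"
proof -
  obtain K where K: "\<And>n. finite (K n)"
    "\<And>n x. cmod (fourier_series d c x - (\<Sum>k\<in>K n. c k * character d k x)) \<le> inverse (real (Suc n))"
    using fourier_series_approx[OF c] by metis
  have "continuous_on (torus_points d) (fourier_series d c)"
  proof (rule uniform_limit_theorem)
    show "\<forall>\<^sub>F n in sequentially. continuous_on (torus_points d) (\<lambda>x. \<Sum>k\<in>K n. c k * character d k x)"
      by (intro always_eventually allI continuous_intros continuous_on_character)
    show "uniform_limit (torus_points d) (\<lambda>n x. \<Sum>k\<in>K n. c k * character d k x) (fourier_series d c) sequentially"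
    proof (rule uniform_limitI)
      fix e :: real assume "0 < e"
      then have "\<forall>\<^sub>F n in sequentially. inverse (real (Suc n)) < e"
        using LIMSEQ_inverse_real_of_nat by (rule order_tendstoD(2)[rotated])
      then show "\<forall>\<^sub>F n in sequentially. \<forall>x\<in>torus_points d. dist (\<Sum>k\<in>K n. c k * character d k x) (fourier_series d c x) < e"
        by eventually_elim (use K(2) in \<open>auto simp: dist_norm norm_minus_commute intro: le_less_trans\<close>)
    qed
  qed simp
  moreover have "fourier_series d c x = fourier_series d c y" if "torus_identified d x y" for x y
    using character_identified[OF that] by (simp add: fourier_series_def)
  ultimately show ?thesis by (simp add: torus_continuous_def)
qed

lemma fourier_series_measurable:
  assumes c: "(\<lambda>k. cmod (c k)) summable_on frequencies d"
  shows "fourier_series d c \<in> borel_measurable (torus d)"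
proof -
  obtain K where K: "\<And>n. finite (K n)"
    "\<And>n x. cmod (fourier_series d c x - (\<Sum>k\<in>K n. c k * character d k x)) \<le> inverse (real (Suc n))"
    using fourier_series_approx[OF c] by metis
  show ?thesis
  proof (rule borel_measurable_LIMSEQ_metric)
    show "(\<lambda>x. \<Sum>k\<in>K n. c k * character d k x) \<in> borel_measurable (torus d)" for n by measurable
    fix x
    show "(\<lambda>n. \<Sum>k\<in>K n. c k * character d k x) \<longlonglongrightarrow> fourier_series d c x"
      by (rule metric_tendsto_imp_tendsto[OF LIMSEQ_inverse_real_of_nat])
        (use K(2) in \<open>auto simp: dist_norm norm_minus_commute\<close>)
  qed
qed

lemma fourier_coeff_fourier_series:
  assumes c: "(\<lambda>k. cmod (c k)) summable_on frequencies d" and l: "l \<in> frequencies d"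
  shows "fourier_coeff d (fourier_series d c) l = c l"
proof -
  note m = fourier_series_measurable[OF c]
  have int: "integrable (torus d) (fourier_series d c)"
    by (rule integrable_bounded_torus[OF m norm_fourier_series_le[OF c]])
  have "cmod (fourier_coeff d (fourier_series d c) l - c l) \<le> e" if e: "0 < e" for e
  proof -
    obtain K where K: "finite K" "K \<subseteq> frequencies d" "(\<Sum>\<^sub>\<infinity>k\<in>frequencies d - K. cmod (c k)) \<le> e"
      using abs_summable_tail[OF c e] by blast
    \<comment> \<open>Including \<open>l\<close> makes the coefficient of the partial sum at
      \<open>l\<close> equal to \<open>c l\<close>; the rest contributes at most its uniform
      bound.\<close>
    define K' where "K' = insert l K"
    have K': "finite K'" "K' \<subseteq> frequencies d" using K l by (auto simp: K'_def)
    have "(\<Sum>\<^sub>\<infinity>k\<in>frequencies d - K'. cmod (c k)) \<le> (\<Sum>\<^sub>\<infinity>k\<in>frequencies d - K. cmod (c k))"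
      by (rule infsum_mono2) (auto simp: K'_def intro: summable_on_subset_banach[OF c])
    then have le: "(\<Sum>\<^sub>\<infinity>k\<in>frequencies d - K'. cmod (c k)) \<le> e" using K(3) by simp
    let ?p = "\<lambda>x. \<Sum>k\<in>K'. c k * character d k x"
    have "cmod (fourier_coeff d (\<lambda>x. fourier_series d c x - ?p x) l) \<le> e"
      by (rule fourier_coeff_bound) (use m fourier_series_tail[OF c K'] le in \<open>auto intro: order_trans\<close>)
    also have "fourier_coeff d (\<lambda>x. fourier_series d c x - ?p x) l = fourier_coeff d (fourier_series d c) l - c l"
      using K' l by (simp add: fourier_coeff_diff[OF int trig_poly_integrable] fourier_coeff_trig_poly) (simp add: K'_def)
    finally show ?thesis .
  qed
  then have "cmod (fourier_coeff d (fourier_series d c) l - c l) \<le> 0"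
    by (rule field_le_epsilon[of _ 0, simplified])
  then show ?thesis by simp
qed

lemma AE_eq_fourier_series:
  assumes f: "integrable (torus d) f" and c: "(\<lambda>k. cmod (fourier_coeff d f k)) summable_on frequencies d"
  shows "AE x in torus d. f x = fourier_series d (fourier_coeff d f) x"
  using f integrable_bounded_torus[OF fourier_series_measurable[OF c] norm_fourier_series_le[OF c]]
  by (rule fourier_coeff_unique) (simp add: fourier_coeff_fourier_series[OF c])

section \<open>Point values through the continuous representative\<close>

text \<open>Every box around \<open>x\<close> has positive measure and so contains a point where the
  functions agree; shrinking the boxes gives a sequence of such points tending to
  \<open>x\<close>.\<close>

lemma torus_continuous_AE_unique:
  assumes g: "continuous_on (torus_points d) g" and h: "continuous_on (torus_points d) h"
    and ae: "AE x in torus d. g x = (h x :: complex)" and x: "x \<in> torus_points d"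
  shows "g x = h x"
proof -
  define r where "r n = inverse (real (Suc n))" for n
  have r0: "0 < r n" for n by (simp add: r_def)
  \<comment> \<open>Clipped to the cube; each side keeps positive length even when \<open>x\<close>
    lies on the boundary.\<close>
  define B where "B n = (\<Pi>\<^sub>E i\<in>{..<d}. {max 0 (x i - r n)..min (2 * pi) (x i + r n)})" for n
  have xi: "0 \<le> x i" "x i \<le> 2 * pi" if "i < d" for i
    using x that by (auto simp: torus_points_def PiE_def Pi_def)
  have sets: "{max 0 (x i - r n)..min (2 * pi) (x i + r n)} \<in> sets circle" for i n
    unfolding sets_circle by (auto simp: sets_restrict_space intro!: image_eqI[of _ _ "{max 0 (x i - r n)..min (2 * pi) (x i + r n)}"])
  have B: "B n \<in> sets (torus d)" for n
    unfolding B_def torus_eq by (rule sets_PiM_I_finite) (use sets in auto)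
  have Bsub: "B n \<subseteq> torus_points d" for n
    using sets.sets_into_space[OF B] by simp
  have "\<exists>y\<in>B n. g y = h y" for n
  proof (rule ccontr)
    assume "\<not> (\<exists>y\<in>B n. g y = h y)"
    then have "AE y in torus d. y \<notin> B n" using ae by (auto elim: eventually_mono)
    then have "emeasure (torus d) {y \<in> space (torus d). y \<in> B n} = 0" by (rule emeasure_eq_0_AE)
    also have "{y \<in> space (torus d). y \<in> B n} = B n" using Bsub[of n] by auto
    finally have "emeasure (torus d) (B n) = 0" .
    moreover have "emeasure (torus d) (B n) = (\<Prod>i<d. emeasure circle {max 0 (x i - r n)..min (2 * pi) (x i + r n)})"
      unfolding B_def torus_eq by (rule circle_product.emeasure_PiM) (use sets in auto)
    moreover have "emeasure circle {max 0 (x i - r n)..min (2 * pi) (x i + r n)} \<noteq> 0" if "i < d" for i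
    proof -
      have "emeasure circle {a..b} \<noteq> 0" if "0 \<le> a" "a < b" "b \<le> 2 * pi" for a b
        using that by (subst emeasure_circle) auto
      moreover have "max 0 (x i - r n) < min (2 * pi) (x i + r n)"
        using xi[OF that] r0[of n] pi_gt_zero by (auto simp: max_def min_def)
      ultimately show ?thesis by simp
    qed
    ultimately show False by simp
  qed
  then have "\<forall>n. \<exists>y. y \<in> B n \<and> g y = h y" by blast
  from choice[OF this] obtain y where y: "\<And>n. y n \<in> B n" "\<And>n. g (y n) = h (y n)" by blast
  have "(\<lambda>n. y n i) \<longlonglongrightarrow> x i" for i
    proof (cases "i < d")
      case True
      have "dist (y n i) (x i) \<le> r n" for n
        using y(1)[of n] True by (auto simp: B_def PiE_def Pi_def dist_real_def)
      then have le: "dist (y n i) (x i) \<le> dist (r n) 0" for n using r0[of n] by (simp add: dist_real_def)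
      have r: "r \<longlonglongrightarrow> 0" unfolding r_def[abs_def] by (rule LIMSEQ_inverse_real_of_nat)
      show ?thesis
        by (rule metric_tendsto_imp_tendsto[OF r always_eventually]) (rule allI, rule le)
    next
      case False
      \<comment> \<open>Both points are extensional, so they agree outside the first
        \<open>d\<close> coordinates; convergence is coordinatewise over all of
        \<open>nat\<close>.\<close>
      then have "y n i = x i" for n
        using y(1)[of n] x by (auto simp: B_def torus_points_def PiE_def extensional_def)
      then show ?thesis by simp
    qed
  then have "limitin (product_topology (\<lambda>i. euclidean) UNIV) y x sequentially"
    by (simp add: limitin_componentwise)
  then have lim: "y \<longlonglongrightarrow> x" by (simp add: euclidean_product_topology)
  have yT: "\<forall>\<^sub>F n in sequentially. y n \<in> torus_points d"
    by (intro always_eventually allI subsetD[OF Bsub y(1)])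
  have "(\<lambda>n. g (y n)) \<longlonglongrightarrow> g x" "(\<lambda>n. h (y n)) \<longlonglongrightarrow> h x"
    by (rule continuous_on_tendsto_compose[OF g lim x yT], rule continuous_on_tendsto_compose[OF h lim x yT])
  then show ?thesis unfolding y(2) by (rule LIMSEQ_unique)
qed

text \<open>The Fourier series shows that the choice in \<open>cont_rep\<close> succeeds, and
  continuous representatives that agree almost everywhere agree at every point.\<close>

lemma cont_rep_eq:
  assumes f: "integrable (torus d) f" and c: "(\<lambda>k. cmod (fourier_coeff d f k)) summable_on frequencies d"
    and x: "x \<in> torus_points d"
  shows "cont_rep d f x = fourier_series d (fourier_coeff d f) x"
proof -
  let ?g = "fourier_series d (fourier_coeff d f)"
  have g: "torus_continuous d ?g \<and> (AE x in torus d. f x = ?g x)"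
    using fourier_series_continuous[OF c] AE_eq_fourier_series[OF f c] by simp
  then have "torus_continuous d (cont_rep d f) \<and> (AE x in torus d. f x = cont_rep d f x)"
    unfolding cont_rep_def
    by (rule someI[where P="\<lambda>g. torus_continuous d g \<and> (AE x in torus d. f x = g x)"])
  then have "AE x in torus d. cont_rep d f x = ?g x" and "continuous_on (torus_points d) (cont_rep d f)"
    using g by (auto simp: torus_continuous_def)
  then show ?thesis
    by (intro torus_continuous_AE_unique[OF _ _ _ x]) (use g in \<open>simp_all add: torus_continuous_def\<close>)
qed

section \<open>Approximation and sampling numbers\<close>

text \<open>Gram-Schmidt in the form of rank-one updates: from the current projection
  \<open>Y\<close>, the projection onto the direction \<open>Y z\<close> is subtracted for each new
  vector \<open>z\<close>. The trace of a projection is its rank, and it drops by at most 1 each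
  time.\<close>

lemma annihilating_projection:
  fixes \<phi> :: "nat \<Rightarrow> 'k \<Rightarrow> complex"
  assumes fin: "finite I"
  shows "\<exists>Y. selfadj I Y \<and> (\<forall>a b. ip I (Y a) (Y b) = ip I a (Y b)) \<and>
    (\<forall>i<m. \<forall>a. ip I a (Y (\<phi> i)) = 0) \<and> real (card I) - real m \<le> wtrace I (\<lambda>_. 1) Y"
proof (induction m)
  case 0
  have "wtrace I (\<lambda>_. 1) (\<lambda>a. a) = real (card I)" by (simp add: wtrace_def unit_vec_def)
  then show ?case by (intro exI[of _ "\<lambda>a. a"]) (simp add: selfadj_def)
next
  case (Suc m)
  then obtain Y where sY: "selfadj I Y" and idem: "\<And>a b. ip I (Y a) (Y b) = ip I a (Y b)"
    and null: "\<And>i a. i < m \<Longrightarrow> ip I a (Y (\<phi> i)) = 0" and tr: "real (card I) - real m \<le> wtrace I (\<lambda>_. 1) Y"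
    by blast
  define z where "z = \<phi> m"
  define \<gamma> where "\<gamma> = quad_form I Y z"
  have \<gamma>: "ip I z (Y z) = of_real \<gamma>" unfolding \<gamma>_def by (rule quad_form_complex[OF sY])
  \<comment> \<open>If \<open>\<gamma> = 0\<close> then \<open>Y z\<close> vanishes on
    \<open>I\<close>: the vector is already annihilated, and with \<open>1 / 0 = 0\<close> the
    update changes nothing.\<close>
  have dich: "ip I a (Y z) = 0" if "\<gamma> = 0" for a
  proof -
    have "(\<Sum>i\<in>I. (cmod (Y z i))\<^sup>2) = Re (ip I (Y z) (Y z))" by (simp add: ip_self)
    also have "\<dots> = 0" using \<gamma> that by (simp add: idem)
    finally show ?thesis using ip_norm_bound[of I a "Y z"] by simp
  qed
  define Y' where "Y' = rank_one_update I Y (- (1 / \<gamma>)) (Y z)"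
  have Yz: "ip I (Y z) b = ip I z (Y b)" for b by (simp add: selfadjD[OF sY])
  have right: "ip I a (Y' b) = ip I a (Y b) - of_real (1 / \<gamma>) * ip I (Y z) b * ip I a (Y z)" for a b
    by (simp add: Y'_def ip_rank_one_right)
  have left: "ip I (Y' a) b = ip I (Y a) b - of_real (1 / \<gamma>) * ip I a (Y z) * ip I (Y z) b" for a b
    by (simp add: Y'_def ip_rank_one_left)
  have "selfadj I Y'" unfolding Y'_def by (rule selfadj_rank_one[OF sY])
  moreover have "ip I (Y' a) (Y' b) = ip I a (Y' b)" for a b
  proof -
    have 1: "ip I (Y a) (Y' b) = ip I a (Y' b)" by (simp add: right idem)
    have "ip I (Y z) (Y' b) = ip I (Y z) b * (1 - of_real (1 / \<gamma>) * of_real \<gamma>)"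
      unfolding right idem Yz[of b] \<gamma> by (simp add: algebra_simps)
    then have "\<gamma> \<noteq> 0 \<Longrightarrow> ip I (Y z) (Y' b) = 0" by (simp add: of_real_divide)
    moreover have "\<gamma> = 0 \<Longrightarrow> ip I a (Y z) = 0" by (rule dich)
    ultimately have "ip I a (Y z) * ip I (Y z) (Y' b) = 0" by auto
    then show ?thesis unfolding left 1 by (simp add: mult.assoc)
  qed
  moreover have "ip I a (Y' (\<phi> i)) = 0" if "i < Suc m" for a i
  proof (cases "i = m")
    case True
    have "ip I a (Y' z) = ip I a (Y z) * (1 - of_real (1 / \<gamma>) * of_real \<gamma>)"
      unfolding right Yz \<gamma> by (simp add: algebra_simps)
    moreover have "\<gamma> = 0 \<Longrightarrow> ip I a (Y z) = 0" by (rule dich)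
    ultimately show ?thesis using True by (cases "\<gamma> = 0") (simp_all add: z_def of_real_divide)
  next
    case False
    then show ?thesis using that null by (simp add: right Yz)
  qed
  moreover have "real (card I) - real (Suc m) \<le> wtrace I (\<lambda>_. 1) Y'"
  proof -
    have "quad_form I (\<lambda>a. Y (diag_op (\<lambda>_. 1) (Y a))) z = \<gamma>"
    proof -
      have "ip I z (Y (Y z)) = of_real \<gamma>" using Yz[of "Y z"] idem[of z z] \<gamma> by metis
      then show ?thesis by (simp add: quad_form_def diag_op_def)
    qed
    then have "wtrace I (\<lambda>_. 1) Y' = wtrace I (\<lambda>_. 1) Y - 1 / \<gamma> * \<gamma>"
      unfolding Y'_def trace_rank_one[OF fin sY] by simp
    \<comment> \<open>The product is 1, or 0 when \<open>\<gamma> = 0\<close>.\<close>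
    moreover have "1 / \<gamma> * \<gamma> \<le> 1" by simp
    ultimately show ?thesis using tr by simp
  qed
  ultimately show ?case by blast
qed

text \<open>A diagonal entry of a projection is the squared length of its column, hence nonnegative
  and at least its own square.\<close>

lemma projection_diagonal:
  assumes fin: "finite I" and sY: "selfadj I Y" and idem: "\<And>a b. ip I (Y a) (Y b) = ip I a (Y b)"
    and k: "k \<in> I"
  shows "0 \<le> Re (Y (unit_vec k) k)" "Re (Y (unit_vec k) k) \<le> 1"
proof -
  let ?y = "Y (unit_vec k)"
  have "?y k = ip I ?y ?y" by (simp add: idem ip_unit[OF fin k])
  then have y: "?y k = of_real (\<Sum>i\<in>I. (cmod (?y i))\<^sup>2)" by (simp add: ip_self)
  then show "0 \<le> Re (?y k)" by (simp add: sum_nonneg)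
  have "(Re (?y k))\<^sup>2 \<le> (cmod (?y k))\<^sup>2" by (simp add: cmod_power2)
  also have "\<dots> \<le> (\<Sum>i\<in>I. (cmod (?y i))\<^sup>2)"
    by (rule member_le_sum) (use fin k in auto)
  also have "\<dots> = Re (?y k)" by (simp add: y)
  finally show "Re (?y k) \<le> 1"
    by (metis power2_eq_square mult_le_cancel_right1 not_le order_less_trans zero_less_one mult.right_neutral mult_le_cancel_left_pos)
qed

text \<open>By orthonormality of the characters, the mean of the right side over the torus is
  exactly the left side, so the form cannot lie strictly below it everywhere. This supplies the
  averaging hypothesis of the barrier argument.\<close>

lemma character_average:
  assumes fin: "finite I" and I: "I \<subseteq> frequencies d" and H: "selfadj I H"
  shows "\<exists>x\<in>torus_points d. wtrace I (\<lambda>i. (b i)\<^sup>2) H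
    \<le> quad_form I H (\<lambda>i. of_real (b i) * cnj (character d i x))"
proof (rule ccontr)
  define z where "z x = (\<lambda>i. of_real (b i) * cnj (character d i x))" for x
  assume "\<not> ?thesis"
  then have less: "quad_form I H (z x) < wtrace I (\<lambda>i. (b i)\<^sup>2) H" if "x \<in> torus_points d" for x
    using that by (auto simp: z_def not_le)
  define h where "h i j = cnj (H (unit_vec i) j)" for i j
  have z: "ip I (z x) (H (z x)) = (\<Sum>i\<in>I. \<Sum>j\<in>I. of_real (b i * b j) * h i j * (character d i x * cnj (character d j x)))" for x
  proof -
    have "H (z x) i = (\<Sum>j\<in>I. h i j * z x j)" if "i \<in> I" for i
      using selfadj_entry[OF fin H that, of "z x"] by (simp add: ip_def h_def)
    then show ?thesis
      unfolding ip_def z_def by (intro sum.cong refl) (simp add: sum_distrib_left algebra_simps)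
  qed
  have int: "integrable (torus d) (\<lambda>x. of_real (b i * b j) * h i j * (character d i x * cnj (character d j x)))" for i j
    by (intro integrable_mult_right integrable_times_cnj_character integrable_character)
  have int': "integrable (torus d) (\<lambda>x. ip I (z x) (H (z x)))"
    unfolding z by (intro Bochner_Integration.integrable_sum int)
  have "(LINT x|torus d. ip I (z x) (H (z x))) = (\<Sum>i\<in>I. \<Sum>j\<in>I. of_real (b i * b j) * h i j * (if i = j then 1 else 0))"
    unfolding z using int I
    by (subst Bochner_Integration.integral_sum, simp, intro sum.cong refl,
        subst Bochner_Integration.integral_sum, simp, intro sum.cong refl)
      (subst integral_mult_right_zero, subst character_orthonormal, auto)
  also have "\<dots> = (\<Sum>i\<in>I. of_real ((b i)\<^sup>2) * h i i)"
    using fin by (intro sum.cong refl) (simp add: power2_eq_square if_distrib cong: if_cong)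
  finally have "(LINT x|torus d. quad_form I H (z x)) = wtrace I (\<lambda>i. (b i)\<^sup>2) H"
    using integral_Re[OF int'] by (simp add: quad_form_def wtrace_def h_def)
  moreover have "(LINT x|torus d. quad_form I H (z x)) < wtrace I (\<lambda>i. (b i)\<^sup>2) H"
  proof (rule torus.expectation_less)
    show "integrable (torus d) (\<lambda>x. quad_form I H (z x))"
      unfolding quad_form_def using int' by (rule integrable_Re)
    show "AE x in torus d. quad_form I H (z x) < wtrace I (\<lambda>i. (b i)\<^sup>2) H"
      by (rule AE_I2) (simp add: less)
  qed
  ultimately show False by simp
qed

section \<open>Choice of the frequencies with the smallest weights\<close>

lemma infinite_frequencies:
  assumes "1 \<le> d"
  shows "infinite (frequencies d)"
proof
  assume "finite (frequencies d)"
  moreover have "range (\<lambda>n::nat. \<lambda>i\<in>{..<d}. int n) \<subseteq> frequencies d"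
    by (intro image_subsetI) (simp add: frequencies_def)
  ultimately have "finite (range (\<lambda>n::nat. \<lambda>i\<in>{..<d}. int n))"
    by (rule finite_subset[rotated])
  moreover have "inj (\<lambda>n::nat. \<lambda>i\<in>{..<d}. int n)"
  proof (rule injI)
    fix n n' :: nat
    assume "(\<lambda>i\<in>{..<d}. int n) = (\<lambda>i\<in>{..<d}. int n')"
    from fun_cong[OF this, of 0] show "n = n'" using assms by simp
  qed
  ultimately show False using finite_imageD infinite_UNIV_nat by blast
qed

lemma summable_superlevel_finite:
  fixes u :: "'a \<Rightarrow> real"
  assumes u: "u summable_on F" "\<And>k. k \<in> F \<Longrightarrow> 0 \<le> u k" and e: "0 < e"
  shows "finite {k \<in> F. e \<le> u k}"
proof (rule ccontr)
  define S where "S = (\<Sum>\<^sub>\<infinity>k\<in>F. u k)"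
  assume "infinite {k \<in> F. e \<le> u k}"
  then obtain K where K: "finite K" "card K = nat \<lceil>S / e\<rceil> + 1" "K \<subseteq> {k \<in> F. e \<le> u k}"
    using infinite_arbitrarily_large by blast
  have "real (card K) * e \<le> (\<Sum>k\<in>K. u k)"
    using K(3) by (intro sum_bounded_below) auto
  also have "\<dots> \<le> S"
    unfolding S_def by (rule finite_sum_le_infsum) (use u K in auto)
  finally have "real (card K) \<le> S / e" using e by (simp add: field_simps)
  then show False using K(2) by (simp add: of_nat_add) linarith
qed

text \<open>A largest remaining element is added each time. It exists although \<open>F\<close> is
  infinite, because by summability only finitely many elements reach the level of any given
  one.\<close>

lemma exists_top_set:
  fixes u :: "'a \<Rightarrow> real"
  assumes u: "u summable_on F" "\<And>k. k \<in> F \<Longrightarrow> 0 < u k" and F: "infinite F"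
  shows "\<exists>V. V \<subseteq> F \<and> finite V \<and> card V = m \<and> (\<forall>k\<in>V. \<forall>j\<in>F - V. u j \<le> u k)"
proof (induction m)
  case 0
  show ?case by (intro exI[of _ "{}"]) simp
next
  case (Suc m)
  then obtain V where V: "V \<subseteq> F" "finite V" "card V = m" "\<forall>k\<in>V. \<forall>j\<in>F - V. u j \<le> u k" by blast
  obtain k0 where k0: "k0 \<in> F - V" using F V(2) by (metis Diff_infinite_finite ex_in_conv finite.emptyI)
  define G where "G = {k \<in> F. u k0 \<le> u k} - V"
  have "finite G"
    unfolding G_def using summable_superlevel_finite[OF u(1), of "u k0"] u(2) k0 by (auto simp: less_imp_le)
  moreover have "k0 \<in> G" using k0 by (auto simp: G_def)
  ultimately obtain k1 where k1: "k1 \<in> G" "\<And>k. k \<in> G \<Longrightarrow> u k \<le> u k1"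
    using finite_has_maximal[of "u ` G"] by (metis (mono_tags, lifting) finite_imageI image_iff image_is_empty empty_iff linear)
  have top: "u j \<le> u k1" if "j \<in> F - V" for j
  proof (cases "u k0 \<le> u j")
    case True
    then show ?thesis using that by (intro k1(2)) (auto simp: G_def)
  next
    case False
    then show ?thesis using k1(1) by (auto simp: G_def)
  qed
  have "k1 \<in> F" "k1 \<notin> V" using k1(1) by (auto simp: G_def)
  then show ?case
    using V top by (intro exI[of _ "insert k1 V"]) auto
qed

section \<open>The weighted space and the Fourier projection\<close>

locale weighted_torus =
  fixes d :: nat and w :: "(nat \<Rightarrow> int) \<Rightarrow> real"
  assumes w_pos: "\<And>k. k \<in> frequencies d \<Longrightarrow> 0 < w k"
    and w_sum: "(\<lambda>k. 1 / (w k)\<^sup>2) summable_on frequencies d"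
begin

text \<open>The quantity \<open>T\<close> of the overview, for an arbitrary set
  \<open>V\<close>.\<close>

definition tail :: "(nat \<Rightarrow> int) set \<Rightarrow> real" where
  "tail V = (\<Sum>\<^sub>\<infinity>k\<in>frequencies d - V. 1 / (w k)\<^sup>2)"

lemma tail_nonneg: "0 \<le> tail V"
  unfolding tail_def by (rule infsum_nonneg) simp

lemma tail_summable: "(\<lambda>k. 1 / (w k)\<^sup>2) summable_on (frequencies d - V)"
  by (rule summable_on_subset_banach[OF w_sum]) simp

lemma sum_le_tail: "finite K \<Longrightarrow> K \<subseteq> frequencies d - V \<Longrightarrow> (\<Sum>k\<in>K. 1 / (w k)\<^sup>2) \<le> tail V"
  unfolding tail_def by (rule finite_sum_le_infsum) (use tail_summable in auto)

lemma Hw_norm_nonneg: "0 \<le> Hw_norm d w f"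
  unfolding Hw_norm_def by (intro real_sqrt_ge_zero infsum_nonneg) simp

lemma Hw_integrable: "f \<in> Hw d w \<Longrightarrow> integrable (torus d) f"
  by (simp add: Hw_def)

lemma coeff_sum_le_Hw_norm:
  assumes "f \<in> Hw d w" "finite K" "K \<subseteq> frequencies d"
  shows "(\<Sum>k\<in>K. (w k)\<^sup>2 * (cmod (fourier_coeff d f k))\<^sup>2) \<le> (Hw_norm d w f)\<^sup>2"
proof -
  have "(\<Sum>k\<in>K. (w k)\<^sup>2 * (cmod (fourier_coeff d f k))\<^sup>2)
      \<le> (\<Sum>\<^sub>\<infinity>k\<in>frequencies d. (w k)\<^sup>2 * (cmod (fourier_coeff d f k))\<^sup>2)"
    by (rule finite_sum_le_infsum) (use assms in \<open>auto simp: Hw_def\<close>)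
  also have "\<dots> = (Hw_norm d w f)\<^sup>2"
    by (simp add: Hw_norm_def infsum_nonneg)
  finally show ?thesis .
qed

text \<open>Follows from \<open>2 a b \<le> a^2 + b^2\<close> with \<open>a = 1 / w k\<close>. Hence
  every element of the space is almost everywhere equal to its continuous Fourier series.\<close>

lemma Hw_abs_summable:
  assumes f: "f \<in> Hw d w"
  shows "(\<lambda>k. cmod (fourier_coeff d f k)) summable_on frequencies d"
proof (rule summable_on_comparison_test)
  show "(\<lambda>k. 1 / (w k)\<^sup>2 + (w k)\<^sup>2 * (cmod (fourier_coeff d f k))\<^sup>2) summable_on frequencies d"
    using f by (intro summable_on_add w_sum) (simp add: Hw_def)
  fix k assume k: "k \<in> frequencies d"
  have "2 * (1 / w k) * (w k * cmod (fourier_coeff d f k)) \<le> (1 / w k)\<^sup>2 + (w k * cmod (fourier_coeff d f k))\<^sup>2"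
    by (rule sum_squares_bound)
  then show "cmod (fourier_coeff d f k) \<le> 1 / (w k)\<^sup>2 + (w k)\<^sup>2 * (cmod (fourier_coeff d f k))\<^sup>2"
    using w_pos[OF k] by (simp add: power_divide power_mult_distrib) (smt (verit) norm_ge_zero)
qed simp

lemma sum_coeff_le:
  assumes f: "f \<in> Hw d w" and K: "finite K" "K \<subseteq> frequencies d"
  shows "(\<Sum>k\<in>K. cmod (fourier_coeff d f k)) \<le> sqrt (\<Sum>k\<in>K. 1 / (w k)\<^sup>2) * Hw_norm d w f"
proof -
  have "w k \<noteq> 0" if "k \<in> K" for k using K(2) w_pos[of k] that by force
  then have "(\<Sum>k\<in>K. cmod (fourier_coeff d f k)) = (\<Sum>k\<in>K. \<bar>1 / w k\<bar> * \<bar>w k * cmod (fourier_coeff d f k)\<bar>)"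
    by (intro sum.cong) (auto simp: abs_mult)
  also have "\<dots> \<le> L2_set (\<lambda>k. 1 / w k) K * L2_set (\<lambda>k. w k * cmod (fourier_coeff d f k)) K"
    by (rule L2_set_mult_ineq)
  also have "L2_set (\<lambda>k. 1 / w k) K = sqrt (\<Sum>k\<in>K. 1 / (w k)\<^sup>2)"
    by (simp add: L2_set_def power_divide)
  also have "L2_set (\<lambda>k. w k * cmod (fourier_coeff d f k)) K \<le> Hw_norm d w f"
    unfolding L2_set_def power_mult_distrib
    by (rule real_le_lsqrt) (use coeff_sum_le_Hw_norm[OF f K] Hw_norm_nonneg in \<open>auto simp: sum_nonneg\<close>)
  finally show ?thesis by (simp add: mult_left_mono sum_nonneg)
qed

text \<open>Cauchy-Schwarz on finite sets, passed to the limit. Together with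
  \<open>fourier_series_tail\<close> it bounds the uniform error of a Fourier projection.\<close>

lemma coeff_tail_le:
  assumes f: "f \<in> Hw d w"
  shows "(\<Sum>\<^sub>\<infinity>k\<in>frequencies d - V. cmod (fourier_coeff d f k)) \<le> sqrt (tail V) * Hw_norm d w f"
proof (rule infsum_le_finite_sums)
  show "(\<lambda>k. cmod (fourier_coeff d f k)) summable_on frequencies d - V"
    by (rule summable_on_subset_banach[OF Hw_abs_summable[OF f]]) simp
  fix K assume K: "finite K" "K \<subseteq> frequencies d - V"
  then have "(\<Sum>k\<in>K. cmod (fourier_coeff d f k)) \<le> sqrt (\<Sum>k\<in>K. 1 / (w k)\<^sup>2) * Hw_norm d w f"
    by (intro sum_coeff_le[OF f]) auto
  also have "\<dots> \<le> sqrt (tail V) * Hw_norm d w f"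
    using sum_le_tail[OF K] Hw_norm_nonneg by (intro mult_right_mono) auto
  finally show "(\<Sum>k\<in>K. cmod (fourier_coeff d f k)) \<le> sqrt (tail V) * Hw_norm d w f" .
qed

lemma projection_in_Hw_operators:
  assumes V: "finite V" "V \<subseteq> frequencies d"
  shows "(\<lambda>f x. \<Sum>k\<in>V. fourier_coeff d f k * character d k x) \<in> Hw_operators d w"
    (is "?A \<in> _")
proof -
  have "?A (\<lambda>y. a * f y + b * g y) x = a * ?A f x + b * ?A g x" if "f \<in> Hw d w" "g \<in> Hw d w" for f g a b x
    using that by (simp add: fourier_coeff_lincomb Hw_integrable sum_distrib_left sum.distrib[symmetric] algebra_simps)
  moreover have "Linf_norm d (?A f) \<le> ennreal (sqrt (\<Sum>k\<in>V. 1 / (w k)\<^sup>2) * Hw_norm d w f)" if "f \<in> Hw d w" for f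
    by (rule Linf_norm_le[OF trig_poly_measurable], rule AE_I2,
        rule order_trans[OF norm_trig_poly_le sum_coeff_le[OF that V]])
  ultimately show ?thesis
    unfolding Hw_operators_def using trig_poly_Linf by blast
qed

lemma approx_number_le_tail:
  assumes V: "finite V" "V \<subseteq> frequencies d" "card V < n"
  shows "approx_number d w n \<le> ennreal (sqrt (tail V))"
proof -
  let ?A = "\<lambda>f x. \<Sum>k\<in>V. fourier_coeff d f k * character d k x"
  have "rank_less d w ?A n"
  proof -
    obtain h where h: "bij_betw h {..<card V} V"
      using ex_bij_betw_nat_finite[OF V(1)] by (auto simp: atLeast0LessThan)
    have "?A f x = (\<Sum>i<card V. fourier_coeff d f (h i) * character d (h i) x)" for f x
      by (rule sum.reindex_bij_betw[OF h, symmetric])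
    moreover have "character d k \<in> Linf d" for k
      by (rule Linf_bounded[of _ _ 1]) auto
    ultimately show ?thesis
      unfolding rank_less_def using V(3)
      by (intro exI[of _ "card V"] conjI exI[of _ "\<lambda>i. character d (h i)"] allI impI ballI)
        (auto intro!: exI[of _ "\<lambda>i. fourier_coeff d _ (h i)"])
  qed
  with projection_in_Hw_operators[OF V(1,2)]
  have "approx_number d w n \<le> (SUP f\<in>Hw_ball d w. Linf_norm d (\<lambda>x. f x - ?A f x))"
    unfolding approx_number_def by (intro INF_lower) simp
  also have "\<dots> \<le> ennreal (sqrt (tail V))"
  proof (rule SUP_least)
    fix f assume "f \<in> Hw_ball d w"
    then have f: "f \<in> Hw d w" "Hw_norm d w f \<le> 1" by (auto simp: Hw_ball_def)
    show "Linf_norm d (\<lambda>x. f x - ?A f x) \<le> ennreal (sqrt (tail V))"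
    proof (rule Linf_norm_le)
      show "(\<lambda>x. f x - ?A f x) \<in> borel_measurable (torus d)"
        using Hw_integrable[OF f(1)] by (intro borel_measurable_diff trig_poly_measurable) auto
      have "cmod (fourier_series d (fourier_coeff d f) x - ?A f x) \<le> sqrt (tail V)" for x
      proof -
        have "cmod (fourier_series d (fourier_coeff d f) x - ?A f x) \<le> sqrt (tail V) * Hw_norm d w f"
          using fourier_series_tail[OF Hw_abs_summable[OF f(1)] V(1,2)] coeff_tail_le[OF f(1)] by (rule order_trans)
        also have "\<dots> \<le> sqrt (tail V)"
          using f(2) tail_nonneg by (simp add: mult_left_le)
        finally show ?thesis .
      qed
      then show "AE x in torus d. cmod (f x - ?A f x) \<le> sqrt (tail V)"
        using AE_eq_fourier_series[OF Hw_integrable[OF f(1)] Hw_abs_summable[OF f(1)]]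
        by (auto elim!: eventually_mono)
    qed
  qed
  finally show ?thesis .
qed

end

section \<open>Lower bound for the approximation numbers\<close>

lemma ip_sum_right: "ip I a (\<lambda>j. \<Sum>i\<in>S. c i * v i j) = (\<Sum>i\<in>S. c i * ip I a (v i))"
  unfolding ip_def sum_distrib_left by (subst sum.swap) (simp add: algebra_simps)

lemma sum_times_le_sqrt:
  fixes a b :: "'a \<Rightarrow> real"
  assumes "(\<Sum>i\<in>S. (a i)\<^sup>2) * (\<Sum>i\<in>S. (b i)\<^sup>2) \<le> c"
  shows "(\<Sum>i\<in>S. a i * b i) \<le> sqrt c"
proof -
  have "(\<Sum>i\<in>S. a i * b i)\<^sup>2 \<le> c"
    using Cauchy_Schwarz_ineq_sum[of a b S] assms by (rule order_trans)
  then show ?thesis by (rule real_le_rsqrt)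
qed

text \<open>The numbers \<open>y\<close> spread a mass of at least \<open>card K\<close> with at
  most 1 on each point. The weighted sum of \<open>u\<close> is smallest when the mass fills the low
  values, which are those on \<open>K\<close>. The largest value \<open>\<theta>\<close> of
  \<open>u\<close> on \<open>K\<close> separates the two sets.\<close>

lemma top_sum_le:
  fixes u y :: "'a \<Rightarrow> real"
  assumes fin: "finite V" "finite K" and disj: "V \<inter> K = {}"
    and y: "\<And>k. k \<in> V \<union> K \<Longrightarrow> 0 \<le> y k \<and> y k \<le> 1" and card: "card K \<le> (\<Sum>k\<in>V \<union> K. y k)"
    and u: "\<And>k. 0 \<le> u k" and top: "\<And>k j. k \<in> V \<Longrightarrow> j \<in> K \<Longrightarrow> u j \<le> u k"
  shows "(\<Sum>k\<in>K. u k) \<le> (\<Sum>k\<in>V \<union> K. u k * y k)"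
proof (cases "K = {}")
  case True
  then show ?thesis using u y by (auto intro!: sum_nonneg)
next
  case False
  define \<theta> where "\<theta> = Max (u ` K)"
  have K\<theta>: "u k \<le> \<theta>" if "k \<in> K" for k using that fin by (simp add: \<theta>_def)
  have V\<theta>: "\<theta> \<le> u k" if "k \<in> V" for k
    unfolding \<theta>_def using fin False top[OF that] by (subst Max_le_iff) auto
  have \<theta>0: "0 \<le> \<theta>" using False K\<theta> u by (meson ex_in_conv order_trans)
  have split: "(\<Sum>k\<in>V \<union> K. g k) = (\<Sum>k\<in>V. g k) + (\<Sum>k\<in>K. g k)" for g :: "'a \<Rightarrow> real"
    by (rule sum.union_disjoint[OF fin disj])
  have "(\<Sum>k\<in>K. u k) - (\<Sum>k\<in>K. u k * y k) = (\<Sum>k\<in>K. u k * (1 - y k))"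
    by (simp add: sum_subtractf right_diff_distrib)
  also have "\<dots> \<le> (\<Sum>k\<in>K. \<theta> * (1 - y k))"
    using K\<theta> y by (intro sum_mono mult_right_mono) auto
  also have "\<dots> = \<theta> * (card K - (\<Sum>k\<in>K. y k))"
    by (simp add: sum_distrib_left[symmetric] sum_subtractf)
  also have "\<dots> \<le> \<theta> * (\<Sum>k\<in>V. y k)"
    using card \<theta>0 by (intro mult_left_mono) (simp_all add: split)
  also have "\<dots> \<le> (\<Sum>k\<in>V. u k * y k)"
    unfolding sum_distrib_left using V\<theta> y by (intro sum_mono mult_right_mono) auto
  finally show ?thesis by (simp add: split)
qed

lemma fourier_coeff_sum:
  assumes "\<And>i. i \<in> S \<Longrightarrow> integrable (torus d) (\<phi> i)"
  shows "fourier_coeff d (\<lambda>x. \<Sum>i\<in>S. c i * \<phi> i x) k = (\<Sum>i\<in>S. c i * fourier_coeff d (\<phi> i) k)"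
proof -
  have "fourier_coeff d (\<lambda>x. \<Sum>i\<in>S. c i * \<phi> i x) k
      = (LINT x|torus d. (\<Sum>i\<in>S. c i * (\<phi> i x * cnj (character d k x))))"
    by (simp add: fourier_coeff_eq sum_distrib_right mult.assoc)
  also have "\<dots> = (\<Sum>i\<in>S. c i * fourier_coeff d (\<phi> i) k)"
    using integrable_times_cnj_character[OF assms]
    by (subst Bochner_Integration.integral_sum) (auto simp: fourier_coeff_eq)
  finally show ?thesis .
qed

lemma pairing_trig_poly:
  assumes f: "integrable (torus d) f"
  shows "integrable (torus d) (\<lambda>x. f x * cnj (\<Sum>j\<in>K. u j * character d j x))" (is ?int)
    and "(LINT x|torus d. f x * cnj (\<Sum>j\<in>K. u j * character d j x)) = ip K u (fourier_coeff d f)" (is ?eq)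
proof -
  have eq: "f x * cnj (\<Sum>j\<in>K. u j * character d j x) = (\<Sum>j\<in>K. cnj (u j) * (f x * cnj (character d j x)))" for x
    by (simp add: sum_distrib_left algebra_simps)
  note int = integrable_times_cnj_character[OF f]
  show ?int unfolding eq by (intro Bochner_Integration.integrable_sum integrable_mult_right int)
  show ?eq unfolding eq using int
    by (subst Bochner_Integration.integral_sum) (auto simp: ip_def fourier_coeff_eq)
qed

lemma rational_approx_complex:
  fixes a :: complex
  assumes "0 < e"
  shows "\<exists>p q. cmod (Complex (of_rat p) (of_rat q) - a) < e"
proof -
  have "\<exists>p. \<bar>of_rat p - x\<bar> < e / 2" for x :: real
  proof -
    obtain p where "x < of_rat p" "of_rat p < x + e / 2"
      using of_rat_dense[of x "x + e / 2"] assms by auto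
    then show ?thesis by (intro exI[of _ p]) auto
  qed
  then obtain p q where pq: "\<bar>of_rat p - Re a\<bar> < e / 2" "\<bar>of_rat q - Im a\<bar> < e / 2" by metis
  have "cmod (Complex (of_rat p) (of_rat q) - a) \<le> \<bar>of_rat p - Re a\<bar> + \<bar>of_rat q - Im a\<bar>"
    using cmod_le[of "Complex (of_rat p) (of_rat q) - a"] by simp
  with pq show ?thesis by (intro exI[of _ p] exI[of _ q]) linarith
qed

text \<open>Exchanges the quantifier over \<open>a\<close> with the exceptional null set:
  coefficients with rational real and imaginary parts form a countable family on \<open>K\<close>,
  and both sides are continuous in the coefficients.\<close>

lemma AE_uniform_linear_bound:
  fixes h :: "'k \<Rightarrow> 'x \<Rightarrow> complex" and v :: "'k \<Rightarrow> real"
  assumes K: "finite K"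
    and ae: "\<And>a. AE x in M. cmod (\<Sum>k\<in>K. a k * h k x) \<le> e * sqrt (\<Sum>k\<in>K. v k * (cmod (a k))\<^sup>2)"
  shows "AE x in M. \<forall>a. cmod (\<Sum>k\<in>K. a k * h k x) \<le> e * sqrt (\<Sum>k\<in>K. v k * (cmod (a k))\<^sup>2)"
proof -
  define C where "C = range (\<lambda>(p, q). Complex (of_rat p) (of_rat q))"
  have "countable (K \<rightarrow>\<^sub>E C)"
    by (rule countable_PiE[OF K]) (simp add: C_def)
  then have "AE x in M. \<forall>a\<in>K \<rightarrow>\<^sub>E C. cmod (\<Sum>k\<in>K. a k * h k x) \<le> e * sqrt (\<Sum>k\<in>K. v k * (cmod (a k))\<^sup>2)"
    using ae by (simp add: AE_ball_countable)
  then show ?thesis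
  proof (rule eventually_mono, intro allI)
    fix x and a :: "'k \<Rightarrow> complex"
    assume le: "\<forall>a\<in>K \<rightarrow>\<^sub>E C. cmod (\<Sum>k\<in>K. a k * h k x) \<le> e * sqrt (\<Sum>k\<in>K. v k * (cmod (a k))\<^sup>2)"
    have "\<forall>n k. \<exists>c. c \<in> C \<and> cmod (c - a k) < inverse (real (Suc n))"
    proof (intro allI)
      fix n k
      obtain p q where "cmod (Complex (of_rat p) (of_rat q) - a k) < inverse (real (Suc n))"
        using rational_approx_complex[of "inverse (real (Suc n))" "a k"] by auto
      then show "\<exists>c. c \<in> C \<and> cmod (c - a k) < inverse (real (Suc n))"
        by (intro exI[of _ "Complex (of_rat p) (of_rat q)"]) (auto simp: C_def)
    qed
    then obtain b where b: "\<And>n k. b n k \<in> C" "\<And>n k. cmod (b n k - a k) < inverse (real (Suc n))"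
      by metis
    have lim: "(\<lambda>n. b n k) \<longlonglongrightarrow> a k" for k
      by (rule metric_tendsto_imp_tendsto[OF LIMSEQ_inverse_real_of_nat always_eventually])
        (use b(2) in \<open>auto simp: dist_norm intro: less_imp_le\<close>)
    have "cmod (\<Sum>k\<in>K. b n k * h k x) \<le> e * sqrt (\<Sum>k\<in>K. v k * (cmod (b n k))\<^sup>2)" for n
    proof -
      have "restrict (b n) K \<in> K \<rightarrow>\<^sub>E C" using b(1) by auto
      with le have "cmod (\<Sum>k\<in>K. restrict (b n) K k * h k x) \<le> e * sqrt (\<Sum>k\<in>K. v k * (cmod (restrict (b n) K k))\<^sup>2)"
        by blast
      then show ?thesis by simp
    qed
    then show "cmod (\<Sum>k\<in>K. a k * h k x) \<le> e * sqrt (\<Sum>k\<in>K. v k * (cmod (a k))\<^sup>2)"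
      by (intro LIMSEQ_le[of "\<lambda>n. cmod (\<Sum>k\<in>K. b n k * h k x)" _ "\<lambda>n. e * sqrt (\<Sum>k\<in>K. v k * (cmod (b n k))\<^sup>2)"]
          tendsto_intros lim) auto
  qed
qed

context weighted_torus
begin

lemma trig_poly_Hw:
  assumes K: "finite K" "K \<subseteq> frequencies d"
  shows "(\<lambda>x. \<Sum>k\<in>K. a k * character d k x) \<in> Hw d w" (is "?p \<in> _")
    and "Hw_norm d w (\<lambda>x. \<Sum>k\<in>K. a k * character d k x) = sqrt (\<Sum>k\<in>K. (w k)\<^sup>2 * (cmod (a k))\<^sup>2)"
proof -
  let ?g = "\<lambda>k. (w k)\<^sup>2 * (cmod (fourier_coeff d ?p k))\<^sup>2"
  have g: "?g k = (if k \<in> K then (w k)\<^sup>2 * (cmod (a k))\<^sup>2 else 0)" if "k \<in> frequencies d" for k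
    using fourier_coeff_trig_poly[OF K that] by simp
  have "finite {k \<in> frequencies d. ?g k \<noteq> 0}"
    by (rule finite_subset[OF _ K(1)]) (use fourier_coeff_trig_poly[OF K, where c=a] in \<open>auto split: if_splits\<close>)
  then have "?g summable_on frequencies d" by (rule finite_nonzero_values_imp_summable_on)
  then show "?p \<in> Hw d w" by (simp add: Hw_def trig_poly_integrable)
  have "infsum ?g (frequencies d) = infsum (\<lambda>k. (w k)\<^sup>2 * (cmod (a k))\<^sup>2) K"
    by (rule infsum_cong_neutral) (use g K in auto)
  then show "Hw_norm d w ?p = sqrt (\<Sum>k\<in>K. (w k)\<^sup>2 * (cmod (a k))\<^sup>2)"
    using K(1) by (simp add: Hw_norm_def)
qed

lemma character_Hw: "k \<in> frequencies d \<Longrightarrow> character d k \<in> Hw d w"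
  using trig_poly_Hw(1)[of "{k}" "\<lambda>_. 1"] by simp

lemma Hw_operatorD:
  assumes "A \<in> Hw_operators d w" "f \<in> Hw d w"
  shows "A f \<in> Linf d"
    and "g \<in> Hw d w \<Longrightarrow> AE x in torus d. A (\<lambda>y. a * f y + b * g y) x = a * A f x + b * A g x"
  using assms by (auto simp: Hw_operators_def)

lemma Hw_operator_trig_poly:
  assumes A: "A \<in> Hw_operators d w" and K: "finite K" "K \<subseteq> frequencies d"
  shows "AE x in torus d. A (\<lambda>y. \<Sum>k\<in>K. a k * character d k y) x = (\<Sum>k\<in>K. a k * A (character d k) x)"
  using K
proof (induction K rule: finite_induct)
  case empty
  have "(\<lambda>y. 0) \<in> Hw d w" using trig_poly_Hw(1)[of "{}"] by simp
  \<comment> \<open>Linearity with both scalars 0 shows that the zero function is sent to 0 almost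
    everywhere.\<close>
  from Hw_operatorD(2)[OF A this this, of 0 0] show ?case by simp
next
  case (insert k K)
  then have "character d k \<in> Hw d w" "(\<lambda>y. \<Sum>k\<in>K. a k * character d k y) \<in> Hw d w"
    using character_Hw trig_poly_Hw(1)[of K a] by auto
  from Hw_operatorD(2)[OF A this, of "a k" 1]
  have "AE x in torus d. A (\<lambda>y. a k * character d k y + 1 * (\<Sum>k\<in>K. a k * character d k y)) x
      = a k * A (character d k) x + 1 * A (\<lambda>y. \<Sum>k\<in>K. a k * character d k y) x" .
  moreover have "AE x in torus d. A (\<lambda>y. \<Sum>k\<in>K. a k * character d k y) x = (\<Sum>k\<in>K. a k * A (character d k) x)"
    using insert by auto
  ultimately show ?case
    by (rule eventually_elim2) (use insert.hyps in simp)
qed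

text \<open>The worst-case error applied to a normalised trigonometric polynomial gives the bound
  for each fixed \<open>a\<close>; one null set then serves all \<open>a\<close>. Having it at a
  fixed \<open>x\<close> allows \<open>a\<close> to depend on \<open>x\<close>.\<close>

lemma operator_error_pointwise:
  assumes A: "A \<in> Hw_operators d w" and K: "finite K" "K \<subseteq> frequencies d" and e: "0 \<le> e"
    and err: "\<And>f. f \<in> Hw_ball d w \<Longrightarrow> Linf_norm d (\<lambda>x. f x - A f x) \<le> ennreal e"
  shows "AE x in torus d. \<forall>a. cmod (\<Sum>k\<in>K. a k * (character d k x - A (character d k) x))
      \<le> e * sqrt (\<Sum>k\<in>K. (w k)\<^sup>2 * (cmod (a k))\<^sup>2)"
proof (rule AE_uniform_linear_bound[OF K(1)])
  fix a :: "(nat \<Rightarrow> int) \<Rightarrow> complex"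
  define s where "s = sqrt (\<Sum>k\<in>K. (w k)\<^sup>2 * (cmod (a k))\<^sup>2)"
  have s0: "0 \<le> s" by (simp add: s_def sum_nonneg)
  show "AE x in torus d. cmod (\<Sum>k\<in>K. a k * (character d k x - A (character d k) x))
      \<le> e * sqrt (\<Sum>k\<in>K. (w k)\<^sup>2 * (cmod (a k))\<^sup>2)"
    unfolding s_def[symmetric]
  proof (cases "s = 0")
    \<comment> \<open>Normalisation is impossible here, but positive weights make all coefficients
      vanish.\<close>
    case True
    then have "\<forall>k\<in>K. (w k)\<^sup>2 * (cmod (a k))\<^sup>2 = 0"
      using K(1) by (simp add: s_def sum_nonneg_eq_0_iff)
    then have "\<forall>k\<in>K. a k = 0" using K(2) w_pos by fastforce
    then show "AE x in torus d. cmod (\<Sum>k\<in>K. a k * (character d k x - A (character d k) x)) \<le> e * s"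
      using e s0 by simp
  next
    case False
    let ?f = "\<lambda>y. \<Sum>k\<in>K. (a k / of_real s) * character d k y"
    have "(\<Sum>k\<in>K. (w k)\<^sup>2 * (cmod (a k / of_real s))\<^sup>2) = (\<Sum>k\<in>K. (w k)\<^sup>2 * (cmod (a k))\<^sup>2) / s\<^sup>2"
      by (simp add: norm_divide power_divide sum_divide_distrib)
    also have "(\<Sum>k\<in>K. (w k)\<^sup>2 * (cmod (a k))\<^sup>2) = s\<^sup>2" by (simp add: s_def sum_nonneg)
    finally have "(\<Sum>k\<in>K. (w k)\<^sup>2 * (cmod (a k / of_real s))\<^sup>2) = 1" using False by simp
    then have "Hw_norm d w ?f = 1" unfolding trig_poly_Hw(2)[OF K] by simp
    then have "?f \<in> Hw_ball d w"
      unfolding Hw_ball_def by (intro CollectI conjI trig_poly_Hw(1)[OF K]) (simp only: order_refl)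
    from AE_Linf_norm[OF err[OF this] e] Hw_operator_trig_poly[OF A K, of "\<lambda>k. a k / of_real s"]
    show "AE x in torus d. cmod (\<Sum>k\<in>K. a k * (character d k x - A (character d k) x)) \<le> e * s"
    proof (rule eventually_elim2)
      fix x assume 1: "cmod (?f x - A ?f x) \<le> e" and 2: "A ?f x = (\<Sum>k\<in>K. a k / of_real s * A (character d k) x)"
      have "?f x - A ?f x = (\<Sum>k\<in>K. a k * (character d k x - A (character d k) x)) / of_real s"
        unfolding 2 by (simp add: sum_divide_distrib sum_subtractf[symmetric] right_diff_distrib diff_divide_distrib)
      then have "cmod (\<Sum>k\<in>K. a k * (character d k x - A (character d k) x)) / s \<le> e"
        using 1 s0 by (simp add: norm_divide)
      then show "cmod (\<Sum>k\<in>K. a k * (character d k x - A (character d k) x)) \<le> e * s"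
        using False s0 by (simp add: field_simps)
    qed
  qed
qed

text \<open>A projection \<open>Y\<close> annihilating the range of \<open>A\<close> makes the
  errors \<open>h k\<close> and the test polynomials \<open>p k\<close> satisfy: \<open>h k\<close>
  and \<open>p k\<close> have the same pairing with \<open>p k\<close>, in real part, namely the
  diagonal entry \<open>y k\<close>. Weighting and summing, the pointwise error bound integrates to
  \<open>S \<le> (e^2 + S) / 2\<close>, so \<open>S \<le> e^2\<close>; the trace bound for
  \<open>Y\<close> compares \<open>S\<close> with the sum over \<open>K\<close>.\<close>

lemma operator_error_ge:
  assumes A: "A \<in> Hw_operators d w" "rank_less d w A (card V + 1)"
    and V: "finite V" "V \<subseteq> frequencies d" and K: "finite K" "K \<subseteq> frequencies d - V"
    and top: "\<And>k j. k \<in> V \<Longrightarrow> j \<in> frequencies d - V \<Longrightarrow> 1 / (w j)\<^sup>2 \<le> 1 / (w k)\<^sup>2"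
    and e: "0 \<le> e" and err: "\<And>f. f \<in> Hw_ball d w \<Longrightarrow> Linf_norm d (\<lambda>x. f x - A f x) \<le> ennreal e"
  shows "(\<Sum>k\<in>K. 1 / (w k)\<^sup>2) \<le> e\<^sup>2"
proof -
  define I where "I = V \<union> K"
  have I: "finite I" "I \<subseteq> frequencies d" using V K by (auto simp: I_def)
  obtain m \<phi> where m: "m < card V + 1" and \<phi>: "\<And>i. i < m \<Longrightarrow> \<phi> i \<in> Linf d"
    and rank: "\<And>f. f \<in> Hw d w \<Longrightarrow> \<exists>c :: nat \<Rightarrow> complex. AE x in torus d. A f x = (\<Sum>i<m. c i * \<phi> i x)"
    using A(2) unfolding rank_less_def by blast
  obtain Y where sY: "selfadj I Y" and idem: "\<And>a b. ip I (Y a) (Y b) = ip I a (Y b)"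
    and null: "\<And>i a. i < m \<Longrightarrow> ip I a (Y (fourier_coeff d (\<phi> i))) = 0"
    and tr: "real (card I) - real m \<le> wtrace I (\<lambda>_. 1) Y"
    using annihilating_projection[OF I(1), of m "\<lambda>i. fourier_coeff d (\<phi> i)"] by blast
  define y where "y k = Re (Y (unit_vec k) k)" for k
  define p where "p k x = (\<Sum>j\<in>I. Y (unit_vec k) j * character d j x)" for k x
  define h where "h k x = character d k x - A (character d k) x" for k x
  have AI: "integrable (torus d) (A (character d k))" if "k \<in> I" for k
    using Hw_operatorD(1)[OF A(1) character_Hw] that I(2) by (auto intro: Linf_integrable)
  have hI: "integrable (torus d) (h k)" if "k \<in> I" for k
    unfolding h_def using integrable_character AI[OF that] by (rule Bochner_Integration.integrable_diff)
  have pI: "integrable (torus d) (p k)" for k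
    unfolding p_def by (rule trig_poly_integrable)
  \<comment> \<open>The part of \<open>h k\<close> coming from \<open>A\<close> is a combination of
    the functions \<open>\<phi> i\<close>, whose coefficient vectors \<open>Y\<close> annihilates;
    only the character itself contributes.\<close>
  have h_coeff: "ip I (Y (unit_vec k)) (fourier_coeff d (h k)) = cnj (Y (unit_vec k) k)" if k: "k \<in> I" for k
  proof -
    have kF: "k \<in> frequencies d" using k I(2) by auto
    obtain c where c: "AE x in torus d. A (character d k) x = (\<Sum>i<m. c i * \<phi> i x)"
      using rank[OF character_Hw[OF kF]] by blast
    have \<phi>I: "integrable (torus d) (\<phi> i)" if "i < m" for i by (rule Linf_integrable[OF \<phi>[OF that]])
    then have sI: "integrable (torus d) (\<lambda>x. \<Sum>i<m. c i * \<phi> i x)"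
      by (intro Bochner_Integration.integrable_sum integrable_mult_right) auto
    have "fourier_coeff d (h k) j = unit_vec k j + (- 1) * (\<Sum>i<m. c i * fourier_coeff d (\<phi> i) j)" if j: "j \<in> I" for j
    proof -
      have jF: "j \<in> frequencies d" using j I(2) by auto
      have "fourier_coeff d (A (character d k)) j = fourier_coeff d (\<lambda>x. \<Sum>i<m. c i * \<phi> i x) j"
        unfolding fourier_coeff_eq
        by (rule integral_cong_AE)
          (use c integrable_times_cnj_character[OF AI[OF k]] integrable_times_cnj_character[OF sI]
            in \<open>auto elim: eventually_mono\<close>)
      also have "\<dots> = (\<Sum>i<m. c i * fourier_coeff d (\<phi> i) j)"
        by (rule fourier_coeff_sum) (use \<phi>I in auto)
      finally have "fourier_coeff d (A (character d k)) j = (\<Sum>i<m. c i * fourier_coeff d (\<phi> i) j)" .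
      moreover have "fourier_coeff d (character d k) j = unit_vec k j"
        using fourier_coeff_trig_poly[of "{k}" d j "\<lambda>_. 1"] kF jF by (auto simp: unit_vec_def)
      ultimately show ?thesis
        unfolding h_def[abs_def] by (simp add: fourier_coeff_diff[OF integrable_character AI[OF k]])
    qed
    then have "ip I (Y (unit_vec k)) (fourier_coeff d (h k))
        = ip I (Y (unit_vec k)) (\<lambda>j. unit_vec k j + (- 1) * (\<Sum>i<m. c i * fourier_coeff d (\<phi> i) j))"
      by (intro ip_cong) auto
    also have "\<dots> = ip I (Y (unit_vec k)) (unit_vec k)
        + (- 1) * (\<Sum>i<m. c i * ip I (Y (unit_vec k)) (fourier_coeff d (\<phi> i)))"
      by (simp only: ip_add_right ip_scale_right ip_sum_right)
    also have "(\<Sum>i<m. c i * ip I (Y (unit_vec k)) (fourier_coeff d (\<phi> i))) = 0"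
      using null by (simp add: selfadjD[OF sY, symmetric])
    also have "ip I (Y (unit_vec k)) (unit_vec k) = cnj (Y (unit_vec k) k)"
      by (metis cnj_ip ip_unit[OF I(1) k])
    finally show ?thesis by simp
  qed
  have p_coeff: "ip I (Y (unit_vec k)) (fourier_coeff d (p k)) = Y (unit_vec k) k" if k: "k \<in> I" for k
  proof -
    have "ip I (Y (unit_vec k)) (fourier_coeff d (p k)) = ip I (Y (unit_vec k)) (Y (unit_vec k))"
      using fourier_coeff_trig_poly[OF I] I(2) unfolding p_def by (intro ip_cong) auto
    then show ?thesis by (simp add: idem ip_unit[OF I(1) k])
  qed
  define S where "S = (\<Sum>k\<in>I. 1 / (w k)\<^sup>2 * y k)"
  have pair: "integrable (torus d) (\<lambda>x. \<Sum>k\<in>I. (1 / (w k)\<^sup>2) * Re (g k x * cnj (p k x)))"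
     "(LINT x|torus d. (\<Sum>k\<in>I. (1 / (w k)\<^sup>2) * Re (g k x * cnj (p k x)))) = S"
    if g: "\<And>k. k \<in> I \<Longrightarrow> integrable (torus d) (g k)"
      "\<And>k. k \<in> I \<Longrightarrow> Re (ip I (Y (unit_vec k)) (fourier_coeff d (g k))) = y k" for g
  proof -
    have i: "integrable (torus d) (\<lambda>x. g k x * cnj (p k x))" if "k \<in> I" for k
      unfolding p_def by (rule pairing_trig_poly(1)[OF g(1)[OF that]])
    then have i': "integrable (torus d) (\<lambda>x. (1 / (w k)\<^sup>2) * Re (g k x * cnj (p k x)))" if "k \<in> I" for k
      using that by (intro integrable_mult_right integrable_Re) auto
    then show "integrable (torus d) (\<lambda>x. \<Sum>k\<in>I. (1 / (w k)\<^sup>2) * Re (g k x * cnj (p k x)))"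
      by (rule Bochner_Integration.integrable_sum)
    have "(LINT x|torus d. Re (g k x * cnj (p k x))) = y k" if "k \<in> I" for k
      using integral_Re[OF i[OF that]] pairing_trig_poly(2)[OF g(1)[OF that], where K=I and u="Y (unit_vec k)"] g(2)[OF that]
      by (simp add: p_def)
    then show "(LINT x|torus d. (\<Sum>k\<in>I. (1 / (w k)\<^sup>2) * Re (g k x * cnj (p k x)))) = S"
      unfolding S_def by (subst Bochner_Integration.integral_sum[OF i']) (auto intro!: sum.cong)
  qed
  have h_pair: "integrable (torus d) (\<lambda>x. \<Sum>k\<in>I. (1 / (w k)\<^sup>2) * Re (h k x * cnj (p k x)))"
     "(LINT x|torus d. (\<Sum>k\<in>I. (1 / (w k)\<^sup>2) * Re (h k x * cnj (p k x)))) = S"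
    by (rule pair; use hI h_coeff in \<open>simp add: y_def\<close>)+
  have p_pair: "integrable (torus d) (\<lambda>x. \<Sum>k\<in>I. (1 / (w k)\<^sup>2) * Re (p k x * cnj (p k x)))"
     "(LINT x|torus d. (\<Sum>k\<in>I. (1 / (w k)\<^sup>2) * Re (p k x * cnj (p k x)))) = S"
    by (rule pair; use pI p_coeff in \<open>simp add: y_def\<close>)+
  have "S \<le> (LINT x|torus d. (e\<^sup>2 + (\<Sum>k\<in>I. (1 / (w k)\<^sup>2) * Re (p k x * cnj (p k x)))) / 2)"
    unfolding h_pair(2)[symmetric]
  proof (rule integral_mono_AE[OF h_pair(1)])
    show "integrable (torus d) (\<lambda>x. (e\<^sup>2 + (\<Sum>k\<in>I. (1 / (w k)\<^sup>2) * Re (p k x * cnj (p k x)))) / 2)"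
      using p_pair(1) by simp
    show "AE x in torus d. (\<Sum>k\<in>I. (1 / (w k)\<^sup>2) * Re (h k x * cnj (p k x)))
        \<le> (e\<^sup>2 + (\<Sum>k\<in>I. (1 / (w k)\<^sup>2) * Re (p k x * cnj (p k x)))) / 2"
      using operator_error_pointwise[OF A(1) I e err]
    proof (rule eventually_mono)
      fix x
      assume *: "\<forall>a. cmod (\<Sum>k\<in>I. a k * (character d k x - A (character d k) x))
          \<le> e * sqrt (\<Sum>k\<in>I. (w k)\<^sup>2 * (cmod (a k))\<^sup>2)"
      define P where "P = (\<Sum>k\<in>I. (1 / (w k)\<^sup>2) * Re (p k x * cnj (p k x)))"
      \<comment> \<open>The coefficients that turn the linear bound into the weighted pairing at
        \<open>x\<close>; their weighted squared length is exactly \<open>P\<close>.\<close>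
      define a where "a k = of_real (1 / (w k)\<^sup>2) * cnj (p k x)" for k
      have "(\<Sum>k\<in>I. (1 / (w k)\<^sup>2) * Re (h k x * cnj (p k x))) = Re (\<Sum>k\<in>I. a k * h k x)"
        unfolding a_def Re_sum by (intro sum.cong refl) (simp add: algebra_simps add_divide_distrib)
      also have "\<dots> \<le> cmod (\<Sum>k\<in>I. a k * h k x)" by (rule complex_Re_le_cmod)
      also have "\<dots> \<le> e * sqrt (\<Sum>k\<in>I. (w k)\<^sup>2 * (cmod (a k))\<^sup>2)"
        using * by (simp add: h_def)
      also have "(\<Sum>k\<in>I. (w k)\<^sup>2 * (cmod (a k))\<^sup>2) = P"
        unfolding P_def
      proof (intro sum.cong refl)
        fix k assume "k \<in> I"
        then have "0 < w k" using I(2) w_pos by auto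
        moreover have "Re (p k x * cnj (p k x)) = (cmod (p k x))\<^sup>2"
          by (metis complex_norm_square Re_complex_of_real)
        ultimately show "(w k)\<^sup>2 * (cmod (a k))\<^sup>2 = (1 / (w k)\<^sup>2) * Re (p k x * cnj (p k x))"
          by (simp add: a_def norm_mult norm_divide norm_power power_divide power2_eq_square)
      qed
      also have "e * sqrt P \<le> (e\<^sup>2 + P) / 2"
      proof -
        have "0 \<le> P" unfolding P_def
          by (intro sum_nonneg mult_nonneg_nonneg) (simp_all add: complex_mult_cnj)
        then show ?thesis using sum_squares_bound[of e "sqrt P"] by simp
      qed
      finally show "(\<Sum>k\<in>I. (1 / (w k)\<^sup>2) * Re (h k x * cnj (p k x)))
        \<le> (e\<^sup>2 + (\<Sum>k\<in>I. (1 / (w k)\<^sup>2) * Re (p k x * cnj (p k x)))) / 2"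
        by (simp add: P_def)
    qed
  qed
  also have "\<dots> = (e\<^sup>2 + S) / 2"
    using p_pair torus.prob_space by (simp add: add_divide_distrib)
  finally have S: "S \<le> e\<^sup>2" by simp
  have "(\<Sum>k\<in>K. 1 / (w k)\<^sup>2) \<le> S"
    unfolding S_def I_def
  proof (rule top_sum_le[OF V(1) K(1)])
    show "V \<inter> K = {}" using K(2) by auto
    show "0 \<le> y k \<and> y k \<le> 1" if "k \<in> V \<union> K" for k
      using projection_diagonal[OF I(1) sY idem] that by (simp add: y_def I_def)
    \<comment> \<open>As \<open>m\<close> is at most \<open>card V\<close>, the trace of
      \<open>Y\<close> is at least \<open>card K\<close>.\<close>
    have "card I = card V + card K"
      unfolding I_def using V(1) K by (intro card_Un_disjoint) auto
    then show "real (card K) \<le> (\<Sum>k\<in>V \<union> K. y k)"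
      using tr m by (simp add: wtrace_def y_def I_def[symmetric])
    show "1 / (w j)\<^sup>2 \<le> 1 / (w k)\<^sup>2" if "k \<in> V" "j \<in> K" for k j
      using top that K(2) by blast
  qed simp
  with S show ?thesis by simp
qed

text \<open>The finite sums over \<open>K\<close> are bounded uniformly by the squared error of any
  competitor, so the full tail is as well; a competitor of infinite error is trivial.\<close>

lemma approx_number_ge_tail:
  assumes V: "finite V" "V \<subseteq> frequencies d"
    and top: "\<And>k j. k \<in> V \<Longrightarrow> j \<in> frequencies d - V \<Longrightarrow> 1 / (w j)\<^sup>2 \<le> 1 / (w k)\<^sup>2"
  shows "ennreal (sqrt (tail V)) \<le> approx_number d w (card V + 1)"
  unfolding approx_number_def
proof (rule INF_greatest)
  fix A assume "A \<in> {A \<in> Hw_operators d w. rank_less d w A (card V + 1)}"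
  then have A: "A \<in> Hw_operators d w" "rank_less d w A (card V + 1)" by auto
  let ?E = "SUP f\<in>Hw_ball d w. Linf_norm d (\<lambda>x. f x - A f x)"
  show "ennreal (sqrt (tail V)) \<le> ?E"
  proof (cases ?E)
    case (real e)
    have "Linf_norm d (\<lambda>x. f x - A f x) \<le> ennreal e" if "f \<in> Hw_ball d w" for f
      using SUP_upper[OF that, of "\<lambda>f. Linf_norm d (\<lambda>x. f x - A f x)"] real by simp
    then have "tail V \<le> e\<^sup>2"
      unfolding tail_def
      by (intro infsum_le_finite_sums tail_summable operator_error_ge[OF A V _ _ top real(1)]) auto
    then have "sqrt (tail V) \<le> e" using real(1) by (rule real_le_lsqrt[rotated])
    then show ?thesis using real by (simp add: ennreal_leI)
  next
    case top
    then show ?thesis by (metis top_greatest)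
  qed
qed

section \<open>Upper bound for the sampling numbers\<close>

text \<open>The barrier argument needs a finite index set, so the frequencies split into
  \<open>V\<close>, a finite part \<open>K\<close> and a remainder too small to disturb the samples
  by more than \<open>T\<close> in total. Least squares on \<open>V\<close> and \<open>K\<close> has
  error at most \<open>2 sqrt (2 T) \<le> 3 sqrt T\<close>, and the remainder adds at most
  \<open>sqrt T\<close>.\<close>

lemma sampling_number_le_tail:
  assumes V: "finite V" "V \<subseteq> frequencies d" and n: "16 * card V \<le> n" and pos: "0 < tail V"
  shows "sampling_number d w n \<le> ennreal (4 * sqrt (tail V))"
proof -
  define T where "T = tail V"
  define q where "q = 16 * card V"
  have T: "0 < T" using pos by (simp add: T_def)
  \<comment> \<open>A quarter of the \<open>16 * card V\<close> squared residuals, each at most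
    \<open>tail I\<close>, amounts to \<open>4 * card V * tail I\<close>, which has to stay below
    \<open>T\<close>.\<close>
  define \<epsilon> where "\<epsilon> = T / (4 * card V + 1)"
  have \<epsilon>: "0 < \<epsilon>" using T by (simp add: \<epsilon>_def)
  obtain K where K: "finite K" "K \<subseteq> frequencies d - V"
    and approx: "dist (\<Sum>k\<in>K. 1 / (w k)\<^sup>2) T \<le> \<epsilon>"
    using infsum_finite_approximation[OF tail_summable \<epsilon>, of V] unfolding T_def tail_def by blast
  define I where "I = V \<union> K"
  have I: "finite I" "I \<subseteq> frequencies d" "V \<subseteq> I" and IV: "I - V = K"
    using V K by (auto simp: I_def)
  have "tail I = T - (\<Sum>k\<in>K. 1 / (w k)\<^sup>2)"
    using infsum_Diff[OF tail_summable summable_on_finite[OF K(1)] K(2)] K(1)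
    by (simp add: tail_def T_def I_def Diff_Un Diff_Diff_Int set_diff_eq conj_assoc cong: conj_cong)
  then have "tail I \<le> \<epsilon>" using approx by (simp add: dist_real_def)
  then have "tail I * (4 * card V + 1) \<le> T" by (simp add: \<epsilon>_def field_simps)
  then have tailI: "4 * card V * tail I + tail I \<le> T" by (simp add: algebra_simps)
  have tailI0: "0 \<le> tail I" by (rule tail_nonneg)
  have tailI1: "tail I \<le> T"
  proof -
    have "0 \<le> 4 * card V * tail I" using tailI0 by simp
    then show ?thesis using tailI by linarith
  qed
  \<comment> \<open>The scaling makes the weights \<open>D = b^2\<close> equal to 1 on
    \<open>V\<close> and of total at most 1 off \<open>V\<close>, as the barrier argument
    requires.\<close>
  define b where "b i = (if i \<in> V then 1 else 1 / (w i * sqrt T))" for i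
  have b0: "b i \<noteq> 0" if "i \<in> I" for i
    using that I(2) w_pos[of i] T by (auto simp: b_def)
  have bK: "(b i)\<^sup>2 = 1 / (w i)\<^sup>2 / T" if "i \<in> K" for i
    using that K(2) T by (auto simp: b_def power_divide power_mult_distrib)
  have sum_bK: "(\<Sum>i\<in>K. (b i)\<^sup>2) \<le> 1"
  proof -
    have "(\<Sum>i\<in>K. (b i)\<^sup>2) = (\<Sum>i\<in>K. 1 / (w i)\<^sup>2) / T"
      by (simp add: bK sum_divide_distrib)
    also have "\<dots> \<le> 1" using sum_le_tail[OF K] T by (simp add: T_def)
    finally show ?thesis .
  qed
  define z where "z x = (\<lambda>i. of_real (b i) * cnj (character d i x))" for x
  obtain xs L where xs: "\<And>t. t < q \<Longrightarrow> xs t \<in> torus_points d"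
    and ls: "\<And>c r. let e = (\<lambda>i. (\<Sum>t<q. L t i * (ip I (z (xs t)) c + r t)) - c i);
         J = (\<Sum>i\<in>I - V. (cmod (c i))\<^sup>2) + (\<Sum>t<q. (cmod (r t))\<^sup>2) / 4
     in card V * (\<Sum>i\<in>V. (cmod (e i))\<^sup>2) \<le> J \<and> (\<Sum>i\<in>I - V. (cmod (e i))\<^sup>2) \<le> J"
  proof -
    have "\<exists>xs L. (\<forall>t<16 * card V. xs t \<in> torus_points d) \<and> (\<forall>c r.
     let e = (\<lambda>i. (\<Sum>t<16 * card V. L t i * (ip I (z (xs t)) c + r t)) - c i);
         J = (\<Sum>i\<in>I - V. (cmod (c i))\<^sup>2) + (\<Sum>t<16 * card V. (cmod (r t))\<^sup>2) / 4
     in card V * (\<Sum>i\<in>V. (cmod (e i))\<^sup>2) \<le> J \<and> (\<Sum>i\<in>I - V. (cmod (e i))\<^sup>2) \<le> J)"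
    proof (rule regularised_least_squares[OF I(1,3), where D="\<lambda>i. (b i)\<^sup>2"])
      show "(\<Sum>i\<in>I - V. (b i)\<^sup>2) \<le> 1" using sum_bK by (simp add: IV)
      show "\<exists>x\<in>torus_points d. wtrace I (\<lambda>i. (b i)\<^sup>2) H \<le> quad_form I H (z x)" if "selfadj I H" for H
        unfolding z_def by (rule character_average[OF I(1,2) that])
    qed (simp_all add: b_def)
    then show ?thesis using that unfolding q_def by blast
  qed
  \<comment> \<open>Surplus points are placed at the origin, and the reconstruction ignores their
    values.\<close>
  define X where "X = (\<lambda>j\<in>{..<n}. if j < q then xs j else (\<lambda>i\<in>{..<d}. 0))"
  have qn: "t < n" if "t < q" for t using that n by (simp add: q_def)
  have X: "X \<in> {..<n} \<rightarrow>\<^sub>E torus_points d"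
    using xs by (auto simp: X_def torus_points_def)
  define R where "R u = (\<lambda>x. \<Sum>i\<in>I. ((\<Sum>t<q. L t i * u t) * of_real (b i)) * character d i x)" for u
  have R: "R \<in> reconstructions d n"
  proof -
    have "R (\<lambda>j\<in>{..<n}. a1 * u j + a2 * v j) x = a1 * R u x + a2 * R v x" for a1 a2 u v x
    proof -
      have "(\<Sum>t<q. L t i * (\<lambda>j\<in>{..<n}. a1 * u j + a2 * v j) t) = a1 * (\<Sum>t<q. L t i * u t) + a2 * (\<Sum>t<q. L t i * v t)" for i
      proof -
        have "(\<Sum>t<q. L t i * (\<lambda>j\<in>{..<n}. a1 * u j + a2 * v j) t) = (\<Sum>t<q. a1 * (L t i * u t) + a2 * (L t i * v t))"
          using qn by (intro sum.cong) (auto simp: algebra_simps)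
        then show ?thesis by (simp add: sum.distrib sum_distrib_left)
      qed
      then show ?thesis
        unfolding R_def by (simp add: sum.distrib[symmetric] sum_distrib_left algebra_simps)
    qed
    moreover have "R u \<in> Linf d" for u unfolding R_def by (rule trig_poly_Linf)
    ultimately show ?thesis by (simp add: reconstructions_def)
  qed
  have "Linf_norm d (\<lambda>x. f x - R (\<lambda>j\<in>{..<n}. cont_rep d f (X j)) x) \<le> ennreal (4 * sqrt T)"
    if fb: "f \<in> Hw_ball d w" for f
  proof -
    have f: "f \<in> Hw d w" "Hw_norm d w f \<le> 1" using fb by (auto simp: Hw_ball_def)
    note fi = Hw_integrable[OF f(1)] note fs = Hw_abs_summable[OF f(1)]
    let ?c = "fourier_coeff d f" let ?g = "fourier_series d (fourier_coeff d f)"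
    define p where "p x = (\<Sum>i\<in>I. ?c i * character d i x)" for x
    define y where "y = (\<lambda>j\<in>{..<n}. cont_rep d f (X j))"
    \<comment> \<open>Rescaled so that pairing with \<open>z x\<close> evaluates the partial sum
      \<open>p\<close> at \<open>x\<close>.\<close>
    define c where "c i = ?c i / of_real (b i)" for i
    define r where "r t = ?g (xs t) - p (xs t)" for t
    have rest: "cmod (?g x - p x) \<le> sqrt (tail I)" for x
    proof -
      have "cmod (?g x - p x) \<le> sqrt (tail I) * Hw_norm d w f"
        unfolding p_def using fourier_series_tail[OF fs I(1,2)] coeff_tail_le[OF f(1)] by (rule order_trans)
      also have "\<dots> \<le> sqrt (tail I)" using f(2) tailI0 by (simp add: mult_left_le)
      finally show ?thesis .
    qed
    have ipz: "ip I (z x) c = p x" for x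
      unfolding ip_def p_def z_def c_def using b0 by (intro sum.cong) auto
    have y: "ip I (z (xs t)) c + r t = y t" if "t < q" for t
      using cont_rep_eq[OF fi fs xs[OF that]] that qn[OF that] by (simp add: ipz r_def y_def X_def)
    define e where "e i = (\<Sum>t<q. L t i * y t) - c i" for i
    define J where "J = (\<Sum>i\<in>K. (cmod (c i))\<^sup>2) + (\<Sum>t<q. (cmod (r t))\<^sup>2) / 4"
    have e_alt: "(\<lambda>i. (\<Sum>t<q. L t i * (ip I (z (xs t)) c + r t)) - c i) = e"
      using y by (auto simp: e_def fun_eq_iff)
    have eV: "card V * (\<Sum>i\<in>V. (cmod (e i))\<^sup>2) \<le> J" and eK: "(\<Sum>i\<in>K. (cmod (e i))\<^sup>2) \<le> J"
      using ls[of c r] unfolding Let_def e_alt IV J_def by auto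
    \<comment> \<open>One \<open>T\<close> comes from the penalty, since the rescaled coefficients
      on \<open>K\<close> have squared length at most \<open>T\<close> times the squared norm of
      \<open>f\<close>; the other comes from the unseen part \<open>r\<close>.\<close>
    have J: "J \<le> 2 * T"
    proof -
      have "(\<Sum>i\<in>K. (cmod (c i))\<^sup>2) = T * (\<Sum>i\<in>K. (w i)\<^sup>2 * (cmod (?c i))\<^sup>2)"
        unfolding sum_distrib_left
      proof (intro sum.cong refl)
        fix i assume i: "i \<in> K"
        have "(cmod (c i))\<^sup>2 = (cmod (?c i))\<^sup>2 / (b i)\<^sup>2"
          by (simp add: c_def norm_divide power_divide)
        then show "(cmod (c i))\<^sup>2 = T * ((w i)\<^sup>2 * (cmod (?c i))\<^sup>2)"
          using T by (simp add: bK[OF i])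
      qed
      also have "\<dots> \<le> T * 1"
      proof (rule mult_left_mono)
        have "(\<Sum>i\<in>K. (w i)\<^sup>2 * (cmod (?c i))\<^sup>2) \<le> (Hw_norm d w f)\<^sup>2"
          using coeff_sum_le_Hw_norm[OF f(1) K(1)] K(2) by blast
        also have "\<dots> \<le> 1" using f(2) Hw_norm_nonneg[of f] by (simp add: power_le_one)
        finally show "(\<Sum>i\<in>K. (w i)\<^sup>2 * (cmod (?c i))\<^sup>2) \<le> 1" .
      qed (use T in simp)
      finally have 1: "(\<Sum>i\<in>K. (cmod (c i))\<^sup>2) \<le> T" by simp
      have "(cmod (r t))\<^sup>2 \<le> tail I" for t
        using power_mono[OF rest norm_ge_zero, of "xs t" 2] tailI0 by (simp add: r_def)
      then have "(\<Sum>t<q. (cmod (r t))\<^sup>2) \<le> (\<Sum>t<q. tail I)" by (rule sum_mono)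
      also have "\<dots> = 4 * (4 * card V * tail I)" by (simp add: q_def)
      finally show ?thesis using 1 tailI tailI0 unfolding J_def by linarith
    qed
    have sq: "sqrt (2 * T) \<le> 3 / 2 * sqrt T"
    proof (rule real_le_lsqrt)
      show "2 * T \<le> (3 / 2 * sqrt T)\<^sup>2" using T by (simp add: power_mult_distrib power2_eq_square)
    qed (use T in auto)
    have "cmod (R y x - p x) \<le> 3 * sqrt T" for x
    proof -
      have "R y x - p x = (\<Sum>i\<in>I. (e i * of_real (b i)) * character d i x)"
        unfolding R_def p_def sum_subtractf[symmetric] left_diff_distrib[symmetric]
        using b0 by (intro sum.cong refl) (simp add: e_def c_def left_diff_distrib)
      also have "cmod \<dots> \<le> (\<Sum>i\<in>I. cmod (e i * of_real (b i)))" by (rule norm_trig_poly_le)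
      also have "\<dots> = (\<Sum>i\<in>K. cmod (e i) * \<bar>b i\<bar>) + (\<Sum>i\<in>V. cmod (e i) * 1)"
        unfolding norm_mult norm_of_real
        by (subst sum.subset_diff[OF I(3,1)]) (simp add: IV b_def)
      also have "(\<Sum>i\<in>K. cmod (e i) * \<bar>b i\<bar>) \<le> sqrt (2 * T)"
      proof (rule sum_times_le_sqrt)
        have "(\<Sum>i\<in>K. (cmod (e i))\<^sup>2) * (\<Sum>i\<in>K. \<bar>b i\<bar>\<^sup>2) \<le> (\<Sum>i\<in>K. (cmod (e i))\<^sup>2) * 1"
          using sum_bK by (intro mult_left_mono) (auto intro: sum_nonneg)
        then show "(\<Sum>i\<in>K. (cmod (e i))\<^sup>2) * (\<Sum>i\<in>K. \<bar>b i\<bar>\<^sup>2) \<le> 2 * T" using eK J by simp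
      qed
      \<comment> \<open>Cauchy-Schwarz against the constant 1 costs the factor
        \<open>card V\<close>, which the stability constant of least squares on \<open>V\<close>
        pays for.\<close>
      also have "(\<Sum>i\<in>V. cmod (e i) * 1) \<le> sqrt (2 * T)"
        by (rule sum_times_le_sqrt) (use eV J in \<open>simp add: mult.commute\<close>)
      finally show ?thesis using sq by linarith
    qed
    moreover have "cmod (?g x - p x) \<le> sqrt T" for x
      using rest[of x] tailI1 by (meson order_trans real_sqrt_le_mono)
    ultimately have "cmod (?g x - R y x) \<le> 4 * sqrt T" for x
      using norm_triangle_ineq4[of "?g x - p x" "R y x - p x"] by (smt (verit) diff_diff_eq2 diff_add_cancel)
    then have "AE x in torus d. cmod (f x - R y x) \<le> 4 * sqrt T"
      using AE_eq_fourier_series[OF fi fs] by (auto elim!: eventually_mono)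
    moreover have "(\<lambda>x. f x - R y x) \<in> borel_measurable (torus d)"
      unfolding R_def using fi by (intro borel_measurable_diff trig_poly_measurable) auto
    ultimately show ?thesis unfolding y_def by (intro Linf_norm_le)
  qed
  then have "(SUP f\<in>Hw_ball d w. Linf_norm d (\<lambda>x. f x - R (\<lambda>j\<in>{..<n}. cont_rep d f (X j)) x)) \<le> ennreal (4 * sqrt T)"
    by (rule SUP_least)
  then show ?thesis
    unfolding sampling_number_def T_def by (intro INF_lower2[OF X] INF_lower2[OF R])
qed

text \<open>Index \<open>M = m + 1\<close> corresponds to retaining the \<open>m\<close> frequencies
  of smallest weight; the upper bound for sampling and the lower bound for approximation meet in the
  same tail.\<close>

lemma sampling_number_le_approx_number:
  assumes d: "1 \<le> d" and M: "16 * M \<le> n"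
  shows "sampling_number d w n \<le> 4 * approx_number d w M"
proof (cases M)
  case 0
  \<comment> \<open>No operator has rank below 0, so the infimum is over the empty set.\<close>
  then have "approx_number d w M = \<infinity>"
    by (simp add: approx_number_def rank_less_def)
  then show ?thesis by (simp add: ennreal_mult_top)
next
  case (Suc m)
  obtain V where V: "V \<subseteq> frequencies d" "finite V" "card V = m"
    and top: "\<forall>k\<in>V. \<forall>j\<in>frequencies d - V. 1 / (w j)\<^sup>2 \<le> 1 / (w k)\<^sup>2"
    using exists_top_set[OF w_sum _ infinite_frequencies[OF d], of m] w_pos by fastforce
  \<comment> \<open>One remaining frequency makes the tail positive, so that dividing by it is
    legitimate.\<close>
  obtain k where k: "k \<in> frequencies d - V"
    using infinite_frequencies[OF d] V(2) by (metis Diff_infinite_finite ex_in_conv finite.emptyI)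
  have "0 < 1 / (w k)\<^sup>2" using w_pos[of k] k by auto
  also have "\<dots> \<le> tail V" using sum_le_tail[of "{k}" V] k by simp
  finally have "sampling_number d w n \<le> ennreal (4 * sqrt (tail V))"
    using V M Suc by (intro sampling_number_le_tail) auto
  also have "\<dots> = 4 * ennreal (sqrt (tail V))"
    by (simp add: ennreal_mult tail_nonneg)
  also have "\<dots> \<le> 4 * approx_number d w M"
    using approx_number_ge_tail[OF V(2,1)] top V(3) Suc by (intro mult_left_mono) auto
  finally show ?thesis .
qed

text \<open>The rank condition below \<open>n + 1\<close> admits the Fourier projection onto the
  first \<open>n\<close> frequencies of the rearrangement; its tail is reindexed along
  \<open>\<sigma>\<close>.\<close>

lemma approx_number_le_rearranged_tail:
  assumes \<tau>: "nonincreasing_rearrangement (\<lambda>k. 1 / w k) (frequencies d) \<tau>"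
  shows "(approx_number d w (n + 1))\<^sup>2 \<le> (\<Sum>\<^sub>\<infinity>k\<in>{n + 1..}. ennreal ((\<tau> k)\<^sup>2))"
proof -
  obtain \<sigma> where \<sigma>: "bij_betw \<sigma> {1..} (frequencies d)" "\<And>k. 1 \<le> k \<Longrightarrow> \<tau> k = 1 / w (\<sigma> k)"
    using \<tau> by (auto simp: nonincreasing_rearrangement_def)
  define V where "V = \<sigma> ` {1..n}"
  have inj: "inj_on \<sigma> {1..n}" using \<sigma>(1) by (rule inj_on_subset[OF bij_betw_imp_inj_on]) auto
  have V: "finite V" "V \<subseteq> frequencies d" "card V < n + 1"
    using bij_betw_imp_surj_on[OF \<sigma>(1)] card_image[OF inj] by (auto simp: V_def)
  have "frequencies d - V = \<sigma> ` ({1..} - {1..n})"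
    unfolding V_def bij_betw_imp_surj_on[OF \<sigma>(1), symmetric]
    by (rule inj_on_image_set_diff[OF bij_betw_imp_inj_on[OF \<sigma>(1)], symmetric]) auto
  also have "{1..} - {1..n} = {n + 1..}" by auto
  finally have bij: "bij_betw \<sigma> {n + 1..} (frequencies d - V)"
    using bij_betw_imp_inj_on[OF \<sigma>(1)] by (auto simp: bij_betw_def intro: inj_on_subset)
  have sq: "1 / (w (\<sigma> k))\<^sup>2 = (\<tau> k)\<^sup>2" if "k \<in> {n + 1..}" for k
    using \<sigma>(2)[of k] that by (simp add: power_divide)
  have "((\<lambda>k. 1 / (w k)\<^sup>2) has_sum tail V) (frequencies d - V)"
    unfolding tail_def using tail_summable by (rule has_sum_infsum)
  then have "((\<lambda>k. 1 / (w (\<sigma> k))\<^sup>2) has_sum tail V) {n + 1..}"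
    by (subst has_sum_reindex_bij_betw[OF bij])
  then have "((\<lambda>k. (\<tau> k)\<^sup>2) has_sum tail V) {n + 1..}"
    using sq by (subst (asm) has_sum_cong) auto
  \<comment> \<open>The real sum is carried over to \<open>ennreal\<close> through its net of finite
    partial sums.\<close>
  then have "((\<lambda>S. ennreal (\<Sum>k\<in>S. (\<tau> k)\<^sup>2)) \<longlongrightarrow> ennreal (tail V)) (finite_subsets_at_top {n + 1..})"
    unfolding has_sum_def by (rule tendsto_ennrealI)
  then have "((\<lambda>k. ennreal ((\<tau> k)\<^sup>2)) has_sum ennreal (tail V)) {n + 1..}"
    unfolding has_sum_def by (rule Lim_transform_eventually) (simp add: sum_ennreal)
  then have eq: "(\<Sum>\<^sub>\<infinity>k\<in>{n + 1..}. ennreal ((\<tau> k)\<^sup>2)) = ennreal (tail V)" by (rule infsumI)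
  have "(approx_number d w (n + 1))\<^sup>2 \<le> (ennreal (sqrt (tail V)))\<^sup>2"
    by (intro power_mono approx_number_le_tail V) simp
  also have "\<dots> = ennreal (tail V)" by (simp add: ennreal_power tail_nonneg)
  finally show ?thesis unfolding eq .
qed

end

theorem theorem7p2:
  shows "\<exists>C b c :: real. C > 0 \<and> b > 0 \<and> c > 0 \<and>
    (\<forall>(d :: nat) (w :: (nat \<Rightarrow> int) \<Rightarrow> real).
       d \<ge> 1 \<longrightarrow>
       (\<forall>k\<in>frequencies d. w k > 0) \<longrightarrow>
       (\<lambda>k. 1 / (w k)\<^sup>2) summable_on frequencies d \<longrightarrow>
       (\<forall>n\<ge>2. sampling_number d w n \<le>
          ennreal C * min (approx_number d w (nat \<lfloor>real n / (b * ln (real n))\<rfloor>))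
                          (ennreal (sqrt (ln (real n))) * approx_number d w (nat \<lfloor>c * real n\<rfloor>))) \<and>
       (\<forall>\<tau>. nonincreasing_rearrangement (\<lambda>k. 1 / w k) (frequencies d) \<tau> \<longrightarrow>
          (\<forall>n. (approx_number d w (n + 1))\<^sup>2 \<le> (\<Sum>\<^sub>\<infinity>k\<in>{n + 1..}. ennreal ((\<tau> k)\<^sup>2)))))"
\<comment> \<open>For \<open>n \<ge> 2\<close> the logarithm is at least \<open>1/2\<close>. So
  \<open>32 ln n \<ge> 16\<close>, which makes both indices at most \<open>n / 16\<close>, and
  \<open>4 \<le> 8 sqrt (ln n)\<close>, which absorbs the factor 4 into the second term of the
  minimum.\<close>
proof (rule exI[of _ 8], rule exI[of _ 32], rule exI[of _ "1 / 16"], intro conjI allI impI)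
  fix d :: nat and w :: "(nat \<Rightarrow> int) \<Rightarrow> real"
  assume d: "1 \<le> d" and w: "\<forall>k\<in>frequencies d. 0 < w k" "(\<lambda>k. 1 / (w k)\<^sup>2) summable_on frequencies d"
  interpret weighted_torus d w using w by unfold_locales auto
  show "(approx_number d w (n + 1))\<^sup>2 \<le> (\<Sum>\<^sub>\<infinity>k\<in>{n + 1..}. ennreal ((\<tau> k)\<^sup>2))"
    if "nonincreasing_rearrangement (\<lambda>k. 1 / w k) (frequencies d) \<tau>" for \<tau> n
    by (rule approx_number_le_rearranged_tail[OF that])
  fix n :: nat assume n: "2 \<le> n"
  have "ln (2::real) \<le> ln (real n)" using n by simp
  then have ln: "1 / 2 \<le> ln (real n)" using ln2_ge_two_thirds by linarith
  let ?M1 = "nat \<lfloor>real n / (32 * ln (real n))\<rfloor>" and ?M2 = "nat \<lfloor>1 / 16 * real n\<rfloor>"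
  have "real n / (32 * ln (real n)) \<le> real n / 16"
    using ln by (intro divide_left_mono) auto
  moreover have "real ?M1 \<le> real n / (32 * ln (real n))"
    using ln by (intro of_nat_floor) simp
  ultimately have "16 * ?M1 \<le> n" by linarith
  then have "sampling_number d w n \<le> 4 * approx_number d w ?M1"
    by (rule sampling_number_le_approx_number[OF d])
  also have "\<dots> \<le> 8 * approx_number d w ?M1" by (intro mult_right_mono) auto
  finally have 1: "sampling_number d w n \<le> 8 * approx_number d w ?M1" .
  have "real ?M2 \<le> 1 / 16 * real n" by (intro of_nat_floor) simp
  then have "16 * ?M2 \<le> n" by linarith
  then have "sampling_number d w n \<le> 4 * approx_number d w ?M2"
    by (rule sampling_number_le_approx_number[OF d])
  also have "(4::ennreal) \<le> 8 * ennreal (sqrt (ln (real n)))"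
  proof -
    have "1 / 2 \<le> sqrt (ln (real n))" by (rule real_le_rsqrt) (use ln in \<open>simp add: power2_eq_square\<close>)
    then have "ennreal 4 \<le> ennreal (8 * sqrt (ln (real n)))" by (intro ennreal_leI) simp
    then show ?thesis using ln by (simp add: ennreal_mult)
  qed
  finally have 2: "sampling_number d w n \<le> 8 * (ennreal (sqrt (ln (real n))) * approx_number d w ?M2)"
    by (simp add: mult.assoc mult_right_mono)
  show "sampling_number d w n \<le> ennreal 8 * min (approx_number d w ?M1) (ennreal (sqrt (ln (real n))) * approx_number d w ?M2)"
    using 1 2 by (simp add: min_def)
qed auto

end
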